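(* Let $R$ be a $1$-dimensional Cohen--Macaulay local ring admitting a canonical module. If $R$ is almost Gorenstein, then $R$ is nearly Gorenstein.
   Context: Let $(R,\mathfrak m)$ be a Cohen--Macaulay local ring with canonical module $\omega_R$. $R$ is called almost Gorenstein (in the sense of Goto, Takahashi and Taniguchi) if there exists an exact sequence $0\to R\to\omega_R\to C\to 0$ of $R$-modules with $\mu(C)=e(C)$, where $\mu(C)$ is the minimal number of generators of $C$ and $e(C)$ is the multiplicity of $C$ with respect to $\mathfrak m$ ($C=0$ is allowed). For an $R$-module $M$, $\operatorname{tr}(M)=\sum_{\varphi\in\operatorname{Hom}_R(M,R)}\varphi(M)$. $R$ is called nearly Gorenstein if $\mathfrak m\subseteq\operatorname{tr}(\omega_R)$. *)

theory Defs
  imports "HOL-Algebra.Module" "HOL-Algebra.Ideal_Product" "HOL-Algebra.QuotRing"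
    "HOL-Algebra.Ring_Divisibility" "HOL-Library.Extended_Real"
begin

section \<open>Modules over a commutative ring\<close>

definition self_module :: "('a, 'r) ring_scheme \<Rightarrow> ('a, 'a) module" where
  "self_module R = \<lparr>carrier = carrier R, monoid.mult = (\<otimes>\<^bsub>R\<^esub>), one = \<one>\<^bsub>R\<^esub>, zero = \<zero>\<^bsub>R\<^esub>,
     add = (\<oplus>\<^bsub>R\<^esub>), smult = (\<otimes>\<^bsub>R\<^esub>)\<rparr>"

text \<open>The free module of rank \<open>n\<close>, as extensional functions on \<open>{..<n}\<close>. The multiplicative fields
  of a module record carry no meaning; they are left undefined here and below.\<close>
definition free_module :: "('a, 'r) ring_scheme \<Rightarrow> nat \<Rightarrow> ('a, nat \<Rightarrow> 'a) module" where
  "free_module R n = \<lparr>carrier = {..<n} \<rightarrow>\<^sub>E carrier R, monoid.mult = undefined, one = undefined,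
     zero = (\<lambda>i\<in>{..<n}. \<zero>\<^bsub>R\<^esub>), add = (\<lambda>x y. \<lambda>i\<in>{..<n}. x i \<oplus>\<^bsub>R\<^esub> y i),
     smult = (\<lambda>r x. \<lambda>i\<in>{..<n}. r \<otimes>\<^bsub>R\<^esub> x i)\<rparr>"

definition quot_module :: "('a, 'b) module \<Rightarrow> 'b set \<Rightarrow> ('a, 'b set) module" where
  "quot_module M N = \<lparr>carrier = a_rcosets\<^bsub>M\<^esub> N, monoid.mult = undefined, one = undefined,
     zero = N, add = set_add M, smult = (\<lambda>r X. \<Union>x\<in>X. N +>\<^bsub>M\<^esub> (r \<odot>\<^bsub>M\<^esub> x))\<rparr>"

definition module_hom ::
  "('a, 'r) ring_scheme \<Rightarrow> ('a, 'b) module \<Rightarrow> ('a, 'c) module \<Rightarrow> ('b \<Rightarrow> 'c) set" where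
  "module_hom R M N = {f \<in> carrier M \<rightarrow> carrier N.
     (\<forall>x\<in>carrier M. \<forall>y\<in>carrier M. f (x \<oplus>\<^bsub>M\<^esub> y) = f x \<oplus>\<^bsub>N\<^esub> f y) \<and>
     (\<forall>r\<in>carrier R. \<forall>x\<in>carrier M. f (r \<odot>\<^bsub>M\<^esub> x) = r \<odot>\<^bsub>N\<^esub> f x)}"

text \<open>The module \<open>Hom(M, N)\<close>. Its elements are extensional, so that a homomorphism is determined by
  its values on \<open>carrier M\<close>.\<close>
definition hom_module ::
  "('a, 'r) ring_scheme \<Rightarrow> ('a, 'b) module \<Rightarrow> ('a, 'c) module \<Rightarrow> ('a, 'b \<Rightarrow> 'c) module" where
  "hom_module R M N = \<lparr>carrier = module_hom R M N \<inter> extensional (carrier M),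
     monoid.mult = undefined, one = undefined, zero = (\<lambda>x\<in>carrier M. \<zero>\<^bsub>N\<^esub>),
     add = (\<lambda>f g. \<lambda>x\<in>carrier M. f x \<oplus>\<^bsub>N\<^esub> g x),
     smult = (\<lambda>r f. \<lambda>x\<in>carrier M. r \<odot>\<^bsub>N\<^esub> f x)\<rparr>"

definition mspan :: "('a, 'r) ring_scheme \<Rightarrow> ('a, 'b) module \<Rightarrow> 'b set \<Rightarrow> 'b set" where
  "mspan R M S = \<Inter>{N. submodule N R M \<and> S \<subseteq> N}"

text \<open>\<open>\<mu>(M)\<close>; it is \<open>\<infinity>\<close> precisely when \<open>M\<close> is not finitely generated.\<close>
definition min_gens :: "('a, 'r) ring_scheme \<Rightarrow> ('a, 'b) module \<Rightarrow> enat" where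
  "min_gens R M = Inf {enat (card S) | S. finite S \<and> S \<subseteq> carrier M \<and> mspan R M S = carrier M}"

definition ideal_smult :: "('a, 'r) ring_scheme \<Rightarrow> 'a set \<Rightarrow> ('a, 'b) module \<Rightarrow> 'b set" where
  "ideal_smult R I M = mspan R M {a \<odot>\<^bsub>M\<^esub> x | a x. a \<in> I \<and> x \<in> carrier M}"

definition annihilator :: "('a, 'r) ring_scheme \<Rightarrow> ('a, 'b) module \<Rightarrow> 'a set" where
  "annihilator R M = {r \<in> carrier R. \<forall>x\<in>carrier M. r \<odot>\<^bsub>M\<^esub> x = \<zero>\<^bsub>M\<^esub>}"

definition module_length :: "('a, 'r) ring_scheme \<Rightarrow> ('a, 'b) module \<Rightarrow> enat" where
  "module_length R M = Sup {enat n | n. \<exists>N :: nat \<Rightarrow> 'b set.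
     (\<forall>i\<le>n. submodule (N i) R M) \<and> (\<forall>i<n. N i \<subset> N (Suc i))}"


section \<open>Dimension, multiplicity and depth\<close>

text \<open>The supremum over the empty set is \<open>0\<close> in \<^typ>\<open>enat\<close>, so the zero ring gets dimension \<open>0\<close>.\<close>
definition krull_dim :: "('a, 'r) ring_scheme \<Rightarrow> enat" where
  "krull_dim R = Sup {enat n | n. \<exists>P :: nat \<Rightarrow> 'a set.
     (\<forall>i\<le>n. primeideal (P i) R) \<and> (\<forall>i<n. P i \<subset> P (Suc i))}"

definition module_dim :: "('a, 'r) ring_scheme \<Rightarrow> ('a, 'b) module \<Rightarrow> enat" where
  "module_dim R M = krull_dim (R Quot annihilator R M)"

definition noetherian_local_ring :: "('a, 'r) ring_scheme \<Rightarrow> bool" where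
  "noetherian_local_ring R \<longleftrightarrow> cring R \<and> noetherian_ring R \<and> (\<exists>!I. maximalideal I R)"

definition max_ideal :: "('a, 'r) ring_scheme \<Rightarrow> 'a set" where
  "max_ideal R = (THE I. maximalideal I R)"

text \<open>The multiplicity \<open>e(M) = lim r! \<cdot> \<ell>(M / \<mm>\<^sup>n M) / n\<^sup>r\<close> with respect to the maximal ideal, where
  \<open>r = dim M\<close> (not \<open>dim R\<close>). For \<open>M\<close> of finite length this is the length of \<open>M\<close>.\<close>
definition multiplicity_at_max :: "('a, 'r) ring_scheme \<Rightarrow> ('a, 'b) module \<Rightarrow> ereal" where
  "multiplicity_at_max R M = (let r = the_enat (module_dim R M) in
     lim (\<lambda>n::nat. ereal (fact r) * ereal_of_enat (module_length R
            (quot_module M (ideal_smult R (max_ideal R [^]\<^bsub>ideals_set R\<^esub> n) M)))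
          / ereal (real n ^ r)))"

text \<open>\<open>M\<close>-sequences in the maximal ideal: each \<open>x\<^sub>j\<close> is a nonzerodivisor on \<open>M / (x\<^sub>0, \<dots>, x\<^bsub>j-1\<^esub>) M\<close>,
  and \<open>M / (x\<^sub>0, \<dots>, x\<^bsub>n-1\<^esub>) M\<close> is not zero.\<close>
definition nonzerodivisor_on :: "('a, 'b) module \<Rightarrow> 'a \<Rightarrow> bool" where
  "nonzerodivisor_on M a \<longleftrightarrow> (\<forall>y\<in>carrier M. a \<odot>\<^bsub>M\<^esub> y = \<zero>\<^bsub>M\<^esub> \<longrightarrow> y = \<zero>\<^bsub>M\<^esub>)"

definition regular_sequence :: "('a, 'r) ring_scheme \<Rightarrow> ('a, 'b) module \<Rightarrow> 'a list \<Rightarrow> bool" where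
  "regular_sequence R M xs \<longleftrightarrow> set xs \<subseteq> max_ideal R \<and>
     (\<forall>j<length xs. nonzerodivisor_on
        (quot_module M (ideal_smult R (Idl\<^bsub>R\<^esub> (set (take j xs))) M)) (xs ! j)) \<and>
     ideal_smult R (Idl\<^bsub>R\<^esub> (set xs)) M \<noteq> carrier M"

definition depth :: "('a, 'r) ring_scheme \<Rightarrow> ('a, 'b) module \<Rightarrow> enat" where
  "depth R M = Sup {enat (length xs) | xs. regular_sequence R M xs}"

definition cohen_macaulay_local_ring :: "('a, 'r) ring_scheme \<Rightarrow> bool" where
  "cohen_macaulay_local_ring R \<longleftrightarrow>
     noetherian_local_ring R \<and> depth R (self_module R) = krull_dim R"


section \<open>Resolutions, type, and the canonical module\<close>

definition fg_free_resolution :: "('a, 'r) ring_scheme \<Rightarrow> ('a, 'b) module \<Rightarrow> (nat \<Rightarrow> nat) \<Rightarrow>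
    (nat \<Rightarrow> (nat \<Rightarrow> 'a) \<Rightarrow> (nat \<Rightarrow> 'a)) \<Rightarrow> ((nat \<Rightarrow> 'a) \<Rightarrow> 'b) \<Rightarrow> bool" where
  "fg_free_resolution R N b d \<epsilon> \<longleftrightarrow>
     (let F = (\<lambda>i. free_module R (b i)) in
       \<epsilon> \<in> module_hom R (F 0) N \<and> (\<forall>i. d i \<in> module_hom R (F (Suc i)) (F i)) \<and>
       \<epsilon> ` carrier (F 0) = carrier N \<and>
       d 0 ` carrier (F 1) = a_kernel (F 0) N \<epsilon> \<and>
       (\<forall>i. d (Suc i) ` carrier (F (Suc (Suc i))) = a_kernel (F (Suc i)) (F i) (d i)))"

text \<open>The \<open>i\<close>-th cohomology of \<open>Hom(F, M)\<close>, where \<open>F\<close> is the complex of free modules of ranks \<open>b\<close> with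
  differentials \<open>d\<close>. This is \<open>Ext\<^sup>i(N, M)\<close> if \<open>F\<close> is a free resolution of \<open>N\<close>.\<close>
definition hom_cohomology :: "('a, 'r) ring_scheme \<Rightarrow> (nat \<Rightarrow> nat) \<Rightarrow>
    (nat \<Rightarrow> (nat \<Rightarrow> 'a) \<Rightarrow> (nat \<Rightarrow> 'a)) \<Rightarrow> ('a, 'b) module \<Rightarrow> nat \<Rightarrow>
    ('a, ((nat \<Rightarrow> 'a) \<Rightarrow> 'b) set) module" where
  "hom_cohomology R b d M i =
     (let F = (\<lambda>i. free_module R (b i));
          H = (\<lambda>i. hom_module R (F i) M);
          Z = {f \<in> carrier (H i). \<forall>x\<in>carrier (F (Suc i)). f (d i x) = \<zero>\<^bsub>M\<^esub>};
          B = (case i of 0 \<Rightarrow> {\<zero>\<^bsub>H 0\<^esub>}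
               | Suc j \<Rightarrow> (\<lambda>g. \<lambda>x\<in>carrier (F (Suc j)). g (d j x)) ` carrier (H j))
      in quot_module ((H i)\<lparr>carrier := Z\<rparr>) B)"

text \<open>The type of \<open>M\<close> is the dimension over \<open>k = R / \<mm>\<close> of \<open>Ext\<^sup>t(k, M)\<close>, \<open>t = depth M\<close>. As this module
  is annihilated by \<open>\<mm>\<close>, its \<open>k\<close>-dimension is the least number of elements spanning it over \<open>R\<close>.
  The value does not depend on the resolution of \<open>k\<close>, and a resolution by finitely generated free
  modules exists because \<open>R\<close> is Noetherian.\<close>
definition has_cm_type :: "('a, 'r) ring_scheme \<Rightarrow> ('a, 'b) module \<Rightarrow> enat \<Rightarrow> bool" where
  "has_cm_type R M r \<longleftrightarrow> (\<exists>b d \<epsilon>.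
     fg_free_resolution R (quot_module (self_module R) (max_ideal R)) b d \<epsilon> \<and>
     min_gens R (hom_cohomology R b d M (the_enat (depth R M))) = r)"

text \<open>Injective modules. The extension property can only be required for modules \<open>B\<close> with carrier in
  a fixed type. The type \<^typ>\<open>nat \<Rightarrow> 'a\<close> accommodates a copy of \<open>R\<close> (and all finite free modules),
  so by Baer's criterion the property then holds for all modules.\<close>
definition injective_module :: "('a, 'r) ring_scheme \<Rightarrow> ('a, 'e) module \<Rightarrow> bool" where
  "injective_module R E \<longleftrightarrow> module R E \<and>
     (\<forall>(B :: ('a, nat \<Rightarrow> 'a) module) A f.
        module R B \<and> submodule A R B \<and> f \<in> module_hom R (B\<lparr>carrier := A\<rparr>) E \<longrightarrow>
        (\<exists>g \<in> module_hom R B E. \<forall>x\<in>A. g x = f x))"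

definition injective_resolution :: "('a, 'r) ring_scheme \<Rightarrow> ('a, 'b) module \<Rightarrow>
    (nat \<Rightarrow> ('a, 'i) module) \<Rightarrow> (nat \<Rightarrow> 'i \<Rightarrow> 'i) \<Rightarrow> ('b \<Rightarrow> 'i) \<Rightarrow> bool" where
  "injective_resolution R M I d \<eta> \<longleftrightarrow>
     (\<forall>j. injective_module R (I j)) \<and>
     \<eta> \<in> module_hom R M (I 0) \<and> (\<forall>j. d j \<in> module_hom R (I j) (I (Suc j))) \<and>
     inj_on \<eta> (carrier M) \<and>
     \<eta> ` carrier M = a_kernel (I 0) (I 1) (d 0) \<and>
     (\<forall>j. d j ` carrier (I j) = a_kernel (I (Suc j)) (I (Suc (Suc j))) (d (Suc j)))"

text \<open>The type \<^typ>\<open>'i\<close> in which the injective modules live is a parameter: it plays the role of a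
  universe, and statements are to be made for arbitrary \<^typ>\<open>'i\<close>.\<close>
definition finite_injective_dim ::
  "'i itself \<Rightarrow> ('a, 'r) ring_scheme \<Rightarrow> ('a, 'b) module \<Rightarrow> bool" where
  "finite_injective_dim (T :: 'i itself) R M \<longleftrightarrow>
     (\<exists>(I :: nat \<Rightarrow> ('a, 'i) module) d \<eta> n.
        injective_resolution R M I d \<eta> \<and> (\<forall>j>n. carrier (I j) = {\<zero>\<^bsub>I j\<^esub>}))"

text \<open>A canonical module of a Cohen--Macaulay local ring is a maximal Cohen--Macaulay module of
  type \<open>1\<close> and of finite injective dimension.\<close>
definition maximal_cohen_macaulay :: "('a, 'r) ring_scheme \<Rightarrow> ('a, 'b) module \<Rightarrow> bool" where
  "maximal_cohen_macaulay R M \<longleftrightarrow> module R M \<and> min_gens R M < \<infinity> \<and>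
     carrier M \<noteq> {\<zero>\<^bsub>M\<^esub>} \<and> depth R M = krull_dim R"

definition canonical_module ::
  "'i itself \<Rightarrow> ('a, 'r) ring_scheme \<Rightarrow> ('a, 'b) module \<Rightarrow> bool" where
  "canonical_module T R M \<longleftrightarrow>
     maximal_cohen_macaulay R M \<and> has_cm_type R M 1 \<and> finite_injective_dim T R M"


section \<open>Almost and nearly Gorenstein rings\<close>

text \<open>The canonical module \<open>\<omega>\<close> of \<open>R\<close>, unique up to isomorphism, is an argument. The cokernel of a map
  into \<open>\<omega>\<close> is realised by cosets, so it is no restriction to take \<open>C\<close> with carrier in \<^typ>\<open>'b set\<close>.\<close>
definition almost_gorenstein :: "('a, 'r) ring_scheme \<Rightarrow> ('a, 'b) module \<Rightarrow> bool" where
  "almost_gorenstein R \<omega> \<longleftrightarrow> (\<exists>(C :: ('a, 'b set) module) \<phi> \<psi>.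
     module R C \<and> \<phi> \<in> module_hom R (self_module R) \<omega> \<and> \<psi> \<in> module_hom R \<omega> C \<and>
     inj_on \<phi> (carrier R) \<and> \<phi> ` carrier R = a_kernel \<omega> C \<psi> \<and> \<psi> ` carrier \<omega> = carrier C \<and>
     ereal_of_enat (min_gens R C) = multiplicity_at_max R C)"

definition trace_ideal :: "('a, 'r) ring_scheme \<Rightarrow> ('a, 'b) module \<Rightarrow> 'a set" where
  "trace_ideal R M = Idl\<^bsub>R\<^esub> (\<Union>f\<in>module_hom R M (self_module R). f ` carrier M)"

definition nearly_gorenstein :: "('a, 'r) ring_scheme \<Rightarrow> ('a, 'b) module \<Rightarrow> bool" where
  "nearly_gorenstein R \<omega> \<longleftrightarrow> max_ideal R \<subseteq> trace_ideal R \<omega>"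

end

theory Submission
  imports Defs
begin

text \<open>Let \<open>x \<in> \<mm>\<close> be regular on \<open>\<omega>\<close>, hence also on \<open>R \<subseteq> \<omega>\<close>. Since \<open>\<omega>\<close> has type one, the socle of
  \<open>\<omega> / x \<omega>\<close> is simple, and dualising a composition series of \<open>R / x R\<close> gives
  \<open>\<ell>(\<omega> / x \<omega>) \<le> \<ell>(R / x R)\<close>. This inequality forces
  the cokernel \<open>C\<close> of \<open>R \<rightarrow> \<omega>\<close> to be killed by a power of \<open>x\<close>, so \<open>dim C \<le> 0\<close> and \<open>e(C)\<close> is
  the supremum of the lengths of \<open>C / \<mm>\<^sup>n C\<close>. If \<open>\<mm> C\<close> were not zero, \<open>C / \<mm>\<^sup>2 C\<close> would
  already have length greater than \<open>\<mu>(C)\<close>; hence \<open>\<mm> \<omega> \<subseteq> R\<close>. For \<open>a \<in> \<mm>\<close>, multiplication by \<open>a\<close> is then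
  a map \<open>\<omega> \<rightarrow> R\<close> that takes the image of \<open>1\<close> to \<open>a\<close>.\<close>

section \<open>Submodules, spans and quotients\<close>

text \<open>For \<open>x\<close> regular on \<open>M\<close>, the length of M/xM is the multiplicity
  of \<open>x\<close> on \<open>M\<close>. Additivity of multiplicities along 0 -> R -> \<omega> ->
  C -> 0 turns the inequality of lengths modulo \<open>x\<close> into multiplicity \<le> 0 on
  \<open>C\<close>, which is why \<open>C\<close> has finite length. This has to be settled before
  e(C) can be evaluated, since the factor r!/n^r in the multiplicity is taken for r = dim C. No
  additive length function is set up. An upper bound for a length is a chain of steps with simple or
  zero quotients, a lower bound is a chain of strict inclusions, and one half of Jordan-Hoelder
  compares the two. In place of additivity, strict chains between x^N \<omega> and \<omega> are
  concatenated; the loss caused by the intersection of x^N \<omega> with R does not grow with N, so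
  a large N makes it harmless.\<close>

locale plain_module = module R M
  for R :: "('a, 'r) ring_scheme" (structure) and M :: "('a, 'c) module" (structure)
begin

lemma submoduleI_add_smult:
  assumes "H \<subseteq> carrier M" "\<zero>\<^bsub>M\<^esub> \<in> H"
    and "\<And>a b. a \<in> H \<Longrightarrow> b \<in> H \<Longrightarrow> a \<oplus>\<^bsub>M\<^esub> b \<in> H"
    and "\<And>a x. a \<in> carrier R \<Longrightarrow> x \<in> H \<Longrightarrow> a \<odot>\<^bsub>M\<^esub> x \<in> H"
  shows "submodule H R M"
proof (rule submoduleI)
  fix a assume a: "a \<in> H"
  then have "\<ominus>\<^bsub>M\<^esub> a = (\<ominus> \<one>) \<odot>\<^bsub>M\<^esub> a"
    using assms(1) by (auto simp: smult_l_minus)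
  then show "\<ominus>\<^bsub>M\<^esub> a \<in> H" using assms(4)[of "\<ominus> \<one>" a] a by simp
qed (use assms in auto)

lemma submodule_zero:
  assumes "submodule N R M" shows "\<zero>\<^bsub>M\<^esub> \<in> N"
  using subgroup.one_closed[OF submodule.axioms(1)[OF assms]] by simp

lemma submodule_add_cancel:
  assumes N: "submodule N R M" and "u \<in> N" "v \<in> carrier M" "u \<oplus>\<^bsub>M\<^esub> v \<in> N"
  shows "v \<in> N"
proof -
  have "u \<in> carrier M" using submoduleE(1)[OF N] assms(2) by auto
  then have "v = (\<ominus>\<^bsub>M\<^esub> u) \<oplus>\<^bsub>M\<^esub> (u \<oplus>\<^bsub>M\<^esub> v)" using assms(3) by (simp add: M.r_neg1)
  then show ?thesis using submoduleE(5)[OF N submoduleE(3)[OF N assms(2)] assms(4)] by simp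
qed

lemma submodule_add_cancel_right:
  assumes N: "submodule N R M" and "u \<in> N" "v \<in> carrier M" "v \<oplus>\<^bsub>M\<^esub> u \<in> N"
  shows "v \<in> N"
proof -
  have "u \<in> carrier M" using submoduleE(1)[OF N] assms(2) by auto
  then show ?thesis using submodule_add_cancel[OF N assms(2,3)] assms(3,4) by (simp add: M.a_comm)
qed

lemma submodule_Int:
  assumes "submodule A R M" "submodule B R M" shows "submodule (A \<inter> B) R M"
  using submoduleE[OF assms(1)] submoduleE[OF assms(2)] submodule_zero[OF assms(1)]
    submodule_zero[OF assms(2)]
  by (intro submoduleI_add_smult) auto

lemma submodule_Inter:
  assumes "\<And>N. N \<in> F \<Longrightarrow> submodule N R M" "F \<noteq> {}" shows "submodule (\<Inter>F) R M"
proof (rule submoduleI_add_smult)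
  show "\<Inter>F \<subseteq> carrier M" using assms submoduleE(1) by fastforce
qed (use assms submoduleE submodule_zero in auto)

lemma submodule_zero_set: "submodule {\<zero>\<^bsub>M\<^esub>} R M"
  by (rule submoduleI_add_smult) auto

lemma submodule_set_add:
  assumes A: "submodule A R M" and B: "submodule B R M"
  shows "submodule (A <+>\<^bsub>M\<^esub> B) R M"
proof -
  note [simp] = set_add_def'
  have c: "A \<subseteq> carrier M" "B \<subseteq> carrier M" using submoduleE(1) A B by auto
  show ?thesis
  proof (rule submoduleI_add_smult)
    show "\<zero>\<^bsub>M\<^esub> \<in> A <+>\<^bsub>M\<^esub> B" using submodule_zero[OF A] submodule_zero[OF B] by force
  next
    fix x y assume "x \<in> A <+>\<^bsub>M\<^esub> B" "y \<in> A <+>\<^bsub>M\<^esub> B"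
    then obtain a b a' b' where *: "a \<in> A" "b \<in> B" "x = a \<oplus>\<^bsub>M\<^esub> b" "a' \<in> A" "b' \<in> B" "y = a' \<oplus>\<^bsub>M\<^esub> b'"
      by auto
    then have "x \<oplus>\<^bsub>M\<^esub> y = (a \<oplus>\<^bsub>M\<^esub> a') \<oplus>\<^bsub>M\<^esub> (b \<oplus>\<^bsub>M\<^esub> b')"
      using c by (simp add: subset_iff M.add.m_ac)
    moreover have "a \<oplus>\<^bsub>M\<^esub> a' \<in> A" "b \<oplus>\<^bsub>M\<^esub> b' \<in> B" using * submoduleE(5) A B by auto
    ultimately show "x \<oplus>\<^bsub>M\<^esub> y \<in> A <+>\<^bsub>M\<^esub> B" by auto
  next
    fix r x assume r: "r \<in> carrier R" and "x \<in> A <+>\<^bsub>M\<^esub> B"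
    then obtain a b where *: "a \<in> A" "b \<in> B" "x = a \<oplus>\<^bsub>M\<^esub> b" by auto
    then have "r \<odot>\<^bsub>M\<^esub> x = r \<odot>\<^bsub>M\<^esub> a \<oplus>\<^bsub>M\<^esub> r \<odot>\<^bsub>M\<^esub> b"
      using c r by (auto simp: subset_iff smult_r_distr)
    moreover have "r \<odot>\<^bsub>M\<^esub> a \<in> A" "r \<odot>\<^bsub>M\<^esub> b \<in> B" using * r submoduleE(4) A B by auto
    ultimately show "r \<odot>\<^bsub>M\<^esub> x \<in> A <+>\<^bsub>M\<^esub> B" by auto
  qed (use c in auto)
qed

lemma set_add_upper:
  assumes A: "submodule A R M" and B: "submodule B R M"
  shows "A \<subseteq> A <+>\<^bsub>M\<^esub> B" "B \<subseteq> A <+>\<^bsub>M\<^esub> B"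
proof -
  have c: "A \<subseteq> carrier M" "B \<subseteq> carrier M" using submoduleE(1) A B by auto
  have "x = x \<oplus>\<^bsub>M\<^esub> \<zero>\<^bsub>M\<^esub>" if "x \<in> A" for x using that c by auto
  then show "A \<subseteq> A <+>\<^bsub>M\<^esub> B" unfolding set_add_def' using submodule_zero[OF B] by blast
  have "x = \<zero>\<^bsub>M\<^esub> \<oplus>\<^bsub>M\<^esub> x" if "x \<in> B" for x using that c by auto
  then show "B \<subseteq> A <+>\<^bsub>M\<^esub> B" unfolding set_add_def' using submodule_zero[OF A] by blast
qed

lemma set_add_least:
  assumes "submodule N R M" "A \<subseteq> N" "B \<subseteq> N" shows "A <+>\<^bsub>M\<^esub> B \<subseteq> N"
  using submoduleE(5)[OF assms(1)] assms(2,3) unfolding set_add_def' by auto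

lemma set_add_mono: "A \<subseteq> A' \<Longrightarrow> B \<subseteq> B' \<Longrightarrow> A <+>\<^bsub>M\<^esub> B \<subseteq> A' <+>\<^bsub>M\<^esub> B'"
  unfolding set_add_def' by blast

section \<open>Cyclic submodules and colon ideals\<close>

definition cyclic_submodule :: "'c \<Rightarrow> 'c set" where
  "cyclic_submodule a = (\<lambda>r. r \<odot>\<^bsub>M\<^esub> a) ` carrier R"

lemma cyclic_submodule_is_submodule:
  assumes a: "a \<in> carrier M" shows "submodule (cyclic_submodule a) R M"
  unfolding cyclic_submodule_def
proof (rule submoduleI_add_smult)
  show "\<zero>\<^bsub>M\<^esub> \<in> (\<lambda>r. r \<odot>\<^bsub>M\<^esub> a) ` carrier R" using a by (auto intro!: image_eqI[of _ _ \<zero>])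
next
  fix x y assume "x \<in> (\<lambda>r. r \<odot>\<^bsub>M\<^esub> a) ` carrier R" "y \<in> (\<lambda>r. r \<odot>\<^bsub>M\<^esub> a) ` carrier R"
  then obtain r s where "x = r \<odot>\<^bsub>M\<^esub> a" "y = s \<odot>\<^bsub>M\<^esub> a" "r \<in> carrier R" "s \<in> carrier R" by auto
  then show "x \<oplus>\<^bsub>M\<^esub> y \<in> (\<lambda>r. r \<odot>\<^bsub>M\<^esub> a) ` carrier R"
    using a by (auto intro!: image_eqI[of _ _ "r \<oplus> s"] simp: smult_l_distr)
next
  fix r x assume "r \<in> carrier R" "x \<in> (\<lambda>r. r \<odot>\<^bsub>M\<^esub> a) ` carrier R"
  then obtain s where "x = s \<odot>\<^bsub>M\<^esub> a" "s \<in> carrier R" "r \<in> carrier R" by auto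
  then show "r \<odot>\<^bsub>M\<^esub> x \<in> (\<lambda>r. r \<odot>\<^bsub>M\<^esub> a) ` carrier R"
    using a by (auto intro!: image_eqI[of _ _ "r \<otimes> s"] simp: smult_assoc1)
qed (use a in auto)

lemma cyclic_submodule_self: "a \<in> carrier M \<Longrightarrow> a \<in> cyclic_submodule a"
  unfolding cyclic_submodule_def by (auto intro!: image_eqI[of _ _ \<one>])

lemma cyclic_submodule_least: "submodule N R M \<Longrightarrow> a \<in> N \<Longrightarrow> cyclic_submodule a \<subseteq> N"
  unfolding cyclic_submodule_def using submoduleE(4) by auto

lemma mem_add_cyclic:
  "w \<in> A <+>\<^bsub>M\<^esub> cyclic_submodule a \<longleftrightarrow> (\<exists>v\<in>A. \<exists>r\<in>carrier R. w = v \<oplus>\<^bsub>M\<^esub> r \<odot>\<^bsub>M\<^esub> a)"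
  unfolding set_add_def' cyclic_submodule_def by auto

lemma smult_left_commute:
  assumes "a \<in> carrier R" "b \<in> carrier R" "x \<in> carrier M"
  shows "a \<odot>\<^bsub>M\<^esub> (b \<odot>\<^bsub>M\<^esub> x) = b \<odot>\<^bsub>M\<^esub> (a \<odot>\<^bsub>M\<^esub> x)"
  using smult_assoc1[of a b x] smult_assoc1[of b a x] m_comm[of a b] assms by simp

text \<open>Serves for annihilators (\<open>N\<close> zero, \<open>S\<close> the whole carrier) and,
  with \<open>S\<close> a singleton, for the coefficient ideals and colon ideals of a single element
  in the Noetherian arguments.\<close>

lemma ideal_colon:
  assumes N: "submodule N R M" and S: "S \<subseteq> carrier M"
  shows "ideal {r \<in> carrier R. \<forall>x\<in>S. r \<odot>\<^bsub>M\<^esub> x \<in> N} R"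
proof -
  define I where "I = {r \<in> carrier R. \<forall>x\<in>S. r \<odot>\<^bsub>M\<^esub> x \<in> N}"
  have sc: "x \<in> carrier M" if "x \<in> S" for x using that S by auto
  have Ic: "a \<in> carrier R" "\<And>x. x \<in> S \<Longrightarrow> a \<odot>\<^bsub>M\<^esub> x \<in> N" if "a \<in> I" for a
    using that by (simp_all add: I_def)
  have II: "a \<in> I" if "a \<in> carrier R" "\<And>x. x \<in> S \<Longrightarrow> a \<odot>\<^bsub>M\<^esub> x \<in> N" for a
    using that by (simp add: I_def)
  have inv: "\<ominus> a \<in> I" if a: "a \<in> I" for a
    by (rule II) (use Ic[OF a] sc submoduleE(3)[OF N] in \<open>simp_all add: smult_l_minus\<close>)
  have "additive_subgroup I R"
    unfolding additive_subgroup_def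
  proof (rule subgroup.intro)
    show "I \<subseteq> carrier (add_monoid R)" using Ic(1) by auto
    show "\<one>\<^bsub>add_monoid R\<^esub> \<in> I" using II[of \<zero>] sc submodule_zero[OF N] by simp
    fix a assume a: "a \<in> I"
    from inv[OF this] show "inv\<^bsub>add_monoid R\<^esub> a \<in> I" unfolding a_inv_def .
    fix b assume b: "b \<in> I"
    have "a \<oplus> b \<in> I"
      by (rule II) (use Ic[OF a] Ic[OF b] sc submoduleE(5)[OF N] in \<open>simp_all add: smult_l_distr\<close>)
    then show "a \<otimes>\<^bsub>add_monoid R\<^esub> b \<in> I" by simp
  qed
  moreover have l: "x \<otimes> a \<in> I" if a: "a \<in> I" and x: "x \<in> carrier R" for a x
    by (rule II) (use Ic[OF a] x sc submoduleE(4)[OF N] in \<open>simp_all add: smult_assoc1\<close>)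
  moreover have "a \<otimes> x \<in> I" if "a \<in> I" "x \<in> carrier R" for a x
    using l[OF that] m_comm[of a x] Ic(1)[OF that(1)] that(2) by simp
  ultimately show ?thesis
    unfolding I_def[symmetric] by (intro idealI R.ring_axioms) (simp_all add: additive_subgroup_def)
qed

section \<open>Spans and the product of an ideal with a module\<close>

lemma mspan_is_submodule: "S \<subseteq> carrier M \<Longrightarrow> submodule (mspan R M S) R M"
  unfolding mspan_def
  by (rule submodule_Inter) (use carrier_is_submodule in blast)+

lemma mspan_superset: "S \<subseteq> mspan R M S"
  unfolding mspan_def by auto

lemma mspan_least: "submodule N R M \<Longrightarrow> S \<subseteq> N \<Longrightarrow> mspan R M S \<subseteq> N"
  unfolding mspan_def by auto

lemma ideal_smult_is_submodule: "I \<subseteq> carrier R \<Longrightarrow> submodule (ideal_smult R I M) R M"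
  unfolding ideal_smult_def by (rule mspan_is_submodule) auto

lemma ideal_smult_mem: "a \<in> I \<Longrightarrow> x \<in> carrier M \<Longrightarrow> a \<odot>\<^bsub>M\<^esub> x \<in> ideal_smult R I M"
  unfolding ideal_smult_def by (rule subsetD[OF mspan_superset]) blast

lemma ideal_smult_least:
  "submodule N R M \<Longrightarrow> (\<And>a x. a \<in> I \<Longrightarrow> x \<in> carrier M \<Longrightarrow> a \<odot>\<^bsub>M\<^esub> x \<in> N) \<Longrightarrow> ideal_smult R I M \<subseteq> N"
  unfolding ideal_smult_def by (rule mspan_least) blast+

end

section \<open>Homomorphisms, images and preimages\<close>

lemma module_homD:
  assumes "f \<in> module_hom R M N"
  shows "\<And>x. x \<in> carrier M \<Longrightarrow> f x \<in> carrier N"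
    and "\<And>x y. x \<in> carrier M \<Longrightarrow> y \<in> carrier M \<Longrightarrow> f (x \<oplus>\<^bsub>M\<^esub> y) = f x \<oplus>\<^bsub>N\<^esub> f y"
    and "\<And>r x. r \<in> carrier R \<Longrightarrow> x \<in> carrier M \<Longrightarrow> f (r \<odot>\<^bsub>M\<^esub> x) = r \<odot>\<^bsub>N\<^esub> f x"
  using assms unfolding module_hom_def by auto

lemma module_hom_zero:
  assumes "module R M" "module R N" "f \<in> module_hom R M N" shows "f \<zero>\<^bsub>M\<^esub> = \<zero>\<^bsub>N\<^esub>"
proof -
  interpret M: plain_module R M using assms(1) by (rule plain_module.intro)
  interpret N: plain_module R N using assms(2) by (rule plain_module.intro)
  have "f (\<zero>\<^bsub>R\<^esub> \<odot>\<^bsub>M\<^esub> \<zero>\<^bsub>M\<^esub>) = \<zero>\<^bsub>R\<^esub> \<odot>\<^bsub>N\<^esub> f \<zero>\<^bsub>M\<^esub>" by (rule module_homD(3)[OF assms(3)]) auto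
  then show ?thesis using module_homD(1)[OF assms(3)] by simp
qed

lemma submodule_vimage:
  assumes "module R M" "module R N" "f \<in> module_hom R M N" "submodule A R N"
  shows "submodule {x \<in> carrier M. f x \<in> A} R M"
proof -
  interpret M: plain_module R M using assms(1) by (rule plain_module.intro)
  interpret N: plain_module R N using assms(2) by (rule plain_module.intro)
  note f = module_homD[OF assms(3)]
  show ?thesis
    using N.submodule_zero[OF assms(4)] N.submoduleE(4,5)[OF assms(4)] f module_hom_zero[OF assms(1-3)]
    by (intro M.submoduleI_add_smult) (simp_all add: subset_iff)
qed

lemma (in plain_module) smult_hom: "c \<in> carrier R \<Longrightarrow> (\<lambda>x. c \<odot>\<^bsub>M\<^esub> x) \<in> module_hom R M M"
  by (auto simp: module_hom_def smult_r_distr smult_left_commute)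

lemmas (in plain_module) submodule_smult_vimage =
  submodule_vimage[OF module_axioms module_axioms smult_hom]

lemma submodule_image:
  assumes "module R M" "module R N" "f \<in> module_hom R M N" "submodule A R M"
  shows "submodule (f ` A) R N"
proof -
  interpret M: plain_module R M using assms(1) by (rule plain_module.intro)
  interpret N: plain_module R N using assms(2) by (rule plain_module.intro)
  note f = module_homD[OF assms(3)]
  have A: "A \<subseteq> carrier M" using M.submoduleE(1)[OF assms(4)] .
  show ?thesis
  proof (rule N.submoduleI_add_smult)
    show "\<zero>\<^bsub>N\<^esub> \<in> f ` A"
      using module_hom_zero[OF assms(1-3)] M.submodule_zero[OF assms(4)] by (metis imageI)
  next
    fix x y assume "x \<in> f ` A" "y \<in> f ` A"
    then obtain a b where *: "a \<in> A" "x = f a" "b \<in> A" "y = f b" by auto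
    then have "x \<oplus>\<^bsub>N\<^esub> y = f (a \<oplus>\<^bsub>M\<^esub> b)" using f(2) A by (simp add: subset_iff)
    then show "x \<oplus>\<^bsub>N\<^esub> y \<in> f ` A" using M.submoduleE(5)[OF assms(4)] * by auto
  next
    fix r x assume r: "r \<in> carrier R" and "x \<in> f ` A"
    then obtain a where *: "a \<in> A" "x = f a" by auto
    then have "r \<odot>\<^bsub>N\<^esub> x = f (r \<odot>\<^bsub>M\<^esub> a)" using f A r by auto
    then show "r \<odot>\<^bsub>N\<^esub> x \<in> f ` A" using M.submoduleE(4)[OF assms(4)] * r by auto
  qed (use f A in auto)
qed

lemmas (in plain_module) submodule_smult_image =
  submodule_image[OF module_axioms module_axioms smult_hom]

text \<open>The axioms pass along a surjection that respects the operations. Only values of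
  \<open>f\<close> are inspected, so the target may be a record of cosets; quotient modules become
  modules in this way.\<close>

lemma module_surj_image:
  fixes M :: "('a, 'b) module" and N :: "('a, 'c) module"
  assumes "module R M" "carrier N = f ` carrier M"
    and add: "\<And>x y. x \<in> carrier M \<Longrightarrow> y \<in> carrier M \<Longrightarrow> f x \<oplus>\<^bsub>N\<^esub> f y = f (x \<oplus>\<^bsub>M\<^esub> y)"
    and smult: "\<And>r x. r \<in> carrier R \<Longrightarrow> x \<in> carrier M \<Longrightarrow> r \<odot>\<^bsub>N\<^esub> f x = f (r \<odot>\<^bsub>M\<^esub> x)"
    and zero: "\<zero>\<^bsub>N\<^esub> = f \<zero>\<^bsub>M\<^esub>"
  shows "module R N"
proof -
  interpret M: plain_module R M using assms(1) by (rule plain_module.intro)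
  show ?thesis
  proof (rule moduleI)
    show "abelian_group N"
    proof (rule abelian_groupI)
      show "x \<oplus>\<^bsub>N\<^esub> y = y \<oplus>\<^bsub>N\<^esub> x" if "x \<in> carrier N" "y \<in> carrier N" for x y
        using that by (auto simp: assms(2) add M.M.a_comm)
      show "x \<oplus>\<^bsub>N\<^esub> y \<oplus>\<^bsub>N\<^esub> z = x \<oplus>\<^bsub>N\<^esub> (y \<oplus>\<^bsub>N\<^esub> z)"
        if "x \<in> carrier N" "y \<in> carrier N" "z \<in> carrier N" for x y z
        using that by (auto simp: assms(2) add M.M.a_assoc)
    next
      fix x assume "x \<in> carrier N"
      then obtain u where "u \<in> carrier M" "x = f u" using assms(2) by auto
      then show "\<exists>y\<in>carrier N. y \<oplus>\<^bsub>N\<^esub> x = \<zero>\<^bsub>N\<^esub>"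
        by (intro bexI[of _ "f (\<ominus>\<^bsub>M\<^esub> u)"]) (auto simp: assms(2) add zero M.M.l_neg)
    qed (auto simp: assms(2) add zero)
  qed (auto simp: assms(2) add smult M.smult_l_distr M.smult_r_distr M.smult_assoc1 M.R.is_cring)
qed

section \<open>Quotient modules\<close>

context plain_module begin

context fixes N assumes N: "submodule N R M" begin

interpretation abelian_subgroup N M
proof (rule abelian_subgroupI3)
  show "additive_subgroup N M" using N by (auto simp: submodule_def additive_subgroup_def)
qed (rule M.abelian_group_axioms)

lemma quot_module_simps:
  shows quot_module_carrier: "carrier (quot_module M N) = (\<lambda>x. N +>\<^bsub>M\<^esub> x) ` carrier M"
    and quot_module_zero: "\<zero>\<^bsub>quot_module M N\<^esub> = N"
    and quot_module_add: "\<And>x y. x \<in> carrier M \<Longrightarrow> y \<in> carrier M \<Longrightarrow>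
      (N +>\<^bsub>M\<^esub> x) \<oplus>\<^bsub>quot_module M N\<^esub> (N +>\<^bsub>M\<^esub> y) = N +>\<^bsub>M\<^esub> (x \<oplus>\<^bsub>M\<^esub> y)"
    and quot_module_smult: "\<And>r x. r \<in> carrier R \<Longrightarrow> x \<in> carrier M \<Longrightarrow>
      r \<odot>\<^bsub>quot_module M N\<^esub> (N +>\<^bsub>M\<^esub> x) = N +>\<^bsub>M\<^esub> (r \<odot>\<^bsub>M\<^esub> x)"
proof -
  show "carrier (quot_module M N) = (\<lambda>x. N +>\<^bsub>M\<^esub> x) ` carrier M"
    by (simp add: quot_module_def A_RCOSETS_defs a_r_coset_def[symmetric] UNION_singleton_eq_range)
  show "\<zero>\<^bsub>quot_module M N\<^esub> = N" by (simp add: quot_module_def)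
  fix x assume x: "x \<in> carrier M"
  { fix y assume "y \<in> carrier M"
    then show "(N +>\<^bsub>M\<^esub> x) \<oplus>\<^bsub>quot_module M N\<^esub> (N +>\<^bsub>M\<^esub> y) = N +>\<^bsub>M\<^esub> (x \<oplus>\<^bsub>M\<^esub> y)"
      using x by (simp add: quot_module_def a_rcos_sum) }
  fix r assume r: "r \<in> carrier R"
  \<comment> \<open>Scalar multiplication in \<open>quot_module\<close> is a union over all
    representatives. Each of them yields the same coset, so the union runs over a singleton.\<close>
  have "N +>\<^bsub>M\<^esub> (r \<odot>\<^bsub>M\<^esub> z) = N +>\<^bsub>M\<^esub> (r \<odot>\<^bsub>M\<^esub> x)" if z: "z \<in> N +>\<^bsub>M\<^esub> x" for z
  proof -
    obtain h where h: "h \<in> N" "z = h \<oplus>\<^bsub>M\<^esub> x" using z by (auto simp: a_r_coset_def')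
    have hc: "h \<in> carrier M" using h submoduleE(1)[OF N] by auto
    have "r \<odot>\<^bsub>M\<^esub> z = r \<odot>\<^bsub>M\<^esub> h \<oplus>\<^bsub>M\<^esub> r \<odot>\<^bsub>M\<^esub> x" unfolding h(2) by (rule smult_r_distr[OF r hc x])
    then have "r \<odot>\<^bsub>M\<^esub> z \<in> N +>\<^bsub>M\<^esub> (r \<odot>\<^bsub>M\<^esub> x)"
      using a_rcosI[OF submoduleE(4)[OF N r h(1)] submoduleE(1)[OF N] smult_closed[OF r x]] by simp
    then show ?thesis by (rule a_repr_independence'[symmetric]) (rule smult_closed[OF r x])
  qed
  then have "(\<lambda>z. N +>\<^bsub>M\<^esub> (r \<odot>\<^bsub>M\<^esub> z)) ` (N +>\<^bsub>M\<^esub> x) = {N +>\<^bsub>M\<^esub> (r \<odot>\<^bsub>M\<^esub> x)}"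
    using a_rcos_self[OF x] by blast
  then show "r \<odot>\<^bsub>quot_module M N\<^esub> (N +>\<^bsub>M\<^esub> x) = N +>\<^bsub>M\<^esub> (r \<odot>\<^bsub>M\<^esub> x)"
    by (simp only: quot_module_def module.simps cSup_singleton)
qed

lemma coset_eq_iff:
  assumes "x \<in> carrier M" shows "N +>\<^bsub>M\<^esub> x = N \<longleftrightarrow> x \<in> N"
  using assms a_rcos_const a_rcos_self by auto

lemma coset_zero: "N +>\<^bsub>M\<^esub> \<zero>\<^bsub>M\<^esub> = N"
  using coset_eq_iff[of "\<zero>\<^bsub>M\<^esub>"] by simp

lemma quot_module_module: "module R (quot_module M N)"
  by (rule module_surj_image[OF module_axioms, where f = "\<lambda>x. N +>\<^bsub>M\<^esub> x"])
    (simp_all add: quot_module_simps coset_zero)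

lemma quot_proj_hom: "(\<lambda>x. N +>\<^bsub>M\<^esub> x) \<in> module_hom R M (quot_module M N)"
  by (auto simp: module_hom_def quot_module_simps)

end

end

section \<open>Modules over a Noetherian local ring\<close>

text \<open>In a Noetherian ring the union of a nonempty chain of ideals is a member of the chain,
  so it stays in \<open>F\<close> and Zorn's lemma applies to any family of ideals.\<close>

lemma (in noetherian_ring) ideal_family_maximal:
  assumes "F \<noteq> {}" "\<And>I. I \<in> F \<Longrightarrow> ideal I R"
  obtains I where "I \<in> F" "\<And>J. J \<in> F \<Longrightarrow> I \<subseteq> J \<Longrightarrow> J = I"
proof -
  have "\<exists>I\<in>F. \<forall>J\<in>F. I \<subseteq> J \<longrightarrow> J = I"
  proof (rule subset_Zorn_nonempty[OF assms(1)])
    fix C assume C: "C \<noteq> {}" "subset.chain F C"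
    then have "subset.chain {I. ideal I R} C"
      using assms(2) by (auto simp: subset_chain_def)
    from ideal_chain_is_trivial[OF C(1) this] C(2) show "\<Union>C \<in> F"
      by (auto simp: subset_chain_def)
  qed
  then show thesis using that by auto
qed

lemma min_gens_attained:
  assumes fg: "min_gens R M < \<infinity>"
  obtains S where "finite S" "S \<subseteq> carrier M" "mspan R M S = carrier M" "enat (card S) = min_gens R M"
proof -
  let ?A = "{enat (card S) | S. finite S \<and> S \<subseteq> carrier M \<and> mspan R M S = carrier M}"
  \<comment> \<open>The infimum of the empty set is \<infinity>, which \<open>fg\<close> excludes; a
    nonempty set in \<open>enat\<close> attains its infimum by well-ordering.\<close>
  have "?A \<noteq> {}"
  proof
    assume "?A = {}"
    then have "min_gens R M = \<infinity>" unfolding min_gens_def Inf_enat_def by (simp only: if_True simp_thms)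
    then show False using fg by simp
  qed
  then have "Inf ?A \<in> ?A" by (meson ex_in_conv wellorder_InfI)
  then show thesis using that unfolding min_gens_def by auto
qed

text \<open>The maximal ideal is a parameter, so that several modules over the same ring share it.
  The link to \<open>max_ideal R\<close> is a separate assumption where a definition mentions that
  constant.\<close>

locale local_module = plain_module R M
  for R :: "('a, 'r) ring_scheme" (structure) and M :: "('a, 'c) module" (structure) +
  fixes mm :: "'a set"
  assumes maximal: "maximalideal mm R"
    and maximal_unique: "\<And>I. maximalideal I R \<Longrightarrow> I = mm"
    and noetherian: "noetherian_ring R"
begin

lemma mm_ideal: "ideal mm R" and mm_carrier: "a \<in> mm \<Longrightarrow> a \<in> carrier R"
  and mm_prime: "primeideal mm R"
proof -
  interpret mm: maximalideal mm R by (rule maximal)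
  show "ideal mm R" by (rule mm.is_ideal)
  show "a \<in> mm \<Longrightarrow> a \<in> carrier R" by (rule mm.Icarr)
  show "primeideal mm R" by (rule R.maximalideal_prime[OF maximal])
qed

lemma one_notin_mm: "\<one> \<notin> mm"
  using ideal.one_imp_carrier[OF mm_ideal] maximalideal.I_notcarr[OF maximal] by auto

text \<open>An ideal maximal among the proper ideals above \<open>I\<close> is a maximal ideal,
  hence equal to \<open>mm\<close>.\<close>

lemma ideal_le_mm:
  assumes "ideal I R" "\<one> \<notin> I" shows "I \<subseteq> mm"
proof -
  let ?F = "{J. ideal J R \<and> I \<subseteq> J \<and> \<one> \<notin> J}"
  have "I \<in> ?F" using assms by simp
  then have "?F \<noteq> {}" by (metis empty_iff)
  then obtain J where JF: "J \<in> ?F" and mxF: "\<And>K. K \<in> ?F \<Longrightarrow> J \<subseteq> K \<Longrightarrow> K = J"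
    by (rule noetherian_ring.ideal_family_maximal[OF noetherian]) auto
  have J: "ideal J R" "I \<subseteq> J" "\<one> \<notin> J" using JF by auto
  have "maximalideal J R"
  proof (rule maximalidealI[OF J(1)])
    show "carrier R \<noteq> J" using J(3) by auto
    fix K assume K: "ideal K R" "J \<subseteq> K" "K \<subseteq> carrier R"
    show "K = J \<or> K = carrier R"
      using mxF[of K] K J(2) ideal.one_imp_carrier[OF K(1)] by auto
  qed
  then show ?thesis using maximal_unique J(2) by auto
qed

lemma unit_ex:
  assumes "a \<in> carrier R" "a \<notin> mm"
  obtains b where "b \<in> carrier R" "b \<otimes> a = \<one>"
proof -
  have "a \<in> PIdl a" by (rule R.cgenideal_self[OF assms(1)])
  then have "\<one> \<in> PIdl a" using ideal_le_mm[OF R.cgenideal_ideal[OF assms(1)]] assms(2) by blast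
  then show thesis using that unfolding cgenideal_def by force
qed

lemma unit_smult_mem:
  assumes "a \<in> carrier R" "a \<notin> mm" "submodule N R M" "v \<in> carrier M" "a \<odot>\<^bsub>M\<^esub> v \<in> N"
  shows "v \<in> N"
proof -
  obtain b where b: "b \<in> carrier R" "b \<otimes> a = \<one>" using unit_ex[OF assms(1,2)] .
  have "v = b \<odot>\<^bsub>M\<^esub> (a \<odot>\<^bsub>M\<^esub> v)" using smult_assoc1[OF b(1) assms(1,4)] b(2) assms(4) by simp
  then show ?thesis using submoduleE(4)[OF assms(3) b(1) assms(5)] by simp
qed

lemma one_minus_notin_mm:
  assumes "a \<in> mm" shows "\<one> \<ominus> a \<notin> mm"
proof
  assume "\<one> \<ominus> a \<in> mm"
  then have "(\<one> \<ominus> a) \<oplus> a \<in> mm"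
    using assms mm_ideal by (simp add: additive_subgroup.a_closed ideal_def)
  moreover have "(\<one> \<ominus> a) \<oplus> a = \<one>"
    using mm_carrier[OF assms] by (simp add: a_minus_def R.a_assoc R.l_neg)
  ultimately show False using one_notin_mm by simp
qed

text \<open>The chains consist of submodules of \<open>M\<close> and are only intersected with
  \<open>N\<close>. Thus \<open>N\<close> never has to become a module of its own, and an induction
  over generators of \<open>N\<close> can start from the zero submodule.\<close>

definition acc_on :: "'c set \<Rightarrow> bool" where
  "acc_on N \<longleftrightarrow> (\<forall>U :: nat \<Rightarrow> 'c set. (\<forall>n. submodule (U n) R M) \<and> (\<forall>n. U n \<subseteq> U (Suc n)) \<longrightarrow>
     (\<exists>n. \<forall>k\<ge>n. U k \<inter> N \<subseteq> U n))"

lemma acc_on_subset: "acc_on N \<Longrightarrow> N' \<subseteq> N \<Longrightarrow> acc_on N'"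
  unfolding acc_on_def by (meson Int_mono order_refl order_trans)

lemma acc_on_zero: "acc_on {\<zero>\<^bsub>M\<^esub>}"
  unfolding acc_on_def using submodule_zero by auto

text \<open>As for an extension of Noetherian modules: \<open>U k\<close> meets \<open>N\<close> in
  a stable set from \<open>n1\<close> on, and the ideals of coefficients \<open>r\<close> with
  \<open>r a\<close> in N + U k are stable from \<open>n2\<close> on. Both together determine the
  part of \<open>U k\<close> inside N + R a.\<close>

lemma acc_on_add_cyclic:
  assumes N: "submodule N R M" and acc: "acc_on N" and a: "a \<in> carrier M"
  shows "acc_on (N <+>\<^bsub>M\<^esub> cyclic_submodule a)"
  unfolding acc_on_def
proof (intro allI impI, elim conjE)
  fix U :: "nat \<Rightarrow> 'c set" assume U: "\<forall>n. submodule (U n) R M" and inc: "\<forall>n. U n \<subseteq> U (Suc n)"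
  have mono: "U n \<subseteq> U k" if "n \<le> k" for n k using lift_Suc_mono_le[of U] inc that by blast
  obtain n1 where n1: "\<And>k. k \<ge> n1 \<Longrightarrow> U k \<inter> N \<subseteq> U n1" using acc U inc unfolding acc_on_def by blast
  define J where "J n = {r \<in> carrier R. \<forall>x\<in>{a}. r \<odot>\<^bsub>M\<^esub> x \<in> N <+>\<^bsub>M\<^esub> U n}" for n
  have J: "ideal (J n) R" for n
    unfolding J_def by (rule ideal_colon) (use a submodule_set_add N U in auto)
  obtain I where "I \<in> range J" "\<And>K. K \<in> range J \<Longrightarrow> I \<subseteq> K \<Longrightarrow> K = I"
    by (rule noetherian_ring.ideal_family_maximal[OF noetherian, of "range J"]) (use J in auto)
  then obtain n2 where n2: "\<And>k. J n2 \<subseteq> J k \<Longrightarrow> J k = J n2" by (metis rangeE rangeI)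
  have J2: "J k = J n2" if "k \<ge> n2" for k
    by (rule n2) (use set_add_mono[OF order_refl mono[OF that]] in \<open>auto simp: J_def\<close>)
  define n where "n = max n1 n2"
  have "w \<in> U n" if k: "k \<ge> n" and w: "w \<in> U k" "w \<in> N <+>\<^bsub>M\<^esub> cyclic_submodule a" for k w
  proof -
    obtain v r where v: "v \<in> N" and r: "r \<in> carrier R" and wv: "w = v \<oplus>\<^bsub>M\<^esub> r \<odot>\<^bsub>M\<^esub> a"
      using w(2) by (auto simp: mem_add_cyclic)
    have Nc: "N \<subseteq> carrier M" and Uc: "U k \<subseteq> carrier M" "U n \<subseteq> carrier M" using submoduleE(1) N U by auto
    have ra: "r \<odot>\<^bsub>M\<^esub> a \<in> carrier M" using r a by simp
    have vc: "v \<in> carrier M" using v Nc by auto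
    have nv: "\<ominus>\<^bsub>M\<^esub> v \<in> N" using submoduleE(3)[OF N v] .
    have "r \<odot>\<^bsub>M\<^esub> a = (\<ominus>\<^bsub>M\<^esub> v) \<oplus>\<^bsub>M\<^esub> w" using wv ra vc by (simp add: M.r_neg1)
    then have "r \<odot>\<^bsub>M\<^esub> a \<in> N <+>\<^bsub>M\<^esub> U k" using nv w(1) unfolding set_add_def' by blast
    then have "r \<in> J k" using r by (simp add: J_def)
    then have "r \<in> J n" using J2[of k] J2[of n] k by (simp add: n_def)
    \<comment> \<open>The element \<open>u\<close> of \<open>U n\<close> agrees with
      \<open>r a\<close> modulo \<open>N\<close>. So w - u lies in both \<open>U k\<close> and
      \<open>N\<close>, where \<open>n1\<close> takes over.\<close>
    then obtain v' u where v': "v' \<in> N" and u: "u \<in> U n" and e: "r \<odot>\<^bsub>M\<^esub> a = v' \<oplus>\<^bsub>M\<^esub> u"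
      unfolding J_def set_add_def' by auto
    have uk: "u \<in> U k" using u mono[OF k] by auto
    have c: "v' \<in> carrier M" "u \<in> carrier M" using v' u Nc Uc by auto
    have vv: "v \<oplus>\<^bsub>M\<^esub> v' \<in> N" using submoduleE(5)[OF N v v'] .
    have wu: "w = (v \<oplus>\<^bsub>M\<^esub> v') \<oplus>\<^bsub>M\<^esub> u" using wv e vc c by (simp add: M.a_assoc)
    have "v \<oplus>\<^bsub>M\<^esub> v' \<in> U k"
      by (rule submodule_add_cancel_right[OF _ uk]) (use U w(1) wu vc c in auto)
    then have "v \<oplus>\<^bsub>M\<^esub> v' \<in> U n1" using n1[of k] k vv by (auto simp: n_def)
    then have "v \<oplus>\<^bsub>M\<^esub> v' \<in> U n" using mono[of n1 n] by (auto simp: n_def)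
    then show ?thesis unfolding wu using submoduleE(5)[of "U n"] U u by blast
  qed
  then show "\<exists>n. \<forall>k\<ge>n. U k \<inter> (N <+>\<^bsub>M\<^esub> cyclic_submodule a) \<subseteq> U n" by blast
qed

lemma mspan_insert_subset:
  assumes "S \<subseteq> carrier M" "a \<in> carrier M"
  shows "mspan R M (insert a S) \<subseteq> mspan R M S <+>\<^bsub>M\<^esub> cyclic_submodule a"
proof (rule mspan_least)
  note s = mspan_is_submodule[OF assms(1)] cyclic_submodule_is_submodule[OF assms(2)]
  show "submodule (mspan R M S <+>\<^bsub>M\<^esub> cyclic_submodule a) R M" by (rule submodule_set_add[OF s])
  show "insert a S \<subseteq> mspan R M S <+>\<^bsub>M\<^esub> cyclic_submodule a"
    using set_add_upper[OF s] mspan_superset[of S] cyclic_submodule_self[OF assms(2)] by blast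
qed

lemma acc_on_mspan:
  assumes "finite S" "S \<subseteq> carrier M" shows "acc_on (mspan R M S)"
  using assms
proof (induction S)
  case empty
  have "mspan R M {} \<subseteq> {\<zero>\<^bsub>M\<^esub>}" by (rule mspan_least[OF submodule_zero_set]) simp
  then show ?case by (rule acc_on_subset[OF acc_on_zero])
next
  case (insert a S)
  then have c: "S \<subseteq> carrier M" "a \<in> carrier M" by auto
  show ?case
    by (rule acc_on_subset[OF acc_on_add_cyclic[OF mspan_is_submodule[OF c(1)] insert.IH[OF c(1)] c(2)]])
      (rule mspan_insert_subset[OF c])
qed

end

section \<open>Finitely generated modules and Nakayama's lemma\<close>

locale fg_local_module = local_module +
  assumes fg: "min_gens R M < \<infinity>"
begin

lemma acc:
  assumes "\<And>n. submodule (U n) R M" "\<And>n. U n \<subseteq> U (Suc n)"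
  shows "\<exists>n. \<forall>k\<ge>n. U k \<subseteq> U (n :: nat)"
proof -
  obtain S where S: "finite S" "S \<subseteq> carrier M" "mspan R M S = carrier M" by (rule min_gens_attained[OF fg])
  then have "acc_on (carrier M)" using acc_on_mspan by metis
  then obtain n where "\<forall>k\<ge>n. U k \<inter> carrier M \<subseteq> U n" using assms unfolding acc_on_def by blast
  moreover have "U k \<subseteq> carrier M" for k using submoduleE(1)[OF assms(1)] .
  ultimately show ?thesis by blast
qed

lemma submodule_family_maximal:
  assumes "F \<noteq> {}" "\<And>U. U \<in> F \<Longrightarrow> submodule U R M"
  obtains U where "U \<in> F" "\<And>V. V \<in> F \<Longrightarrow> U \<subseteq> V \<Longrightarrow> V = U"
proof (rule ccontr)
  assume "\<not> thesis"
  then have no: "\<And>U. U \<in> F \<Longrightarrow> \<exists>V. V \<in> F \<and> U \<subset> V" using that by (metis psubsetI)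
  have "\<exists>U :: nat \<Rightarrow> 'c set. \<forall>n. U n \<in> F \<and> U n \<subset> U (Suc n)"
    by (rule dependent_nat_choice) (use assms(1) no in auto)
  then obtain U :: "nat \<Rightarrow> 'c set" where U: "\<And>n. U n \<in> F" "\<And>n. U n \<subset> U (Suc n)" by blast
  have "\<exists>n. \<forall>k\<ge>n. U k \<subseteq> U n" by (rule acc) (use U assms(2) in blast)+
  then obtain n where "U (Suc n) \<subseteq> U n" using le_SucI by blast
  then show False using U(2)[of n] by blast
qed

text \<open>For a submodule \<open>T\<close> maximal among those that contain \<open>N\<close> but not \<open>V\<close>, the module
  \<open>(T + V) / T\<close> is simple, so \<open>\<mm>V \<subseteq> T\<close>.\<close>
lemma nakayama:
  assumes N: "submodule N R M" and V: "submodule V R M"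
    and step: "\<And>T. submodule T R M \<Longrightarrow> N \<subseteq> T \<Longrightarrow> (\<And>a v. a \<in> mm \<Longrightarrow> v \<in> V \<Longrightarrow> a \<odot>\<^bsub>M\<^esub> v \<in> T) \<Longrightarrow> V \<subseteq> T"
  shows "V \<subseteq> N"
proof (rule ccontr)
  assume "\<not> V \<subseteq> N"
  let ?F = "{T. submodule T R M \<and> N \<subseteq> T \<and> \<not> V \<subseteq> T}"
  have "N \<in> ?F" using N \<open>\<not> V \<subseteq> N\<close> by simp
  then have "?F \<noteq> {}" by (metis empty_iff)
  then obtain T where TF: "T \<in> ?F" and mx: "\<And>T'. T' \<in> ?F \<Longrightarrow> T \<subseteq> T' \<Longrightarrow> T' = T"
    by (rule submodule_family_maximal) auto
  have T: "submodule T R M" "N \<subseteq> T" "\<not> V \<subseteq> T" using TF by auto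
  have "a \<odot>\<^bsub>M\<^esub> v \<in> T" if a: "a \<in> mm" and v: "v \<in> V" for a v
  proof (rule ccontr)
    assume av: "a \<odot>\<^bsub>M\<^esub> v \<notin> T"
    have vc: "v \<in> carrier M" and ac: "a \<in> carrier R" using v submoduleE(1)[OF V] mm_carrier[OF a] by auto
    let ?w = "a \<odot>\<^bsub>M\<^esub> v"
    have wc: "?w \<in> carrier M" using vc ac by simp
    note cs = cyclic_submodule_is_submodule[OF wc]
    \<comment> \<open>T + R w is strictly larger than \<open>T\<close>, so by maximality it must
      contain \<open>V\<close>.\<close>
    have "V \<subseteq> T <+>\<^bsub>M\<^esub> cyclic_submodule ?w"
    proof (rule ccontr)
      assume "\<not> ?thesis"
      then have "T <+>\<^bsub>M\<^esub> cyclic_submodule ?w = T"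
        using mx[of "T <+>\<^bsub>M\<^esub> cyclic_submodule ?w"] submodule_set_add[OF T(1) cs] set_add_upper[OF T(1) cs] T(2)
        by auto
      then show False using set_add_upper[OF T(1) cs] cyclic_submodule_self[OF wc] av by blast
    qed
    then obtain t r where t: "t \<in> T" and r: "r \<in> carrier R" and e: "v = t \<oplus>\<^bsub>M\<^esub> r \<odot>\<^bsub>M\<^esub> ?w"
      using v mem_add_cyclic by blast
    have ra: "r \<otimes> a \<in> mm" using ideal.I_l_closed[OF mm_ideal a r] .
    have tc: "t \<in> carrier M" using t submoduleE(1)[OF T(1)] by auto
    \<comment> \<open>Substituting w = a v turns v = t + r w into (1 - r a) v = t, and 1 - r a is a
      unit.\<close>
    have "(\<one> \<ominus> r \<otimes> a) \<odot>\<^bsub>M\<^esub> v = v \<oplus>\<^bsub>M\<^esub> \<ominus>\<^bsub>M\<^esub> (r \<odot>\<^bsub>M\<^esub> ?w)"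
      using vc r ac by (simp add: a_minus_def smult_l_distr smult_l_minus smult_assoc1)
    also have "\<dots> = (t \<oplus>\<^bsub>M\<^esub> r \<odot>\<^bsub>M\<^esub> ?w) \<oplus>\<^bsub>M\<^esub> \<ominus>\<^bsub>M\<^esub> (r \<odot>\<^bsub>M\<^esub> ?w)" using e by simp
    also have "\<dots> = t" using tc wc r by (simp add: M.a_assoc M.r_neg)
    finally have "(\<one> \<ominus> r \<otimes> a) \<odot>\<^bsub>M\<^esub> v \<in> T" using t by simp
    then have "v \<in> T" by (intro unit_smult_mem[OF _ one_minus_notin_mm[OF ra] T(1) vc]) (use r ac in simp)
    then show False using av submoduleE(4)[OF T(1) ac] by blast
  qed
  then show False using step[OF T(1,2)] T(3) by blast
qed

end

section \<open>Chains of submodules\<close>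

context local_module begin

text \<open>\<open>simple_step A B\<close> allows \<open>A = B\<close>; otherwise \<open>B / A\<close> is simple.\<close>
definition simple_step :: "'c set \<Rightarrow> 'c set \<Rightarrow> bool" where
  "simple_step A B \<longleftrightarrow> submodule A R M \<and> submodule B R M \<and> A \<subseteq> B \<and>
     (\<exists>a\<in>B. (\<forall>b\<in>mm. b \<odot>\<^bsub>M\<^esub> a \<in> A) \<and> B \<subseteq> A <+>\<^bsub>M\<^esub> cyclic_submodule a)"

text \<open>Counterpart of \<open>simple_step\<close>: n strict steps bound a length from below, n
  simple steps bound it from above. A chain that is both, with the same n, is a composition
  series.\<close>

definition strict_step :: "'c set \<Rightarrow> 'c set \<Rightarrow> bool" where
  "strict_step A B \<longleftrightarrow> submodule A R M \<and> submodule B R M \<and> A \<subset> B"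

lemma simple_stepE:
  assumes "simple_step A B"
  obtains a where "submodule A R M" "submodule B R M" "A \<subseteq> B" "a \<in> B"
    "\<And>b. b \<in> mm \<Longrightarrow> b \<odot>\<^bsub>M\<^esub> a \<in> A"
    "\<And>w. w \<in> B \<Longrightarrow> \<exists>v\<in>A. \<exists>r\<in>carrier R. w = v \<oplus>\<^bsub>M\<^esub> r \<odot>\<^bsub>M\<^esub> a"
  using assms unfolding simple_step_def subset_iff mem_add_cyclic by metis

lemma strict_chain_subset: "(strict_step ^^ k) A B \<Longrightarrow> A \<subseteq> B"
proof (induction k arbitrary: B)
  case (Suc k)
  then obtain C where "(strict_step ^^ k) A C" "strict_step C B" by (auto elim: relpowp_Suc_E)
  then have "A \<subseteq> C" "C \<subseteq> B" using Suc.IH[of C] by (simp, simp add: strict_step_def psubset_imp_subset)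
  then show ?case by simp
qed simp

text \<open>The half of Jordan-Hoelder that bounds strict chains. The rank function imitates the
  length of Y/A: passing from \<open>C\<close> to \<open>B\<close> adds 1 exactly for those
  \<open>Y\<close> that are not contained in \<open>C\<close>.\<close>

lemma simple_chain_rank:
  assumes "(simple_step ^^ n) A B"
  shows "\<exists>d :: 'c set \<Rightarrow> nat. (\<forall>Y. d Y \<le> n) \<and> (\<forall>Y Y'. submodule Y R M \<and> submodule Y' R M \<and>
    A \<subseteq> Y \<and> Y \<subset> Y' \<and> Y' \<subseteq> B \<longrightarrow> d Y < d Y')"
  using assms
proof (induction n arbitrary: B)
  case 0
  then show ?case by (intro exI[of _ "\<lambda>_. 0"]) auto
next
  case (Suc n)
  then obtain C where C: "(simple_step ^^ n) A C" and s: "simple_step C B" by (auto elim: relpowp_Suc_E)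
  obtain d :: "'c set \<Rightarrow> nat" where dd: "(\<forall>Y. d Y \<le> n) \<and> (\<forall>Y Y'. submodule Y R M \<and> submodule Y' R M \<and>
    A \<subseteq> Y \<and> Y \<subset> Y' \<and> Y' \<subseteq> C \<longrightarrow> d Y < d Y')"
    using Suc.IH[OF C] by (rule exE)
  then have d: "\<And>Y. d Y \<le> n" "\<And>Y Y'. submodule Y R M \<Longrightarrow> submodule Y' R M \<Longrightarrow> A \<subseteq> Y \<Longrightarrow>
      Y \<subset> Y' \<Longrightarrow> Y' \<subseteq> C \<Longrightarrow> d Y < d Y'" by simp_all
  obtain a where a: "submodule C R M" "submodule B R M" "C \<subseteq> B" "a \<in> B"
    "\<And>b. b \<in> mm \<Longrightarrow> b \<odot>\<^bsub>M\<^esub> a \<in> C" "\<And>w. w \<in> B \<Longrightarrow> \<exists>v\<in>C. \<exists>r\<in>carrier R. w = v \<oplus>\<^bsub>M\<^esub> r \<odot>\<^bsub>M\<^esub> a"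
    by (rule simple_stepE[OF s], rule that)
  have AC: "A \<subseteq> C" using C
  proof (induction n arbitrary: C)
    case (Suc n)
    then obtain D where D: "(simple_step ^^ n) A D" "simple_step D C" by (auto elim: relpowp_Suc_E)
    have "D \<subseteq> C" using D(2) by (simp add: simple_step_def)
    then show ?case using Suc.IH[OF D(1)] by simp
  qed simp
  have ac: "a \<in> carrier M" using a(4) submoduleE(1)[OF a(2)] by auto
  define d' where "d' Y = d (Y \<inter> C) + (if Y \<subseteq> C then 0 else 1)" for Y
  have "d' Y < d' Y'"
    if Y: "submodule Y R M" "submodule Y' R M" "A \<subseteq> Y" "Y \<subset> Y'" "Y' \<subseteq> B" for Y Y'
  proof (cases "Y \<inter> C = Y' \<inter> C")
    case False
    have "d (Y \<inter> C) < d (Y' \<inter> C)"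
      by (rule d(2)) (use Y AC False submodule_Int a(1) in auto)
    moreover have "Y' \<subseteq> C \<Longrightarrow> Y \<subseteq> C" using Y(4) by auto
    ultimately show ?thesis unfolding d'_def by auto
  next
    case True
    have "\<not> Y' \<subseteq> C" using True Y(4) by auto
    moreover have "Y \<subseteq> C"
    proof (rule ccontr)
      assume "\<not> Y \<subseteq> C"
      then obtain u where u: "u \<in> Y" "u \<notin> C" by auto
      obtain y where y: "y \<in> Y'" "y \<notin> Y" using Y(4) by auto
      have yuB: "y \<in> B" "u \<in> B" using u y Y(4,5) by auto
      obtain v r where v: "v \<in> C" "r \<in> carrier R" "u = v \<oplus>\<^bsub>M\<^esub> r \<odot>\<^bsub>M\<^esub> a" using a(6)[OF yuB(2)] by auto
      obtain v' r' where v': "v' \<in> C" "r' \<in> carrier R" "y = v' \<oplus>\<^bsub>M\<^esub> r' \<odot>\<^bsub>M\<^esub> a" using a(6)[OF yuB(1)] by auto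
      have vc: "v \<in> carrier M" "v' \<in> carrier M" using v(1) v'(1) submoduleE(1)[OF a(1)] by auto
      \<comment> \<open>If r were in \<open>mm\<close>, then \<open>u\<close> would be in
        \<open>C\<close>. With r a unit, \<open>a\<close> lies in Y + C, so \<open>y\<close> is an
        element of \<open>Y\<close> plus some \<open>z\<close> in \<open>C\<close>. This
        \<open>z\<close> also lies in Y', and Y' and Y meet \<open>C\<close> in the same set, so
        \<open>y\<close> falls into \<open>Y\<close>.\<close>
      have "r \<notin> mm" using a(5)[of r] u(2) v submoduleE(5)[OF a(1)] by auto
      then obtain t where t: "t \<in> carrier R" "t \<otimes> r = \<one>" using unit_ex[OF v(2)] by auto
      have "t \<odot>\<^bsub>M\<^esub> u = t \<odot>\<^bsub>M\<^esub> v \<oplus>\<^bsub>M\<^esub> a"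
        using v(2,3) t vc ac smult_assoc1[OF t(1) v(2) ac] by (simp add: smult_r_distr)
      then have "r' \<odot>\<^bsub>M\<^esub> (t \<odot>\<^bsub>M\<^esub> u) = r' \<odot>\<^bsub>M\<^esub> (t \<odot>\<^bsub>M\<^esub> v) \<oplus>\<^bsub>M\<^esub> r' \<odot>\<^bsub>M\<^esub> a"
        using v'(2) t vc ac by (simp add: smult_r_distr)
      then have e: "r' \<odot>\<^bsub>M\<^esub> a = \<ominus>\<^bsub>M\<^esub> (r' \<odot>\<^bsub>M\<^esub> (t \<odot>\<^bsub>M\<^esub> v)) \<oplus>\<^bsub>M\<^esub> r' \<odot>\<^bsub>M\<^esub> (t \<odot>\<^bsub>M\<^esub> u)"
        using v'(2) t vc ac by (simp add: M.r_neg1)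
      define z where "z = v' \<oplus>\<^bsub>M\<^esub> \<ominus>\<^bsub>M\<^esub> (r' \<odot>\<^bsub>M\<^esub> (t \<odot>\<^bsub>M\<^esub> v))"
      have zC: "z \<in> C" unfolding z_def
        by (intro submoduleE(5)[OF a(1)] submoduleE(3)[OF a(1)] submoduleE(4)[OF a(1)] v v' t)
      have uc: "u \<in> carrier M" using yuB submoduleE(1)[OF a(2)] by auto
      have yz: "y = z \<oplus>\<^bsub>M\<^esub> r' \<odot>\<^bsub>M\<^esub> (t \<odot>\<^bsub>M\<^esub> u)"
        unfolding v'(3) e z_def using v'(2) t vc uc by (simp add: M.a_assoc)
      have ru: "r' \<odot>\<^bsub>M\<^esub> (t \<odot>\<^bsub>M\<^esub> u) \<in> Y" by (intro submoduleE(4)[OF Y(1)] v' t u)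
      have "z \<in> Y'"
        by (rule submodule_add_cancel_right[OF Y(2), of "r' \<odot>\<^bsub>M\<^esub> (t \<odot>\<^bsub>M\<^esub> u)"])
          (use ru Y(4) zC submoduleE(1)[OF a(1)] y(1) yz in auto)
      then have "z \<in> Y" using True zC by auto
      then show False using y(2) yz ru submoduleE(5)[OF Y(1)] by auto
    qed
    ultimately show ?thesis using True unfolding d'_def by auto
  qed
  moreover have "d' Y \<le> Suc n" for Y using d(1)[of "Y \<inter> C"] by (simp add: d'_def)
  ultimately show ?case by (intro exI[of _ d']) simp
qed

lemma strict_chain_le_simple_chain:
  assumes n: "(simple_step ^^ n) A B" and k: "(strict_step ^^ k) A' B'" and sub: "A \<subseteq> A'" "B' \<subseteq> B"
  shows "k \<le> n"
proof -
  obtain d :: "'c set \<Rightarrow> nat" where dd: "(\<forall>Y. d Y \<le> n) \<and> (\<forall>Y Y'. submodule Y R M \<and> submodule Y' R M \<and>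
    A \<subseteq> Y \<and> Y \<subset> Y' \<and> Y' \<subseteq> B \<longrightarrow> d Y < d Y')"
    using simple_chain_rank[OF n] by (rule exE)
  then have d: "\<And>Y. d Y \<le> n" "\<And>Y Y'. submodule Y R M \<Longrightarrow> submodule Y' R M \<Longrightarrow> A \<subseteq> Y \<Longrightarrow>
      Y \<subset> Y' \<Longrightarrow> Y' \<subseteq> B \<Longrightarrow> d Y < d Y'" by simp_all
  have "d A' + k \<le> d B'" using k sub(2)
  proof (induction k arbitrary: B')
    case (Suc k)
    then obtain C where C: "(strict_step ^^ k) A' C" "strict_step C B'" by (auto elim: relpowp_Suc_E)
    have "C \<subseteq> B" using C(2) Suc.prems(2) by (auto simp: strict_step_def)
    then have "d A' + k \<le> d C" using Suc.IH[OF C(1)] by simp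
    moreover have "d C < d B'"
      by (rule d(2)) (use C(2) Suc.prems(2) strict_chain_subset[OF C(1)] sub(1) in \<open>auto simp: strict_step_def\<close>)
    ultimately show ?case by simp
  qed simp
  then show ?thesis using d(1)[of B'] by simp
qed

text \<open>Modular law: between \<open>A\<close> and \<open>U\<close> no information is lost by
  adding \<open>B\<close>, because whatever \<open>B\<close> contributes inside \<open>U\<close> is
  already in \<open>A\<close>.\<close>

lemma strict_chain_add:
  assumes B: "submodule B R M" and U: "B \<inter> U \<subseteq> A" and k: "(strict_step ^^ k) A C" and C: "C \<subseteq> U"
    and Um: "submodule U R M"
  shows "(strict_step ^^ k) (B <+>\<^bsub>M\<^esub> A) (B <+>\<^bsub>M\<^esub> C)"
  using k C
proof (induction k arbitrary: C)
  case (Suc k)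
  then obtain D where D: "(strict_step ^^ k) A D" "strict_step D C" by (auto elim: relpowp_Suc_E)
  then have s: "submodule D R M" "submodule C R M" "D \<subset> C" by (auto simp: strict_step_def)
  have "\<not> B <+>\<^bsub>M\<^esub> C \<subseteq> B <+>\<^bsub>M\<^esub> D"
  proof
    assume le: "B <+>\<^bsub>M\<^esub> C \<subseteq> B <+>\<^bsub>M\<^esub> D"
    obtain y where y: "y \<in> C" "y \<notin> D" using s(3) by auto
    have "y \<in> B <+>\<^bsub>M\<^esub> D" using le set_add_upper(2)[OF B s(2)] y(1) by auto
    then obtain b c where b: "b \<in> B" "c \<in> D" "y = b \<oplus>\<^bsub>M\<^esub> c" by (auto simp: set_add_def')
    have "b \<in> U"
      by (rule submodule_add_cancel_right[OF Um, of c])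
        (use b y s(3) Suc.prems(2) submoduleE(1)[OF B] in auto)
    then have "b \<in> D" using U b(1) strict_chain_subset[OF D(1)] by auto
    then show False using submoduleE(5)[OF s(1) _ b(2)] b(3) y(2) by auto
  qed
  then have "strict_step (B <+>\<^bsub>M\<^esub> D) (B <+>\<^bsub>M\<^esub> C)"
    using submodule_set_add[OF B s(1)] submodule_set_add[OF B s(2)] set_add_mono[of B B D C] s(3)
    by (auto simp: strict_step_def)
  moreover have "(strict_step ^^ k) (B <+>\<^bsub>M\<^esub> A) (B <+>\<^bsub>M\<^esub> D)"
    by (rule Suc.IH[OF D(1)]) (use s(3) Suc.prems(2) in auto)
  ultimately show ?case by (rule relpowp_Suc_I[rotated])
qed simp

section \<open>Multiplying chains by a ring element\<close>

abbreviation smult_set :: "'a \<Rightarrow> 'c set \<Rightarrow> 'c set" where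
  "smult_set c A \<equiv> (\<lambda>x. c \<odot>\<^bsub>M\<^esub> x) ` A"

lemma smult_set_mult:
  assumes "a \<in> carrier R" "b \<in> carrier R" "A \<subseteq> carrier M"
  shows "smult_set (a \<otimes> b) A = smult_set a (smult_set b A)"
  unfolding image_image using assms by (intro image_cong) (auto simp: smult_assoc1)

lemma smult_set_mono: "A \<subseteq> B \<Longrightarrow> smult_set c A \<subseteq> smult_set c B"
  by (rule image_mono)

lemma smult_set_subset: "c \<in> carrier R \<Longrightarrow> submodule A R M \<Longrightarrow> smult_set c A \<subseteq> A"
  using submoduleE(4) by auto

text \<open>Multiplication by \<open>c\<close> may collapse the step, which
  \<open>simple_step\<close> permits; hence any \<open>c\<close> is allowed here, whereas strict
  steps survive only under a nonzerodivisor.\<close>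

lemma simple_step_smult:
  assumes c: "c \<in> carrier R" and s: "simple_step A B"
  shows "simple_step (smult_set c A) (smult_set c B)"
proof -
  obtain a where a: "submodule A R M" "submodule B R M" "A \<subseteq> B" "a \<in> B"
    "\<And>b. b \<in> mm \<Longrightarrow> b \<odot>\<^bsub>M\<^esub> a \<in> A" "\<And>w. w \<in> B \<Longrightarrow> \<exists>v\<in>A. \<exists>r\<in>carrier R. w = v \<oplus>\<^bsub>M\<^esub> r \<odot>\<^bsub>M\<^esub> a"
    by (rule simple_stepE[OF s], rule that)
  have ac: "a \<in> carrier M" using a(4) submoduleE(1)[OF a(2)] by auto
  have 1: "b \<odot>\<^bsub>M\<^esub> (c \<odot>\<^bsub>M\<^esub> a) \<in> smult_set c A" if "b \<in> mm" for b
    using a(5)[OF that] smult_left_commute[OF mm_carrier[OF that] c ac] by simp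
  have 2: "w \<in> smult_set c A <+>\<^bsub>M\<^esub> cyclic_submodule (c \<odot>\<^bsub>M\<^esub> a)" if w: "w \<in> smult_set c B" for w
  proof -
    obtain u where u: "u \<in> B" "w = c \<odot>\<^bsub>M\<^esub> u" using w by auto
    obtain v r where v: "v \<in> A" "r \<in> carrier R" "u = v \<oplus>\<^bsub>M\<^esub> r \<odot>\<^bsub>M\<^esub> a" using a(6)[OF u(1)] by auto
    have "v \<in> carrier M" using v(1) submoduleE(1)[OF a(1)] by auto
    then have "w = c \<odot>\<^bsub>M\<^esub> v \<oplus>\<^bsub>M\<^esub> r \<odot>\<^bsub>M\<^esub> (c \<odot>\<^bsub>M\<^esub> a)"
      using u(2) v(2,3) c ac smult_left_commute[OF v(2) c ac] by (simp add: smult_r_distr)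
    then show ?thesis unfolding mem_add_cyclic using v(1,2) by auto
  qed
  show ?thesis
    unfolding simple_step_def
    using submodule_smult_image[OF c a(1)] submodule_smult_image[OF c a(2)] smult_set_mono[OF a(3)] 1 2 a(4)
    by (intro conjI bexI[of _ "c \<odot>\<^bsub>M\<^esub> a"] subsetI ballI) auto
qed

lemma chain_smult:
  assumes "\<And>A B. P A B \<Longrightarrow> P (smult_set c A) (smult_set c B)" "(P ^^ n) A B"
  shows "(P ^^ n) (smult_set c A) (smult_set c B)"
  using assms(2)
proof (induction n arbitrary: B)
  case (Suc n)
  then obtain C where C: "(P ^^ n) A C" "P C B" by (auto elim: relpowp_Suc_E)
  show ?case by (rule relpowp_Suc_I[OF Suc.IH[OF C(1)] assms(1)[OF C(2)]])
qed simp

text \<open>The chain from c U to U is multiplied by c^j for j < N, and the N copies are joined end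
  to end. The relation is left open so that both kinds of step are covered.\<close>

lemma chain_smult_pow:
  assumes c: "c \<in> carrier R" and U: "U \<subseteq> carrier M"
    and P: "\<And>A B. P A B \<Longrightarrow> P (smult_set c A) (smult_set c B)"
    and l: "(P ^^ l) (smult_set c U) U"
  shows "(P ^^ (N * l)) (smult_set (c [^] N) U) U"
proof (induction N)
  case 0
  have "smult_set (c [^] (0::nat)) U = U" using U by (auto simp: subset_iff image_iff)
  then show ?case by simp
next
  case (Suc N)
  have "smult_set (c [^] Suc N) U = smult_set c (smult_set (c [^] N) U)"
    using smult_set_mult[of c "c [^] N" U] c U by (simp add: R.m_comm)
  then have "(P ^^ (N * l)) (smult_set (c [^] Suc N) U) (smult_set c U)"
    using chain_smult[OF P Suc.IH] by simp
  from relpowp_add[of "N * l" l P] this l show ?case by (auto simp: add.commute relcompp.simps)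
qed

end

section \<open>Comparing lengths modulo a regular element\<close>

context local_module begin

text \<open>The usual argument for associated primes: a maximal member among the colon ideals (J :
  b), with \<open>b\<close> in R a outside \<open>J\<close>, is prime. If t b is outside
  \<open>J\<close>, then (J : b) is contained in (J : t b), so the two agree, and s t in (J : b)
  puts \<open>s\<close> into (J : t b) = (J : b).\<close>

lemma colon_element_prime:
  assumes J: "submodule J R M" and a: "a \<in> carrier M" "a \<notin> J"
  obtains b where "b \<in> cyclic_submodule a" "b \<notin> J" "primeideal {s \<in> carrier R. s \<odot>\<^bsub>M\<^esub> b \<in> J} R"
proof -
  define colon where "colon b = {s \<in> carrier R. \<forall>x\<in>{b}. s \<odot>\<^bsub>M\<^esub> x \<in> J}" for b
  let ?F = "colon ` (cyclic_submodule a - J)"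
  note cs = cyclic_submodule_is_submodule[OF a(1)]
  have cc: "b \<in> carrier M" if "b \<in> cyclic_submodule a" for b using that submoduleE(1)[OF cs] by auto
  have ideal: "ideal (colon b) R" if "b \<in> cyclic_submodule a" for b
    unfolding colon_def using cc[OF that] by (intro ideal_colon[OF J]) auto
  have "a \<in> cyclic_submodule a - J" using cyclic_submodule_self[OF a(1)] a(2) by simp
  then have "?F \<noteq> {}" by (metis empty_iff imageI)
  then obtain P where P: "P \<in> ?F" and mx: "\<And>Q. Q \<in> ?F \<Longrightarrow> P \<subseteq> Q \<Longrightarrow> Q = P"
    by (rule noetherian_ring.ideal_family_maximal[OF noetherian]) (use ideal in auto)
  obtain b where b: "b \<in> cyclic_submodule a" "b \<notin> J" "P = colon b" using P by auto
  note bc = cc[OF b(1)]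
  have "primeideal (colon b) R"
  proof (rule primeidealI[OF ideal[OF b(1)] R.is_cring])
    have "\<one> \<notin> colon b" using b(2) bc by (simp add: colon_def)
    then show "carrier R \<noteq> colon b" by auto
    fix s t assume st: "s \<in> carrier R" "t \<in> carrier R" "s \<otimes> t \<in> colon b"
    show "s \<in> colon b \<or> t \<in> colon b"
    proof (cases "t \<in> colon b")
      case False
      then have "t \<odot>\<^bsub>M\<^esub> b \<in> cyclic_submodule a - J"
        using st(2) submoduleE(4)[OF cs st(2) b(1)] by (simp add: colon_def)
      moreover have "r \<odot>\<^bsub>M\<^esub> (t \<odot>\<^bsub>M\<^esub> b) \<in> J" if r: "r \<in> colon b" for r
        using r submoduleE(4)[OF J st(2), of "r \<odot>\<^bsub>M\<^esub> b"] smult_left_commute[of r t b] st(2) bc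
        by (simp add: colon_def)
      then have "P \<subseteq> colon (t \<odot>\<^bsub>M\<^esub> b)" unfolding b(3) by (auto simp: colon_def)
      ultimately have "colon (t \<odot>\<^bsub>M\<^esub> b) = colon b" using mx b(3) by auto
      moreover have "s \<in> colon (t \<odot>\<^bsub>M\<^esub> b)" using st bc by (simp add: colon_def smult_assoc1)
      ultimately show ?thesis by simp
    qed simp
  qed
  moreover have "colon b = {s \<in> carrier R. s \<odot>\<^bsub>M\<^esub> b \<in> J}" by (simp add: colon_def)
  ultimately show thesis using that b(1,2) by simp
qed

lemma strict_step_smult:
  assumes c: "c \<in> carrier R" "nonzerodivisor_on M c" and s: "strict_step A B"
  shows "strict_step (smult_set c A) (smult_set c B)"
proof -
  have AB: "submodule A R M" "submodule B R M" "A \<subset> B" using s by (auto simp: strict_step_def)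
  obtain y where y: "y \<in> B" "y \<notin> A" using AB(3) by auto
  have yc: "y \<in> carrier M" using y(1) submoduleE(1)[OF AB(2)] by auto
  have "c \<odot>\<^bsub>M\<^esub> y \<notin> smult_set c A"
  proof
    assume "c \<odot>\<^bsub>M\<^esub> y \<in> smult_set c A"
    then obtain u where u: "u \<in> A" "c \<odot>\<^bsub>M\<^esub> y = c \<odot>\<^bsub>M\<^esub> u" by auto
    have uc: "u \<in> carrier M" using u(1) submoduleE(1)[OF AB(1)] by auto
    have "c \<odot>\<^bsub>M\<^esub> (y \<oplus>\<^bsub>M\<^esub> \<ominus>\<^bsub>M\<^esub> u) = \<zero>\<^bsub>M\<^esub>"
      using u(2) uc yc c(1) by (simp add: smult_r_distr smult_r_minus M.r_neg)
    then have "y \<oplus>\<^bsub>M\<^esub> \<ominus>\<^bsub>M\<^esub> u = \<zero>\<^bsub>M\<^esub>" using c(2) uc yc unfolding nonzerodivisor_on_def by simp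
    moreover have "y = (y \<oplus>\<^bsub>M\<^esub> \<ominus>\<^bsub>M\<^esub> u) \<oplus>\<^bsub>M\<^esub> u" using uc yc by (simp add: M.a_assoc M.l_neg)
    ultimately have "y = u" using uc by simp
    then show False using u(1) y(2) by simp
  qed
  then have "smult_set c A \<subset> smult_set c B" using smult_set_mono[of A B c] AB(3) y(1) by auto
  then show ?thesis
    using submodule_smult_image[OF c(1)] AB(1,2) by (simp add: strict_step_def)
qed

text \<open>The ideals \<open>I\<close> of the chain \<open>I e\<close> from \<open>x e R\<close> to \<open>e R\<close> give the submodules
  \<open>{w. I w \<subseteq> x M}\<close>, and consecutive quotients of these embed into the socle of \<open>M / x M\<close>.\<close>
lemma socle_chain:
  assumes x: "x \<in> carrier R" and e: "e \<in> carrier M"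
    and faithful: "\<And>r. r \<in> carrier R \<Longrightarrow> r \<odot>\<^bsub>M\<^esub> e = \<zero>\<^bsub>M\<^esub> \<Longrightarrow> r = \<zero>"
    and socle: "\<And>w w'. w \<in> carrier M \<Longrightarrow> w' \<in> carrier M \<Longrightarrow>
      (\<And>b. b \<in> mm \<Longrightarrow> b \<odot>\<^bsub>M\<^esub> w \<in> smult_set x (carrier M)) \<Longrightarrow>
      (\<And>b. b \<in> mm \<Longrightarrow> b \<odot>\<^bsub>M\<^esub> w' \<in> smult_set x (carrier M)) \<Longrightarrow>
      w \<notin> smult_set x (carrier M) \<Longrightarrow> w' \<in> smult_set x (carrier M) <+>\<^bsub>M\<^esub> cyclic_submodule w"
    and chain: "(simple_step ^^ l) (smult_set x (cyclic_submodule e)) (cyclic_submodule e)"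
  shows "(simple_step ^^ l) (smult_set x (carrier M)) (carrier M)"
proof -
  let ?xM = "smult_set x (carrier M)" and ?U = "cyclic_submodule e"
  note xM = submodule_smult_image[OF x carrier_is_submodule]
  define W where "W A = {w \<in> carrier M. \<forall>r\<in>carrier R. r \<odot>\<^bsub>M\<^esub> e \<in> A \<longrightarrow> r \<odot>\<^bsub>M\<^esub> w \<in> ?xM}" for A
  have W: "submodule (W A) R M" if A: "submodule A R M" for A
  proof (rule submoduleI_add_smult)
    show "\<zero>\<^bsub>M\<^esub> \<in> W A" using submodule_zero[OF xM] by (simp add: W_def)
    fix w w' assume "w \<in> W A" "w' \<in> W A"
    then show "w \<oplus>\<^bsub>M\<^esub> w' \<in> W A" using submoduleE(5)[OF xM] by (simp add: W_def smult_r_distr)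
  next
    fix r w assume r: "r \<in> carrier R" and w: "w \<in> W A"
    then show "r \<odot>\<^bsub>M\<^esub> w \<in> W A" using submoduleE(4)[OF xM r] smult_left_commute[OF _ r] by (simp add: W_def)
  qed (auto simp: W_def)
  have Wstep: "simple_step (W B) (W A)" if s: "simple_step A B" and BU: "B \<subseteq> ?U" for A B
  proof -
    obtain a where a: "submodule A R M" "submodule B R M" "A \<subseteq> B" "a \<in> B"
      "\<And>b. b \<in> mm \<Longrightarrow> b \<odot>\<^bsub>M\<^esub> a \<in> A" "\<And>w. w \<in> B \<Longrightarrow> \<exists>v\<in>A. \<exists>r\<in>carrier R. w = v \<oplus>\<^bsub>M\<^esub> r \<odot>\<^bsub>M\<^esub> a"
      by (rule simple_stepE[OF s], rule that)
    obtain s where s: "s \<in> carrier R" "a = s \<odot>\<^bsub>M\<^esub> e" using BU a(4) by (auto simp: cyclic_submodule_def)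
    have Wc: "w \<in> carrier M" if "w \<in> W A" for w using that by (simp add: W_def)
    have W_antimono: "W B \<subseteq> W A" using a(3) by (auto simp: W_def)
    \<comment> \<open>For \<open>w\<close> in \<open>W A\<close>, the product s w represents a socle
      element of M/xM, because \<open>mm\<close> takes a = s e into \<open>A\<close>.\<close>
    have soc: "b \<odot>\<^bsub>M\<^esub> (s \<odot>\<^bsub>M\<^esub> w) \<in> ?xM" if w: "w \<in> W A" and b: "b \<in> mm" for b w
    proof -
      note bc = mm_carrier[OF b]
      have "(b \<otimes> s) \<odot>\<^bsub>M\<^esub> e \<in> A" using a(5)[OF b] s bc e by (simp add: smult_assoc1)
      then have "(b \<otimes> s) \<odot>\<^bsub>M\<^esub> w \<in> ?xM" using w bc s(1) unfolding W_def by simp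
      then show ?thesis using s(1) bc Wc[OF w] by (simp add: smult_assoc1)
    qed
    \<comment> \<open>\<open>W B\<close> is the kernel of multiplication by \<open>s\<close> from
      \<open>W A\<close> to M/xM: an \<open>r\<close> with r e in \<open>B\<close> differs from a
      multiple of \<open>s\<close> by a coefficient belonging to \<open>A\<close>.\<close>
    have WB_I: "w \<in> W B" if w: "w \<in> W A" and sw: "s \<odot>\<^bsub>M\<^esub> w \<in> ?xM" for w
    proof -
      note wc = Wc[OF w]
      have "r \<odot>\<^bsub>M\<^esub> w \<in> ?xM" if r: "r \<in> carrier R" "r \<odot>\<^bsub>M\<^esub> e \<in> B" for r
      proof -
        obtain v t where v: "v \<in> A" "t \<in> carrier R" "r \<odot>\<^bsub>M\<^esub> e = v \<oplus>\<^bsub>M\<^esub> t \<odot>\<^bsub>M\<^esub> a" using a(6)[OF r(2)] by auto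
        have vc: "v \<in> carrier M" using v(1) submoduleE(1)[OF a(1)] by auto
        have "(r \<ominus> t \<otimes> s) \<odot>\<^bsub>M\<^esub> e = r \<odot>\<^bsub>M\<^esub> e \<oplus>\<^bsub>M\<^esub> \<ominus>\<^bsub>M\<^esub> (t \<odot>\<^bsub>M\<^esub> a)"
          using s v(2) r(1) e by (simp add: a_minus_def smult_l_distr smult_l_minus smult_assoc1)
        also have "\<dots> = v" using v vc s e by (simp add: M.a_assoc M.r_neg)
        finally have "(r \<ominus> t \<otimes> s) \<odot>\<^bsub>M\<^esub> w \<in> ?xM" using w v(1,2) r(1) s(1) by (simp add: W_def)
        moreover have "t \<odot>\<^bsub>M\<^esub> (s \<odot>\<^bsub>M\<^esub> w) \<in> ?xM" by (rule submoduleE(4)[OF xM v(2) sw])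
        moreover have "r \<odot>\<^bsub>M\<^esub> w = (r \<ominus> t \<otimes> s) \<odot>\<^bsub>M\<^esub> w \<oplus>\<^bsub>M\<^esub> t \<odot>\<^bsub>M\<^esub> (s \<odot>\<^bsub>M\<^esub> w)"
          using s(1) v(2) r(1) wc
          by (simp add: a_minus_def smult_l_distr smult_l_minus smult_assoc1 M.a_assoc M.l_neg)
        ultimately show ?thesis using submoduleE(5)[OF xM] by simp
      qed
      then show ?thesis using wc by (simp add: W_def)
    qed
    show ?thesis
    \<comment> \<open>W A / W B thus embeds by \<open>s\<close> into a socle that any nonzero
      element spans. Either the image is zero and the step is trivial, or one \<open>w\<close> with
      nonzero image generates \<open>W A\<close> modulo \<open>W B\<close>.\<close>
    proof (cases "\<exists>w\<in>W A. s \<odot>\<^bsub>M\<^esub> w \<notin> ?xM")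
      case False
      then have WA: "W A = W B" using W_antimono WB_I by auto
      have z: "\<zero>\<^bsub>M\<^esub> \<in> W B" using submodule_zero[OF W[OF a(2)]] .
      show ?thesis
        unfolding simple_step_def WA
        using W[OF a(2)] z set_add_upper(1)[OF W[OF a(2)] cyclic_submodule_is_submodule[of "\<zero>\<^bsub>M\<^esub>"]] mm_carrier
        by (intro conjI bexI[of _ "\<zero>\<^bsub>M\<^esub>"]) auto
    next
      case True
      then obtain w where w: "w \<in> W A" "s \<odot>\<^bsub>M\<^esub> w \<notin> ?xM" by auto
      note wc = Wc[OF w(1)]
      have 1: "b \<odot>\<^bsub>M\<^esub> w \<in> W B" if b: "b \<in> mm" for b
        by (rule WB_I) (use submoduleE(4)[OF W[OF a(1)] mm_carrier[OF b] w(1)] soc[OF w(1) b]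
          smult_left_commute[OF s(1) mm_carrier[OF b] wc] in simp_all)
      have 2: "w' \<in> W B <+>\<^bsub>M\<^esub> cyclic_submodule w" if w': "w' \<in> W A" for w'
      proof -
        note w'c = Wc[OF w']
        have "s \<odot>\<^bsub>M\<^esub> w' \<in> ?xM <+>\<^bsub>M\<^esub> cyclic_submodule (s \<odot>\<^bsub>M\<^esub> w)"
          by (rule socle) (use soc[OF w'] soc[OF w(1)] w(2) s(1) wc w'c in simp_all)
        then obtain v r where v: "v \<in> ?xM" "r \<in> carrier R" "s \<odot>\<^bsub>M\<^esub> w' = v \<oplus>\<^bsub>M\<^esub> r \<odot>\<^bsub>M\<^esub> (s \<odot>\<^bsub>M\<^esub> w)"
          unfolding mem_add_cyclic by auto
        have vc: "v \<in> carrier M" using v(1) submoduleE(1)[OF xM] by auto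
        define u where "u = w' \<oplus>\<^bsub>M\<^esub> \<ominus>\<^bsub>M\<^esub> (r \<odot>\<^bsub>M\<^esub> w)"
        have uA: "u \<in> W A" unfolding u_def
          by (intro submoduleE(5)[OF W[OF a(1)]] submoduleE(3)[OF W[OF a(1)]] submoduleE(4)[OF W[OF a(1)]] w(1) w' v(2))
        have "s \<odot>\<^bsub>M\<^esub> u = s \<odot>\<^bsub>M\<^esub> w' \<oplus>\<^bsub>M\<^esub> \<ominus>\<^bsub>M\<^esub> (r \<odot>\<^bsub>M\<^esub> (s \<odot>\<^bsub>M\<^esub> w))"
          unfolding u_def using s(1) v(2) wc w'c smult_left_commute[OF s(1) v(2) wc]
          by (simp add: smult_r_distr smult_r_minus)
        also have "\<dots> = v" unfolding v(3) using vc v(2) s(1) wc by (simp add: M.a_assoc M.r_neg)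
        finally have "u \<in> W B" using WB_I[OF uA] v(1) by simp
        moreover have "w' = u \<oplus>\<^bsub>M\<^esub> r \<odot>\<^bsub>M\<^esub> w" unfolding u_def using wc w'c v(2) by (simp add: M.a_assoc M.l_neg)
        ultimately show ?thesis unfolding mem_add_cyclic using v(2) by auto
      qed
      show ?thesis unfolding simple_step_def using W[OF a(1)] W[OF a(2)] W_antimono w(1) 1 2 by auto
    qed
  qed
  \<comment> \<open>\<open>W\<close> reverses inclusions, so the chain is traversed
    backwards.\<close>
  have dual: "(simple_step ^^ k) (W B) (W A)" if "(simple_step ^^ k) A B" "B \<subseteq> ?U" for k A B
    using that
  proof (induction k arbitrary: B)
    case (Suc k)
    then obtain C where C: "(simple_step ^^ k) A C" "simple_step C B" by (auto elim: relpowp_Suc_E)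
    have "C \<subseteq> ?U" using C(2) Suc.prems(2) unfolding simple_step_def by (meson order_trans)
    then have "(simple_step ^^ k) (W C) (W A)" using Suc.IH[OF C(1)] by simp
    then show ?case using Wstep[OF C(2) Suc.prems(2)] by (intro relpowp_Suc_I2)
  qed simp
  \<comment> \<open>For R e the coefficient ideal contains 1, which leaves xM. For x R e it is xR by
    faithfulness, and then every \<open>w\<close> qualifies.\<close>
  have "W ?U = ?xM"
  proof
    show "W ?U \<subseteq> ?xM"
    proof
      fix w assume w: "w \<in> W ?U"
      then have "\<one> \<odot>\<^bsub>M\<^esub> e \<in> ?U \<longrightarrow> \<one> \<odot>\<^bsub>M\<^esub> w \<in> ?xM" unfolding W_def using R.one_closed by blast
      then have "\<one> \<odot>\<^bsub>M\<^esub> w \<in> ?xM" using cyclic_submodule_self[OF e] e by simp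
      then show "w \<in> ?xM" using w by (simp add: W_def del: image_iff)
    qed
    show "?xM \<subseteq> W ?U" using submoduleE(1,4)[OF xM] by (auto simp: W_def simp del: image_iff)
  qed
  moreover have "W (smult_set x ?U) = carrier M"
  proof
    show "carrier M \<subseteq> W (smult_set x ?U)"
    proof
      fix w assume w: "w \<in> carrier M"
      have "r \<odot>\<^bsub>M\<^esub> w \<in> ?xM" if r: "r \<in> carrier R" "r \<odot>\<^bsub>M\<^esub> e \<in> smult_set x ?U" for r
      proof -
        obtain t where t: "t \<in> carrier R" "r \<odot>\<^bsub>M\<^esub> e = x \<odot>\<^bsub>M\<^esub> (t \<odot>\<^bsub>M\<^esub> e)"
          using r(2) by (auto simp: cyclic_submodule_def)
        have "(r \<ominus> x \<otimes> t) \<odot>\<^bsub>M\<^esub> e = \<zero>\<^bsub>M\<^esub>"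
          using t r(1) x e by (simp add: a_minus_def smult_l_distr smult_l_minus smult_assoc1 M.r_neg)
        then have "r \<ominus> x \<otimes> t = \<zero>" using faithful r(1) x t(1) by simp
        then have "r = x \<otimes> t" using r(1) x t(1) by simp
        then have "r \<odot>\<^bsub>M\<^esub> w = x \<odot>\<^bsub>M\<^esub> (t \<odot>\<^bsub>M\<^esub> w)" using x t(1) w by (simp add: smult_assoc1)
        then show ?thesis using t(1) w by simp
      qed
      then show "w \<in> W (smult_set x ?U)" using w by (simp add: W_def)
    qed
  qed (auto simp: W_def)
  ultimately show ?thesis using dual[OF chain] by simp
qed

end

section \<open>Composition series and powers of a regular element\<close>

context fg_local_module begin

text \<open>Noetherian induction: a cyclic module modulo a proper submodule contains an element whose
  annihilator is prime, hence equal to \<open>\<mm>\<close>.\<close>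
lemma composition_series:
  assumes x: "x \<in> carrier R" and e: "e \<in> carrier M"
    and primes: "\<And>P. primeideal P R \<Longrightarrow> x \<in> P \<Longrightarrow> P = mm"
  obtains l where "(simple_step ^^ l) (smult_set x (cyclic_submodule e)) (cyclic_submodule e)"
    "(strict_step ^^ l) (smult_set x (cyclic_submodule e)) (cyclic_submodule e)"
proof -
  let ?U = "cyclic_submodule e"
  let ?J0 = "smult_set x ?U"
  note U = cyclic_submodule_is_submodule[OF e]
  \<comment> \<open>One \<open>l\<close> serves both relations, so it is the exact length of
    U/J.\<close>
  define good where "good J = (\<exists>l. (simple_step ^^ l) J ?U \<and> (strict_step ^^ l) J ?U)" for J
  let ?F = "{J. submodule J R M \<and> ?J0 \<subseteq> J \<and> J \<subseteq> ?U \<and> \<not> good J}"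
  have "good ?J0"
  proof (rule ccontr)
    assume "\<not> good ?J0"
    then have "?J0 \<in> ?F" using submodule_smult_image[OF x U] smult_set_subset[OF x U] by simp
    then have "?F \<noteq> {}" by (metis empty_iff)
    then obtain J where JF: "J \<in> ?F" and mx: "\<And>K. K \<in> ?F \<Longrightarrow> J \<subseteq> K \<Longrightarrow> K = J"
      by (rule submodule_family_maximal) auto
    have J: "submodule J R M" "?J0 \<subseteq> J" "J \<subseteq> ?U" "\<not> good J" using JF by auto
    have "good ?U" unfolding good_def by (intro exI[of _ 0]) simp
    then have "J \<noteq> ?U" using J(4) by auto
    then obtain a where a: "a \<in> ?U" "a \<notin> J" using J(3) by auto
    have ac: "a \<in> carrier M" using a(1) submoduleE(1)[OF U] by auto
    obtain b where b: "b \<in> cyclic_submodule a" "b \<notin> J" and P: "primeideal {s \<in> carrier R. s \<odot>\<^bsub>M\<^esub> b \<in> J} R"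
      by (rule colon_element_prime[OF J(1) ac a(2)])
    have bU: "b \<in> ?U" using cyclic_submodule_least[OF U a(1)] b(1) by auto
    then have "x \<odot>\<^bsub>M\<^esub> b \<in> J" using J(2) by auto
    \<comment> \<open>This prime contains \<open>x\<close>, since \<open>b\<close> lies in
      \<open>U\<close> and x U lies in \<open>J\<close>.\<close>
    then have "{s \<in> carrier R. s \<odot>\<^bsub>M\<^esub> b \<in> J} = mm" using primes[OF P] x by simp
    then have mb: "s \<odot>\<^bsub>M\<^esub> b \<in> J" if "s \<in> mm" for s using that by auto
    have bc: "b \<in> carrier M" using bU submoduleE(1)[OF U] by auto
    note cs = cyclic_submodule_is_submodule[OF bc]
    let ?K = "J <+>\<^bsub>M\<^esub> cyclic_submodule b"
    have K: "submodule ?K R M" "J \<subseteq> ?K" "b \<in> ?K" "?K \<subseteq> ?U"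
      using submodule_set_add[OF J(1) cs] set_add_upper[OF J(1) cs] cyclic_submodule_self[OF bc]
        set_add_least[OF U J(3) cyclic_submodule_least[OF U bU]] by auto
    have "?K \<notin> ?F" using mx[of ?K] K(2,3) b(2) by auto
    then have "good ?K" using K J(2) by auto
    then obtain l where l: "(simple_step ^^ l) ?K ?U" "(strict_step ^^ l) ?K ?U" by (auto simp: good_def)
    have "simple_step J ?K" unfolding simple_step_def using J(1) K mb by auto
    moreover have "strict_step J ?K" unfolding strict_step_def using J(1) K b(2) by auto
    ultimately have "(simple_step ^^ Suc l) J ?U" "(strict_step ^^ Suc l) J ?U"
      using l by (auto intro: relpowp_Suc_I2 simp del: relpowp.simps)
    then show False using J(4) unfolding good_def by blast
  qed
  then show thesis using that by (auto simp: good_def)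
qed

text \<open>With \<open>\<ell> = \<ell>(U / x U)\<close>, a chain from \<open>x\<^sup>N M\<close> to \<open>M\<close> has at most \<open>N \<ell>\<close> steps. If the powers
  of \<open>x\<close> acted on \<open>M / U\<close> without stabilising, then \<open>x\<^sup>N M + x\<^bsup>N-c\<^esup> U \<subseteq> x\<^sup>N M + U\<close> would
  contribute \<open>(N - c) \<ell>\<close> steps, and \<open>x\<^sup>N M + U \<subseteq> M\<close> another \<open>N\<close>.\<close>
lemma smult_pow_in_submodule:
  assumes x: "x \<in> mm" "nonzerodivisor_on M x" and U: "submodule U R M"
    and l: "(simple_step ^^ l) (smult_set x (carrier M)) (carrier M)"
    and l': "(strict_step ^^ l) (smult_set x U) U"
  shows "\<exists>i::nat. \<forall>w\<in>carrier M. x [^] i \<odot>\<^bsub>M\<^esub> w \<in> U"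
proof (rule ccontr)
  assume no: "\<not> ?thesis"
  note xc = mm_carrier[OF x(1)]
  have pc: "x [^] i \<in> carrier R" for i :: nat using xc by simp
  define K where "K i = {w \<in> carrier M. x [^] i \<odot>\<^bsub>M\<^esub> w \<in> U}" for i :: nat
  have Kinc: "K i \<subseteq> K (Suc i)" for i
    using submoduleE(4)[OF U xc] xc pc by (auto simp: K_def smult_assoc1 smult_left_commute[OF pc xc])
  have "\<exists>c. \<forall>k\<ge>c. K k \<subseteq> K c"
    by (rule acc) (use Kinc submodule_smult_vimage[OF pc U] in \<open>auto simp: K_def\<close>)
  then obtain c where c: "\<And>k. k \<ge> c \<Longrightarrow> K k \<subseteq> K c" by auto
  \<comment> \<open>The final comparison reads (N - c) l + N \<le> N l, that is, N \<le> c l. Any N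
    above both c l and c contradicts it and makes the subtraction harmless.\<close>
  define N where "N = c * l + c + 1"
  define X where "X i = smult_set (x [^] i) (carrier M)" for i :: nat
  have X: "submodule (X i) R M" for i unfolding X_def by (rule submodule_smult_image[OF pc carrier_is_submodule])
  have XSuc: "X (Suc i) = smult_set x (X i)" for i
    unfolding X_def using smult_set_mult[OF xc pc[of i] subset_refl] xc pc by (simp add: R.m_comm)
  \<comment> \<open>Were the two sums equal, Nakayama's lemma would put x^i M inside
    \<open>U\<close>, against the assumption.\<close>
  have dec: "strict_step (X (Suc i) <+>\<^bsub>M\<^esub> U) (X i <+>\<^bsub>M\<^esub> U)" for i
  proof -
    have "X (Suc i) \<subseteq> X i" unfolding XSuc by (rule smult_set_subset[OF xc X])
    then have le: "X (Suc i) <+>\<^bsub>M\<^esub> U \<subseteq> X i <+>\<^bsub>M\<^esub> U" by (intro set_add_mono) auto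
    moreover have "X (Suc i) <+>\<^bsub>M\<^esub> U \<noteq> X i <+>\<^bsub>M\<^esub> U"
    proof
      assume eq: "X (Suc i) <+>\<^bsub>M\<^esub> U = X i <+>\<^bsub>M\<^esub> U"
      have "X i \<subseteq> U"
      proof (rule nakayama[OF U X])
        fix T assume T: "submodule T R M" "U \<subseteq> T" "\<And>a v. a \<in> mm \<Longrightarrow> v \<in> X i \<Longrightarrow> a \<odot>\<^bsub>M\<^esub> v \<in> T"
        have "X (Suc i) \<subseteq> T" unfolding XSuc using T(3)[OF x(1)] by auto
        then have "X i <+>\<^bsub>M\<^esub> U \<subseteq> T" unfolding eq[symmetric] by (intro set_add_least T)
        then show "X i \<subseteq> T" using set_add_upper(1)[OF X U] by auto
      qed
      then show False using no unfolding X_def by auto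
    qed
    ultimately show ?thesis using submodule_set_add[OF X U] by (auto simp: strict_step_def)
  qed
  have c1: "(strict_step ^^ n) (X n <+>\<^bsub>M\<^esub> U) (X 0 <+>\<^bsub>M\<^esub> U)" for n
  proof (induction n)
    case (Suc n)
    show ?case by (rule relpowp_Suc_I2[of strict_step, OF dec Suc.IH])
  qed simp
  have Uc: "U \<subseteq> carrier M" by (rule submoduleE(1)[OF U])
  have "(strict_step ^^ ((N - c) * l)) (smult_set (x [^] (N - c)) U) U"
    by (rule chain_smult_pow[OF xc Uc strict_step_smult[OF xc x(2)] l'])
  \<comment> \<open>An Artin-Rees statement with constant \<open>c\<close>: if x^N w lies in
    \<open>U\<close>, then so does x^c w, because the submodules \<open>K\<close> are stable from
    \<open>c\<close> on.\<close>
  moreover have "X N \<inter> U \<subseteq> smult_set (x [^] (N - c)) U"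
  proof
    fix u assume u: "u \<in> X N \<inter> U"
    then obtain w where w: "w \<in> carrier M" "u = x [^] N \<odot>\<^bsub>M\<^esub> w" by (auto simp: X_def)
    have "w \<in> K N" using u w by (simp add: K_def)
    then have "x [^] c \<odot>\<^bsub>M\<^esub> w \<in> U" using c[of N] by (auto simp: N_def K_def)
    moreover have "x [^] N = x [^] (N - c) \<otimes> x [^] c" using R.nat_pow_mult[OF xc, of "N - c" c] by (simp add: N_def)
    then have "u = x [^] (N - c) \<odot>\<^bsub>M\<^esub> (x [^] c \<odot>\<^bsub>M\<^esub> w)" using w pc by (simp add: smult_assoc1)
    ultimately show "u \<in> smult_set (x [^] (N - c)) U" by simp
  qed
  ultimately have c2: "(strict_step ^^ ((N - c) * l)) (X N <+>\<^bsub>M\<^esub> smult_set (x [^] (N - c)) U) (X N <+>\<^bsub>M\<^esub> U)"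
    using strict_chain_add[OF X _ _ subset_refl U] by simp
  have c3: "(strict_step ^^ ((N - c) * l + N)) (X N <+>\<^bsub>M\<^esub> smult_set (x [^] (N - c)) U) (X 0 <+>\<^bsub>M\<^esub> U)"
    unfolding relpowp_add by (rule relcomppI, rule c2, rule c1)
  have c4: "(simple_step ^^ (N * l)) (X N) (carrier M)"
    unfolding X_def by (rule chain_smult_pow[OF xc subset_refl simple_step_smult[OF xc] l])
  have "(N - c) * l + N \<le> N * l"
    by (rule strict_chain_le_simple_chain[OF c4 c3])
      (use set_add_upper(1)[OF X submodule_smult_image[OF pc U]] set_add_least[OF carrier_is_submodule] X
        submoduleE(1) Uc in auto)
  moreover have "(N - c) * l + c * l = N * l" by (simp add: N_def flip: add_mult_distrib)
  ultimately show False by (simp add: N_def)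
qed

end

section \<open>Free modules and modules of homomorphisms\<close>

lemma self_module_simps [simp]:
  "carrier (self_module R) = carrier R" "\<zero>\<^bsub>self_module R\<^esub> = \<zero>\<^bsub>R\<^esub>"
  "x \<oplus>\<^bsub>self_module R\<^esub> y = x \<oplus>\<^bsub>R\<^esub> y" "r \<odot>\<^bsub>self_module R\<^esub> x = r \<otimes>\<^bsub>R\<^esub> x"
  by (simp_all add: self_module_def)

lemma (in cring) self_module_module: "module R (self_module R)"
proof (rule moduleI)
  show "abelian_group (self_module R)"
  proof (rule abelian_groupI)
    fix x assume "x \<in> carrier (self_module R)"
    then show "\<exists>y\<in>carrier (self_module R). y \<oplus>\<^bsub>self_module R\<^esub> x = \<zero>\<^bsub>self_module R\<^esub>"
      by (intro bexI[of _ "\<ominus> x"]) (simp_all add: l_neg)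
  qed (simp_all add: add.m_ac)
qed (auto simp: l_distr r_distr m_assoc is_cring)

lemma (in cring) ideal_submodule_self:
  assumes "ideal I R" shows "submodule I R (self_module R)"
proof -
  interpret S: plain_module R "self_module R" by (rule plain_module.intro[OF self_module_module])
  interpret I: ideal I R by fact
  show ?thesis by (rule S.submoduleI_add_smult) (simp_all add: I.a_subset I.I_l_closed)
qed

section \<open>Free modules and pointwise operations\<close>

lemma free_module_simps:
  "carrier (free_module R n) = {..<n} \<rightarrow>\<^sub>E carrier R" "\<zero>\<^bsub>free_module R n\<^esub> = (\<lambda>i\<in>{..<n}. \<zero>\<^bsub>R\<^esub>)"
  "x \<oplus>\<^bsub>free_module R n\<^esub> y = (\<lambda>i\<in>{..<n}. x i \<oplus>\<^bsub>R\<^esub> y i)" "r \<odot>\<^bsub>free_module R n\<^esub> x = (\<lambda>i\<in>{..<n}. r \<otimes>\<^bsub>R\<^esub> x i)"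
  by (simp_all add: free_module_def)

text \<open>Common to free modules, with \<open>self_module R\<close> as target, and to modules of
  homomorphisms: both consist of extensional functions with pointwise operations. The negative of
  \<open>f\<close> is (-1) f, so no closure under negation is assumed.\<close>

lemma (in plain_module) pointwise_module:
  fixes P :: "('a, 'i \<Rightarrow> 'c) module"
  assumes sub: "carrier P \<subseteq> I \<rightarrow>\<^sub>E carrier M"
    and zero: "\<zero>\<^bsub>P\<^esub> = (\<lambda>i\<in>I. \<zero>\<^bsub>M\<^esub>)" "\<zero>\<^bsub>P\<^esub> \<in> carrier P"
    and add: "\<And>f g. f \<oplus>\<^bsub>P\<^esub> g = (\<lambda>i\<in>I. f i \<oplus>\<^bsub>M\<^esub> g i)"
      "\<And>f g. f \<in> carrier P \<Longrightarrow> g \<in> carrier P \<Longrightarrow> f \<oplus>\<^bsub>P\<^esub> g \<in> carrier P"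
    and smult: "\<And>r f. r \<odot>\<^bsub>P\<^esub> f = (\<lambda>i\<in>I. r \<odot>\<^bsub>M\<^esub> f i)"
      "\<And>r f. r \<in> carrier R \<Longrightarrow> f \<in> carrier P \<Longrightarrow> r \<odot>\<^bsub>P\<^esub> f \<in> carrier P"
  shows "module R P"
proof (rule moduleI)
  have mem: "f i \<in> carrier M" if "f \<in> carrier P" "i \<in> I" for f i
    using subsetD[OF sub that(1)] that(2) by (rule PiE_mem)
  have restr: "(\<lambda>i\<in>I. f i) = f" if "f \<in> carrier P" for f
    using subsetD[OF sub that] by (rule PiE_restrict)
  show "abelian_group P"
  proof (rule abelian_groupI)
    fix f assume f: "f \<in> carrier P"
    show "\<exists>g\<in>carrier P. g \<oplus>\<^bsub>P\<^esub> f = \<zero>\<^bsub>P\<^esub>"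
    proof (rule bexI)
      show "(\<ominus> \<one>) \<odot>\<^bsub>P\<^esub> f \<in> carrier P" by (rule smult(2)) (simp_all add: f)
      show "(\<ominus> \<one>) \<odot>\<^bsub>P\<^esub> f \<oplus>\<^bsub>P\<^esub> f = \<zero>\<^bsub>P\<^esub>"
        unfolding add(1) smult(1) zero(1)
        by (intro restrict_ext) (simp add: mem[OF f] smult_l_minus M.l_neg)
    qed
    have "\<zero>\<^bsub>P\<^esub> \<oplus>\<^bsub>P\<^esub> f = (\<lambda>i\<in>I. f i)"
      unfolding add(1) zero(1) by (intro restrict_ext) (simp add: mem[OF f])
    then show "\<zero>\<^bsub>P\<^esub> \<oplus>\<^bsub>P\<^esub> f = f" using restr[OF f] by simp
    fix g assume g: "g \<in> carrier P"
    show "f \<oplus>\<^bsub>P\<^esub> g \<in> carrier P" by (rule add(2)[OF f g])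
    show "f \<oplus>\<^bsub>P\<^esub> g = g \<oplus>\<^bsub>P\<^esub> f"
      unfolding add(1) by (intro restrict_ext) (simp add: mem[OF f] mem[OF g] M.a_comm)
    fix h assume h: "h \<in> carrier P"
    show "f \<oplus>\<^bsub>P\<^esub> g \<oplus>\<^bsub>P\<^esub> h = f \<oplus>\<^bsub>P\<^esub> (g \<oplus>\<^bsub>P\<^esub> h)"
      unfolding add(1) by (intro restrict_ext) (simp add: mem[OF f] mem[OF g] mem[OF h] M.a_assoc)
  qed (rule zero(2))
  fix f assume f: "f \<in> carrier P"
  have "\<one> \<odot>\<^bsub>P\<^esub> f = (\<lambda>i\<in>I. f i)" unfolding smult(1) by (intro restrict_ext) (simp add: mem[OF f])
  then show "\<one> \<odot>\<^bsub>P\<^esub> f = f" using restr[OF f] by simp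
  fix a assume a: "a \<in> carrier R"
  show "a \<odot>\<^bsub>P\<^esub> f \<in> carrier P" by (rule smult(2)[OF a f])
  { fix c assume c: "c \<in> carrier R"
    show "(a \<oplus> c) \<odot>\<^bsub>P\<^esub> f = a \<odot>\<^bsub>P\<^esub> f \<oplus>\<^bsub>P\<^esub> c \<odot>\<^bsub>P\<^esub> f"
      unfolding add(1) smult(1) by (intro restrict_ext) (simp add: mem[OF f] a c smult_l_distr)
    show "(a \<otimes> c) \<odot>\<^bsub>P\<^esub> f = a \<odot>\<^bsub>P\<^esub> (c \<odot>\<^bsub>P\<^esub> f)"
      unfolding smult(1) by (intro restrict_ext) (simp add: mem[OF f] a c smult_assoc1) }
  fix g assume g: "g \<in> carrier P"
  show "a \<odot>\<^bsub>P\<^esub> (f \<oplus>\<^bsub>P\<^esub> g) = a \<odot>\<^bsub>P\<^esub> f \<oplus>\<^bsub>P\<^esub> a \<odot>\<^bsub>P\<^esub> g"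
    unfolding add(1) smult(1) by (intro restrict_ext) (simp add: mem[OF f] mem[OF g] a smult_r_distr)
qed (rule R.is_cring)

lemma (in cring) free_module_module: "module R (free_module R n)"
proof -
  interpret S: plain_module R "self_module R" by (rule plain_module.intro[OF self_module_module])
  have mem: "x i \<in> carrier R" if "x \<in> {..<n} \<rightarrow>\<^sub>E carrier R" "i < n" for x i
    using that by (auto elim: PiE_mem)
  show ?thesis
    by (rule S.pointwise_module[where I = "{..<n}"])
      (simp_all add: free_module_simps mem)
qed

lemma hom_module_simps:
  "carrier (hom_module R N M) = module_hom R N M \<inter> extensional (carrier N)"
  "\<zero>\<^bsub>hom_module R N M\<^esub> = (\<lambda>x\<in>carrier N. \<zero>\<^bsub>M\<^esub>)"
  "f \<oplus>\<^bsub>hom_module R N M\<^esub> g = (\<lambda>x\<in>carrier N. f x \<oplus>\<^bsub>M\<^esub> g x)"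
  "r \<odot>\<^bsub>hom_module R N M\<^esub> f = (\<lambda>x\<in>carrier N. r \<odot>\<^bsub>M\<^esub> f x)"
  by (simp_all add: hom_module_def)

lemma (in plain_module) hom_module_module:
  assumes "module R N" shows "module R (hom_module R N M)"
proof -
  interpret N: plain_module R N using assms by (rule plain_module.intro)
  have mem: "f x \<in> carrier M" if "f \<in> module_hom R N M" "x \<in> carrier N" for f x
    by (rule module_homD(1)[OF that])
  have add: "(\<lambda>x\<in>carrier N. f x \<oplus>\<^bsub>M\<^esub> g x) \<in> module_hom R N M"
    if f: "f \<in> module_hom R N M" and g: "g \<in> module_hom R N M" for f g
    using module_homD[OF f] module_homD[OF g]
    by (simp add: module_hom_def smult_r_distr M.add.m_ac)
  have smult: "(\<lambda>x\<in>carrier N. r \<odot>\<^bsub>M\<^esub> f x) \<in> module_hom R N M"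
    if f: "f \<in> module_hom R N M" and r: "r \<in> carrier R" for f r
    using module_homD[OF f] r
    by (simp add: module_hom_def smult_r_distr smult_left_commute[OF r])
  have zero: "(\<lambda>x\<in>carrier N. \<zero>\<^bsub>M\<^esub>) \<in> module_hom R N M" by (simp add: module_hom_def)
  show ?thesis
    by (rule pointwise_module[where I = "carrier N"])
      (auto simp: hom_module_simps PiE_def add smult zero mem)
qed

text \<open>Finite free modules are projective: choose preimages of the images of the unit vectors
  and extend linearly.\<close>

lemma free_module_lift:
  assumes "module R A" "module R B" and p: "p \<in> module_hom R A B" "p ` carrier A = carrier B"
    and h: "h \<in> module_hom R (free_module R n) B"
  shows "\<exists>e\<in>module_hom R (free_module R n) A. \<forall>u\<in>carrier (free_module R n). p (e u) = h u"
proof -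
  interpret A: plain_module R A using assms(1) by (rule plain_module.intro)
  interpret B: plain_module R B using assms(2) by (rule plain_module.intro)
  let ?F = "free_module R n"
  have F: "module R ?F" by (rule A.R.free_module_module)
  define unit where "unit i = (\<lambda>j\<in>{..<n}. if j = i then \<one>\<^bsub>R\<^esub> else \<zero>\<^bsub>R\<^esub>)" for i
  have unit: "unit i \<in> carrier ?F" for i by (simp add: unit_def free_module_simps)
  have "\<exists>a. a \<in> carrier A \<and> p a = h (unit i)" for i
  proof -
    have "h (unit i) \<in> p ` carrier A" unfolding p(2) by (rule module_homD(1)[OF h unit])
    then show ?thesis by auto
  qed
  then obtain c where c: "\<And>i. c i \<in> carrier A" "\<And>i. p (c i) = h (unit i)" by metis
  \<comment> \<open>\<open>s k u\<close> is the sum of u_i c_i over i < k. It is matched below with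
    the truncation \<open>tr k u\<close> of \<open>u\<close> to its first \<open>k\<close>
    coordinates, so that each induction step adds a single unit vector.\<close>
  define s where "s k u = rec_nat \<zero>\<^bsub>A\<^esub> (\<lambda>i t. t \<oplus>\<^bsub>A\<^esub> u i \<odot>\<^bsub>A\<^esub> c i) k" for k and u :: "nat \<Rightarrow> 'a"
  have s_simps: "s 0 u = \<zero>\<^bsub>A\<^esub>" "s (Suc k) u = s k u \<oplus>\<^bsub>A\<^esub> u k \<odot>\<^bsub>A\<^esub> c k" for k u by (simp_all add: s_def)
  have mem: "u i \<in> carrier R" if "u \<in> carrier ?F" "i < n" for u i using that by (auto simp: free_module_simps)
  have s_closed: "s k u \<in> carrier A" if "u \<in> carrier ?F" "k \<le> n" for k u
    using that(2) by (induction k) (simp_all add: s_simps mem[OF that(1)] c)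
  have s_add: "s k (u \<oplus>\<^bsub>?F\<^esub> v) = s k u \<oplus>\<^bsub>A\<^esub> s k v" if "u \<in> carrier ?F" "v \<in> carrier ?F" "k \<le> n" for k u v
    using that(3)
  proof (induction k)
    case (Suc k)
    then show ?case
      using s_closed[OF that(1), of k] s_closed[OF that(2), of k] mem[OF that(1), of k] mem[OF that(2), of k] c
      by (simp add: s_simps free_module_simps(3) A.smult_l_distr A.M.add.m_ac)
  qed (simp add: s_simps)
  have s_smult: "s k (r \<odot>\<^bsub>?F\<^esub> u) = r \<odot>\<^bsub>A\<^esub> s k u" if "u \<in> carrier ?F" "r \<in> carrier R" "k \<le> n" for k u r
    using that(3)
  proof (induction k)
    case (Suc k)
    then show ?case
      using s_closed[OF that(1), of k] mem[OF that(1), of k] c that(2)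
      by (simp add: s_simps free_module_simps(4) A.smult_assoc1 A.smult_r_distr)
  qed (simp add: s_simps that)
  define tr where "tr k u = (\<lambda>i\<in>{..<n}. if i < k then u i else \<zero>\<^bsub>R\<^esub>)" for k :: nat and u
  have tr_closed: "tr k u \<in> carrier ?F" if "u \<in> carrier ?F" for k u
    using mem[OF that] by (simp add: tr_def free_module_simps)
  have s_tr: "p (s k u) = h (tr k u)" if u: "u \<in> carrier ?F" and "k \<le> n" for k u
    using that(2)
  proof (induction k)
    case 0
    have "tr 0 u = \<zero>\<^bsub>?F\<^esub>" by (simp add: tr_def free_module_simps)
    then show ?case using module_hom_zero[OF F assms(2) h] module_hom_zero[OF assms(1,2) p(1)] by (simp add: s_simps)
  next
    case (Suc k)
    have "tr (Suc k) u = tr k u \<oplus>\<^bsub>?F\<^esub> u k \<odot>\<^bsub>?F\<^esub> unit k"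
      using Suc.prems mem[OF u]
      by (intro ext) (auto simp: tr_def unit_def free_module_simps less_Suc_eq)
    moreover have "u k \<odot>\<^bsub>?F\<^esub> unit k \<in> carrier ?F"
      by (rule module.smult_closed[OF F]) (use mem[OF u, of k] Suc.prems unit in auto)
    ultimately have "h (tr (Suc k) u) = h (tr k u) \<oplus>\<^bsub>B\<^esub> u k \<odot>\<^bsub>B\<^esub> h (unit k)"
      using module_homD(2)[OF h tr_closed[OF u]] module_homD(3)[OF h mem[OF u, of k] unit[of k]] Suc.prems by simp
    also have "\<dots> = p (s (Suc k) u)"
      using Suc mem[OF u, of k] c module_homD[OF p(1)] s_closed[OF u, of k] by (simp add: s_simps)
    finally show ?case by simp
  qed
  have hom: "s n \<in> module_hom R ?F A" unfolding module_hom_def using s_closed s_add s_smult by simp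
  show ?thesis
  proof (rule bexI[OF _ hom], rule ballI)
    fix u assume u: "u \<in> carrier ?F"
    have "tr n u = restrict u {..<n}" unfolding tr_def by (rule restrict_ext) simp
    also have "\<dots> = u" using u unfolding free_module_simps by (rule PiE_restrict)
    finally show "p (s n u) = h u" using s_tr[OF u order_refl] by simp
  qed
qed

lemma (in plain_module) coset_mem_eq:
  assumes N: "submodule N R M" and x: "x \<in> carrier M" and y: "y \<in> carrier M" and eq: "N +>\<^bsub>M\<^esub> x = N +>\<^bsub>M\<^esub> y"
  obtains b where "b \<in> N" "x = b \<oplus>\<^bsub>M\<^esub> y"
proof -
  have "\<zero>\<^bsub>M\<^esub> \<oplus>\<^bsub>M\<^esub> x \<in> N +>\<^bsub>M\<^esub> x"
    by (rule M.a_rcosI[OF submodule_zero[OF N] submoduleE(1)[OF N] x])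
  then have "x \<in> N +>\<^bsub>M\<^esub> y" using x eq by simp
  then show thesis using that by (auto simp: a_r_coset_def')
qed

text \<open>M/N is a vector space of dimension one over the residue field, so each nonzero vector
  spans it: in f = b + r h the coefficient \<open>r\<close> must be a unit.\<close>

lemma (in local_module) quotient_one_generator:
  assumes N: "submodule N R M" and one: "min_gens R (quot_module M N) = 1"
    and killed: "\<And>a f. a \<in> mm \<Longrightarrow> f \<in> carrier M \<Longrightarrow> a \<odot>\<^bsub>M\<^esub> f \<in> N"
    and f: "f \<in> carrier M" "f \<notin> N" and f': "f' \<in> carrier M"
  shows "f' \<in> N <+>\<^bsub>M\<^esub> cyclic_submodule f"
proof -
  interpret Q: local_module R "quot_module M N" mm
    by (rule local_module.intro[OF plain_module.intro[OF quot_module_module[OF N]] local_module_axioms.intro[OF maximal maximal_unique noetherian]])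
  interpret Q: fg_local_module R "quot_module M N" mm
    by unfold_locales (simp add: one)
  obtain S where S: "finite S" "S \<subseteq> carrier (quot_module M N)" "mspan R (quot_module M N) S = carrier (quot_module M N)"
    "enat (card S) = 1" using min_gens_attained[OF Q.fg] one by metis
  then have "card S = 1" by (simp add: one_enat_def)
  then obtain X where X: "S = {X}" by (auto simp: card_1_singleton_iff)
  then have Xc: "X \<in> carrier (quot_module M N)" using S(2) by auto
  then obtain h where h: "h \<in> carrier M" "X = N +>\<^bsub>M\<^esub> h" by (auto simp: quot_module_simps[OF N])
  have gen: "\<exists>b\<in>N. \<exists>r\<in>carrier R. g = b \<oplus>\<^bsub>M\<^esub> r \<odot>\<^bsub>M\<^esub> h" if g: "g \<in> carrier M" for g
  proof -
    have "N +>\<^bsub>M\<^esub> g \<in> mspan R (quot_module M N) {X}" using S(3) X g by (simp add: quot_module_simps[OF N])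
    also have "\<dots> \<subseteq> Q.cyclic_submodule X"
      by (rule Q.mspan_least[OF Q.cyclic_submodule_is_submodule[OF Xc]]) (simp add: Q.cyclic_submodule_self[OF Xc])
    finally obtain r where r: "r \<in> carrier R" "N +>\<^bsub>M\<^esub> g = N +>\<^bsub>M\<^esub> (r \<odot>\<^bsub>M\<^esub> h)"
      unfolding Q.cyclic_submodule_def using h by (auto simp: quot_module_simps[OF N])
    obtain b where "b \<in> N" "g = b \<oplus>\<^bsub>M\<^esub> r \<odot>\<^bsub>M\<^esub> h"
      by (rule coset_mem_eq[OF N g smult_closed[OF r(1) h(1)] r(2)])
    then show ?thesis using r(1) by auto
  qed
  let ?T = "N <+>\<^bsub>M\<^esub> cyclic_submodule f"
  note cs = cyclic_submodule_is_submodule[OF f(1)]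
  note T = submodule_set_add[OF N cs] and TU = set_add_upper[OF N cs]
  obtain b r where br: "b \<in> N" "r \<in> carrier R" "f = b \<oplus>\<^bsub>M\<^esub> r \<odot>\<^bsub>M\<^esub> h" using gen[OF f(1)] by auto
  have "r \<notin> mm" using killed[of r h] h(1) br f(2) submoduleE(5)[OF N] by auto
  moreover have "r \<odot>\<^bsub>M\<^esub> h \<in> ?T"
    by (rule submodule_add_cancel[OF T, of b])
      (use TU br h(1) cyclic_submodule_self[OF f(1)] in auto)
  ultimately have "h \<in> ?T" using unit_smult_mem[OF br(2) _ T h(1)] by simp
  moreover obtain b' r' where "b' \<in> N" "r' \<in> carrier R" "f' = b' \<oplus>\<^bsub>M\<^esub> r' \<odot>\<^bsub>M\<^esub> h" using gen[OF f'] by auto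
  ultimately show ?thesis using submoduleE(4,5)[OF T] TU(1) by auto
qed

section \<open>Cohen--Macaulay type one and the socle\<close>

context local_module begin

text \<open>For \<open>w\<close> with \<open>\<mm> w \<subseteq> x M\<close> and a lift \<open>e\<close> of \<open>\<epsilon>\<close> to a map into \<open>R\<close>, the cocycle
  \<open>z \<mapsto> e (d\<^sub>0 z) w / x\<close> realises the embedding of the socle of \<open>M / x M\<close> into \<open>Ext\<^sup>1(k, M)\<close>.\<close>
lemma type_one_socle:
  assumes type: "has_cm_type R M 1" and depth: "the_enat (depth R M) = 1" and mm: "max_ideal R = mm"
    and x: "x \<in> mm" "nonzerodivisor_on M x"
    and w: "w \<in> carrier M" "w' \<in> carrier M"
      "\<And>b. b \<in> mm \<Longrightarrow> b \<odot>\<^bsub>M\<^esub> w \<in> smult_set x (carrier M)"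
      "\<And>b. b \<in> mm \<Longrightarrow> b \<odot>\<^bsub>M\<^esub> w' \<in> smult_set x (carrier M)"
      "w \<notin> smult_set x (carrier M)"
  shows "w' \<in> smult_set x (carrier M) <+>\<^bsub>M\<^esub> cyclic_submodule w"
proof -
  note xc = mm_carrier[OF x(1)]
  let ?k = "quot_module (self_module R) mm" and ?xM = "smult_set x (carrier M)"
  obtain b d \<epsilon> where res: "fg_free_resolution R ?k b d \<epsilon>"
    and gens: "min_gens R (hom_cohomology R b d M 1) = 1"
    using type unfolding has_cm_type_def mm depth by auto
  define F where "F i = free_module R (b i)" for i
  have Fm: "module R (F i)" for i unfolding F_def by (rule R.free_module_module)
  have res': "\<epsilon> \<in> module_hom R (F 0) ?k" "\<And>i. d i \<in> module_hom R (F (Suc i)) (F i)"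
    "\<epsilon> ` carrier (F 0) = carrier ?k" "d 0 ` carrier (F 1) = a_kernel (F 0) ?k \<epsilon>"
    "\<And>i. d (Suc i) ` carrier (F (Suc (Suc i))) = a_kernel (F (Suc i)) (F i) (d i)"
    using res unfolding fg_free_resolution_def Let_def F_def by simp_all
  interpret S: plain_module R "self_module R" by (rule plain_module.intro[OF R.self_module_module])
  note mmS = R.ideal_submodule_self[OF mm_ideal]
  have km: "module R ?k" by (rule S.quot_module_module[OF mmS])
  have kz: "\<zero>\<^bsub>?k\<^esub> = mm" by (rule S.quot_module_zero[OF mmS])
  interpret F0: plain_module R "F 0" by (rule plain_module.intro[OF Fm])
  interpret F1: plain_module R "F 1" by (rule plain_module.intro[OF Fm])
  interpret F2: plain_module R "F 2" by (rule plain_module.intro[OF Fm])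
  note \<epsilon> = module_homD[OF res'(1)]
  have d0: "d 0 \<in> module_hom R (F 1) (F 0)" and d1: "d 1 \<in> module_hom R (F 2) (F 1)"
    using res'(2)[of 0] res'(2)[of 1] by (simp_all add: numeral_2_eq_2)
  note d0D = module_homD[OF d0] and d1D = module_homD[OF d1]
  have ker\<epsilon>: "u \<in> d 0 ` carrier (F 1) \<longleftrightarrow> u \<in> carrier (F 0) \<and> \<epsilon> u = mm" for u
    unfolding res'(4) a_kernel_def' kz by simp
  have kerd0: "z \<in> d 1 ` carrier (F 2) \<longleftrightarrow> z \<in> carrier (F 1) \<and> d 0 z = \<zero>\<^bsub>F 0\<^esub>" for z
    using res'(5)[of 0] by (simp add: a_kernel_def' numeral_2_eq_2)
  have kproj: "(\<lambda>r. mm +>\<^bsub>self_module R\<^esub> r) \<in> module_hom R (self_module R) ?k"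
    by (rule S.quot_proj_hom[OF mmS])
  have kimage: "(\<lambda>r. mm +>\<^bsub>self_module R\<^esub> r) ` carrier (self_module R) = carrier ?k"
    using S.quot_module_carrier[OF mmS] by simp
  obtain e where e: "e \<in> module_hom R (F 0) (self_module R)"
    and e\<epsilon>: "\<And>u. u \<in> carrier (F 0) \<Longrightarrow> mm +>\<^bsub>self_module R\<^esub> e u = \<epsilon> u"
    using free_module_lift[OF R.self_module_module km kproj kimage res'(1)[unfolded F_def]]
    unfolding F_def by auto
  note eD = module_homD[OF e, simplified]
  \<comment> \<open>The zero of the residue field is the coset \<open>mm\<close> itself, so the
    kernel of \<epsilon> is the preimage of \<open>mm\<close> under \<open>e\<close>.\<close>
  have e_ker: "\<epsilon> u = mm \<longleftrightarrow> e u \<in> mm" if "u \<in> carrier (F 0)" for u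
    using S.coset_eq_iff[OF mmS, of "e u"] e\<epsilon>[OF that] eD(1)[OF that] by simp
  have e_mm: "e (d 0 z) \<in> mm" if "z \<in> carrier (F 1)" for z
    using ker\<epsilon>[of "d 0 z"] e_ker[of "d 0 z"] that d0D(1) by auto
  have cancel: "v = v'" if "v \<in> carrier M" "v' \<in> carrier M" "x \<odot>\<^bsub>M\<^esub> v = x \<odot>\<^bsub>M\<^esub> v'" for v v'
  proof -
    have "x \<odot>\<^bsub>M\<^esub> (v \<oplus>\<^bsub>M\<^esub> \<ominus>\<^bsub>M\<^esub> v') = \<zero>\<^bsub>M\<^esub>"
      using that xc by (simp add: smult_r_distr smult_r_minus M.r_neg)
    then have "v \<oplus>\<^bsub>M\<^esub> \<ominus>\<^bsub>M\<^esub> v' = \<zero>\<^bsub>M\<^esub>" using x(2) that(1,2) unfolding nonzerodivisor_on_def by simp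
    moreover have "v = (v \<oplus>\<^bsub>M\<^esub> \<ominus>\<^bsub>M\<^esub> v') \<oplus>\<^bsub>M\<^esub> v'" using that(1,2) by (simp add: M.a_assoc M.l_neg)
    ultimately show ?thesis using that(2) by simp
  qed

  define H where "H i = hom_module R (F i) M" for i
  have Hm: "module R (H i)" for i unfolding H_def by (rule hom_module_module[OF Fm])
  interpret H1: plain_module R "H 1" by (rule plain_module.intro[OF Hm])
  \<comment> \<open>Keeps the index 1 from being rewritten to \<open>Suc 0\<close>, so that facts
    about \<open>F 1\<close> and \<open>H 1\<close> continue to match.\<close>
  note One_nat_def [simp del]
  define Z where "Z = {f \<in> carrier (H 1). \<forall>y\<in>carrier (F 2). f (d 1 y) = \<zero>\<^bsub>M\<^esub>}"
  define B where "B = (\<lambda>g. \<lambda>z\<in>carrier (F 1). g (d 0 z)) ` carrier (H 0)"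
  have coh: "hom_cohomology R b d M 1 = quot_module ((H 1)\<lparr>carrier := Z\<rparr>) B"
    unfolding hom_cohomology_def Let_def Z_def B_def H_def F_def by (simp add: numeral_2_eq_2 One_nat_def)
  have HI: "f \<in> carrier (H i) \<longleftrightarrow> f \<in> module_hom R (F i) M \<and> f \<in> extensional (carrier (F i))" for f i
    by (simp add: H_def hom_module_simps)
  have H_eval: "(f \<oplus>\<^bsub>H 1\<^esub> g) z = f z \<oplus>\<^bsub>M\<^esub> g z" "(r \<odot>\<^bsub>H 1\<^esub> f) z = r \<odot>\<^bsub>M\<^esub> f z" "\<zero>\<^bsub>H 1\<^esub> z = \<zero>\<^bsub>M\<^esub>"
    if "z \<in> carrier (F 1)" for f g r z
    using that by (simp_all add: H_def hom_module_simps)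
  have Z: "submodule Z R (H 1)"
  proof (rule H1.submoduleI_add_smult)
    show "\<zero>\<^bsub>H 1\<^esub> \<in> Z" using d1D(1) H_eval(3) by (simp add: Z_def)
    fix f g assume "f \<in> Z" "g \<in> Z"
    then show "f \<oplus>\<^bsub>H 1\<^esub> g \<in> Z" using d1D(1) H_eval(1) by (simp add: Z_def)
  next
    fix r f assume "r \<in> carrier R" "f \<in> Z"
    then show "r \<odot>\<^bsub>H 1\<^esub> f \<in> Z" using d1D(1) H_eval(2) by (simp add: Z_def)
  qed (auto simp: Z_def)
  \<comment> \<open>The cocycles as a module of their own, with the coboundaries \<open>B\<close> as
    a submodule; the quotient is the first cohomology, to which
    \<open>quotient_one_generator\<close> will apply.\<close>
  define Q where "Q = (H 1)\<lparr>carrier := Z\<rparr>"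
  have Q_simps: "carrier Q = Z" "\<zero>\<^bsub>Q\<^esub> = \<zero>\<^bsub>H 1\<^esub>" "\<And>f g. f \<oplus>\<^bsub>Q\<^esub> g = f \<oplus>\<^bsub>H 1\<^esub> g"
    "\<And>r f. r \<odot>\<^bsub>Q\<^esub> f = r \<odot>\<^bsub>H 1\<^esub> f"
    by (simp_all add: Q_def)
  have Qm: "module R Q" unfolding Q_def by (rule submodule.submodule_is_module[OF Z Hm])
  interpret Q: local_module R Q mm
    by (rule local_module.intro[OF plain_module.intro[OF Qm]
          local_module_axioms.intro[OF maximal maximal_unique noetherian]])
  have H0D: "g \<in> module_hom R (F 0) M" if "g \<in> carrier (H 0)" for g using that by (simp add: HI)
  have pull: "(\<lambda>z\<in>carrier (F 1). g (d 0 z)) \<in> Z" if g: "g \<in> module_hom R (F 0) M" for g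
  proof -
    note gD = module_homD[OF g]
    have "(\<lambda>z\<in>carrier (F 1). g (d 0 z)) \<in> module_hom R (F 1) M"
      using d0D gD by (simp add: module_hom_def)
    moreover have "g (d 0 (d 1 y)) = \<zero>\<^bsub>M\<^esub>" if "y \<in> carrier (F 2)" for y
      using kerd0[of "d 1 y"] that module_hom_zero[OF Fm module_axioms g] by simp
    ultimately show ?thesis using d1D(1) by (simp add: Z_def HI)
  qed
  have Hom0: "module R (H 0)" by (rule Hm)
  have Bimage: "(\<lambda>g. \<lambda>z\<in>carrier (F 1). g (d 0 z)) \<in> module_hom R (H 0) Q"
    using pull[OF H0D] d0D(1)
    by (auto simp: module_hom_def Q_simps H_def hom_module_simps intro!: restrict_ext)
  have B: "submodule B R Q"
    unfolding B_def
    by (rule submodule_image[OF Hom0 Qm Bimage plain_module.intro[OF Hom0, THEN plain_module.axioms, THEN module.carrier_is_submodule]])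

  \<comment> \<open>The relation f = (e o d 0) v / x, with the division cleared.\<close>
  define reps where "reps f v \<longleftrightarrow> (\<forall>z\<in>carrier (F 1). x \<odot>\<^bsub>M\<^esub> f z = e (d 0 z) \<odot>\<^bsub>M\<^esub> v)" for f v
  \<comment> \<open>\<open>e\<close> takes the image of \<open>d 0\<close> into \<open>mm\<close>,
    so the division by \<open>x\<close> is possible. It is unique by \<open>cancel\<close>, which
    also yields linearity; the cocycle condition follows from d 0 o d 1 = 0.\<close>
  have rep_ex: "\<exists>f\<in>Z. reps f v" if v: "v \<in> carrier M" "\<And>a. a \<in> mm \<Longrightarrow> a \<odot>\<^bsub>M\<^esub> v \<in> ?xM" for v
  proof -
    have "\<forall>z\<in>carrier (F 1). \<exists>y. y \<in> carrier M \<and> x \<odot>\<^bsub>M\<^esub> y = e (d 0 z) \<odot>\<^bsub>M\<^esub> v"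
    proof
      fix z assume "z \<in> carrier (F 1)"
      from v(2)[OF e_mm[OF this]] show "\<exists>y. y \<in> carrier M \<and> x \<odot>\<^bsub>M\<^esub> y = e (d 0 z) \<odot>\<^bsub>M\<^esub> v" by auto
    qed
    then obtain f0 where f0: "\<And>z. z \<in> carrier (F 1) \<Longrightarrow> f0 z \<in> carrier M"
      "\<And>z. z \<in> carrier (F 1) \<Longrightarrow> x \<odot>\<^bsub>M\<^esub> f0 z = e (d 0 z) \<odot>\<^bsub>M\<^esub> v" by (metis bchoice)
    define f where "f = restrict f0 (carrier (F 1))"
    have "f0 (z \<oplus>\<^bsub>F 1\<^esub> z') = f0 z \<oplus>\<^bsub>M\<^esub> f0 z'" if z: "z \<in> carrier (F 1)" "z' \<in> carrier (F 1)" for z z'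
      by (rule cancel) (use z f0 d0D eD v xc in \<open>simp_all add: smult_r_distr smult_l_distr\<close>)
    moreover have "f0 (r \<odot>\<^bsub>F 1\<^esub> z) = r \<odot>\<^bsub>M\<^esub> f0 z" if r: "r \<in> carrier R" and z: "z \<in> carrier (F 1)" for r z
      by (rule cancel) (use z r f0 d0D eD v xc in \<open>simp_all add: smult_assoc1 smult_left_commute[OF xc r]\<close>)
    ultimately have "f \<in> carrier (H 1)" using f0(1) by (simp add: HI f_def module_hom_def)
    moreover have "f (d 1 y) = \<zero>\<^bsub>M\<^esub>" if y: "y \<in> carrier (F 2)" for y
    proof (rule cancel)
      have "d 0 (d 1 y) = \<zero>\<^bsub>F 0\<^esub>" using kerd0[of "d 1 y"] y by simp
      then have "e (d 0 (d 1 y)) = \<zero>" using module_hom_zero[OF Fm R.self_module_module e] by simp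
      then show "x \<odot>\<^bsub>M\<^esub> f (d 1 y) = x \<odot>\<^bsub>M\<^esub> \<zero>\<^bsub>M\<^esub>" using f0(2) d1D(1)[OF y] v(1) xc by (simp add: f_def)
    qed (use f0(1) d1D(1)[OF y] in \<open>simp_all add: f_def\<close>)
    ultimately have "f \<in> Z" by (simp add: Z_def)
    moreover have "reps f v" using f0(2) by (simp add: reps_def f_def)
    ultimately show ?thesis by auto
  qed

  \<comment> \<open>If f = g o d 0, then x g(u) = e(u) v for \<open>u\<close> in the kernel of
    \<epsilon>. Take \<open>u\<close> over 1 instead: x u lies in the kernel, and cancelling one
    \<open>x\<close> from x g(x u) = e(x u) v gives x g(u) = e(u) v with e(u) a unit.\<close>
  have rep_B: "v \<in> ?xM" if f: "f \<in> B" "reps f v" and v: "v \<in> carrier M" for f v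
  proof -
    obtain g where g: "g \<in> carrier (H 0)" "f = (\<lambda>z\<in>carrier (F 1). g (d 0 z))" using f(1) by (auto simp: B_def)
    note gD = module_homD[OF H0D[OF g(1)]]
    have gu: "x \<odot>\<^bsub>M\<^esub> g u = e u \<odot>\<^bsub>M\<^esub> v" if u: "u \<in> carrier (F 0)" "\<epsilon> u = mm" for u
    proof -
      obtain z where "z \<in> carrier (F 1)" "u = d 0 z" using ker\<epsilon>[of u] u by auto
      then show ?thesis using f(2) g(2) by (simp add: reps_def)
    qed
    have "mm +>\<^bsub>self_module R\<^esub> \<one> \<in> \<epsilon> ` carrier (F 0)" unfolding res'(3) kimage[symmetric] by simp
    then obtain u where u: "u \<in> carrier (F 0)" "mm +>\<^bsub>self_module R\<^esub> \<one> = \<epsilon> u" by auto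
    have "\<epsilon> u \<noteq> mm" using S.coset_eq_iff[OF mmS, of \<one>] one_notin_mm u(2) by simp
    then have eu: "e u \<notin> mm" using e_ker[OF u(1)] by simp
    have "e (x \<odot>\<^bsub>F 0\<^esub> u) \<in> mm" using eD(1,3) u(1) xc ideal.I_r_closed[OF mm_ideal x(1)] by simp
    then have "\<epsilon> (x \<odot>\<^bsub>F 0\<^esub> u) = mm" using e_ker[of "x \<odot>\<^bsub>F 0\<^esub> u"] u(1) xc by simp
    then have "x \<odot>\<^bsub>M\<^esub> g (x \<odot>\<^bsub>F 0\<^esub> u) = e (x \<odot>\<^bsub>F 0\<^esub> u) \<odot>\<^bsub>M\<^esub> v" using gu[of "x \<odot>\<^bsub>F 0\<^esub> u"] u(1) xc by simp
    then have "x \<odot>\<^bsub>M\<^esub> (x \<odot>\<^bsub>M\<^esub> g u) = x \<odot>\<^bsub>M\<^esub> (e u \<odot>\<^bsub>M\<^esub> v)"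
      using gD(3)[OF xc u(1)] eD(3)[OF xc u(1)] smult_assoc1[OF xc eD(1)[OF u(1)] v] by simp
    then have "x \<odot>\<^bsub>M\<^esub> g u = e u \<odot>\<^bsub>M\<^esub> v" using gD(1)[OF u(1)] eD(1)[OF u(1)] v xc cancel[of "x \<odot>\<^bsub>M\<^esub> g u" "e u \<odot>\<^bsub>M\<^esub> v"] by simp
    then have "e u \<odot>\<^bsub>M\<^esub> v \<in> ?xM" using gD(1)[OF u(1)] by (metis imageI)
    then show ?thesis
      by (rule unit_smult_mem[OF eD(1)[OF u(1)] eu submodule_smult_image[OF xc carrier_is_submodule] v])
  qed

  \<comment> \<open>For \<open>a\<close> in \<open>mm\<close> the map u -> a u sends
    \<open>F 0\<close> into the image of \<open>d 0\<close>. Composing a preimage under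
    \<open>d 0\<close> with the cocycle \<open>f\<close> gives a map \<open>g\<close> on
    \<open>F 0\<close> with a f = g o d 0.\<close>
  have killed: "a \<odot>\<^bsub>Q\<^esub> f \<in> B" if a: "a \<in> mm" and f: "f \<in> carrier Q" for a f
  proof -
    note ac = mm_carrier[OF a]
    have fH: "f \<in> module_hom R (F 1) M" and fZ: "\<And>y. y \<in> carrier (F 2) \<Longrightarrow> f (d 1 y) = \<zero>\<^bsub>M\<^esub>"
      using f by (simp_all add: Q_simps Z_def HI)
    note fD = module_homD[OF fH]
    \<comment> \<open>A cocycle vanishes on the image of \<open>d 1\<close>, which is the kernel of
      \<open>d 0\<close>; so f z depends only on d 0 z, and the choice of preimages below does not
      matter.\<close>
    have f_eq: "f z = f z'" if z: "z \<in> carrier (F 1)" "z' \<in> carrier (F 1)" "d 0 z = d 0 z'" for z z'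
    proof -
      define y where "y = z \<oplus>\<^bsub>F 1\<^esub> (\<ominus> \<one>) \<odot>\<^bsub>F 1\<^esub> z'"
      have yc: "y \<in> carrier (F 1)" using z by (simp add: y_def)
      have "d 0 y = d 0 z \<oplus>\<^bsub>F 0\<^esub> (\<ominus> \<one>) \<odot>\<^bsub>F 0\<^esub> d 0 z'" unfolding y_def using z d0D by simp
      also have "\<dots> = \<zero>\<^bsub>F 0\<^esub>" using z d0D(1)[OF z(2)] by (simp add: F0.smult_l_minus F0.M.r_neg)
      finally have "y \<in> d 1 ` carrier (F 2)" using kerd0 yc by simp
      then have "f y = \<zero>\<^bsub>M\<^esub>" using fZ by auto
      moreover have "f y = f z \<oplus>\<^bsub>M\<^esub> \<ominus>\<^bsub>M\<^esub> f z'" unfolding y_def using z fD by (simp add: smult_l_minus)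
      ultimately have "f z \<oplus>\<^bsub>M\<^esub> \<ominus>\<^bsub>M\<^esub> f z' = \<zero>\<^bsub>M\<^esub>" by simp
      moreover have "f z = (f z \<oplus>\<^bsub>M\<^esub> \<ominus>\<^bsub>M\<^esub> f z') \<oplus>\<^bsub>M\<^esub> f z'"
        using z fD(1) by (simp add: M.a_assoc M.l_neg)
      ultimately show ?thesis using fD(1)[OF z(2)] by simp
    qed
    have "\<forall>u\<in>carrier (F 0). \<exists>z. z \<in> carrier (F 1) \<and> d 0 z = a \<odot>\<^bsub>F 0\<^esub> u"
    proof
      fix u assume u: "u \<in> carrier (F 0)"
      have "e (a \<odot>\<^bsub>F 0\<^esub> u) \<in> mm" using eD(1,3) u ac ideal.I_r_closed[OF mm_ideal a] by simp
      then have "a \<odot>\<^bsub>F 0\<^esub> u \<in> d 0 ` carrier (F 1)" using e_ker[of "a \<odot>\<^bsub>F 0\<^esub> u"] ker\<epsilon> u ac by simp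
      then show "\<exists>z. z \<in> carrier (F 1) \<and> d 0 z = a \<odot>\<^bsub>F 0\<^esub> u" by auto
    qed
    then obtain \<zeta> where \<zeta>: "\<And>u. u \<in> carrier (F 0) \<Longrightarrow> \<zeta> u \<in> carrier (F 1)"
      "\<And>u. u \<in> carrier (F 0) \<Longrightarrow> d 0 (\<zeta> u) = a \<odot>\<^bsub>F 0\<^esub> u" by (metis bchoice)
    define g where "g = (\<lambda>u\<in>carrier (F 0). f (\<zeta> u))"
    have "f (\<zeta> (u \<oplus>\<^bsub>F 0\<^esub> v)) = f (\<zeta> u) \<oplus>\<^bsub>M\<^esub> f (\<zeta> v)" if u: "u \<in> carrier (F 0)" "v \<in> carrier (F 0)" for u v
    proof -
      have "f (\<zeta> (u \<oplus>\<^bsub>F 0\<^esub> v)) = f (\<zeta> u \<oplus>\<^bsub>F 1\<^esub> \<zeta> v)"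
        by (rule f_eq) (use \<zeta> u d0D ac in \<open>simp_all add: F0.smult_r_distr\<close>)
      then show ?thesis using fD(2) \<zeta>(1) u by simp
    qed
    moreover have "f (\<zeta> (r \<odot>\<^bsub>F 0\<^esub> u)) = r \<odot>\<^bsub>M\<^esub> f (\<zeta> u)" if u: "r \<in> carrier R" "u \<in> carrier (F 0)" for r u
    proof -
      have "f (\<zeta> (r \<odot>\<^bsub>F 0\<^esub> u)) = f (r \<odot>\<^bsub>F 1\<^esub> \<zeta> u)"
        by (rule f_eq) (use \<zeta> u d0D ac in \<open>simp_all add: F0.smult_left_commute[OF ac u]\<close>)
      then show ?thesis using fD(3) \<zeta>(1) u by simp
    qed
    ultimately have "g \<in> carrier (H 0)"
      using fD(1) \<zeta>(1) by (simp add: HI g_def module_hom_def)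
    moreover have "a \<odot>\<^bsub>Q\<^esub> f = (\<lambda>z\<in>carrier (F 1). g (d 0 z))"
      unfolding Q_simps H_def hom_module_simps
    proof (rule restrict_ext)
      fix z assume z: "z \<in> carrier (F 1)"
      have "g (d 0 z) = f (a \<odot>\<^bsub>F 1\<^esub> z)"
        unfolding g_def using d0D(1)[OF z] by simp (rule f_eq, use \<zeta> z d0D ac in simp_all)
      then show "a \<odot>\<^bsub>M\<^esub> f z = g (d 0 z)" using fD(3)[OF ac z] by simp
    qed
    ultimately show ?thesis by (auto simp: B_def)
  qed

  obtain f where f: "f \<in> Z" "reps f w" using rep_ex[OF w(1,3)] by auto
  obtain f' where f': "f' \<in> Z" "reps f' w'" using rep_ex[OF w(2,4)] by auto
  have "f \<notin> B" using rep_B[OF _ f(2) w(1)] w(5) by auto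
  then have "f' \<in> B <+>\<^bsub>Q\<^esub> Q.cyclic_submodule f"
    by (intro Q.quotient_one_generator[OF B _ killed])
      (use f(1) f'(1) gens coh in \<open>simp_all add: Q_simps flip: Q_def\<close>)
  then obtain \<beta> s where \<beta>: "\<beta> \<in> B" "s \<in> carrier R" "f' = \<beta> \<oplus>\<^bsub>H 1\<^esub> s \<odot>\<^bsub>H 1\<^esub> f"
    unfolding Q.mem_add_cyclic Q_simps by auto
  \<comment> \<open>\<beta> = f' - s f represents w' - s w, and a coboundary represents only
    elements of xM.\<close>
  define v where "v = w' \<oplus>\<^bsub>M\<^esub> \<ominus>\<^bsub>M\<^esub> (s \<odot>\<^bsub>M\<^esub> w)"
  have vc: "v \<in> carrier M" using w \<beta>(2) by (simp add: v_def)
  have "reps \<beta> v"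
    unfolding reps_def
  proof
    fix z assume z: "z \<in> carrier (F 1)"
    have \<beta>Z: "\<beta> \<in> Z" using Q.submoduleE(1)[OF B] \<beta>(1) by (auto simp: Q_simps)
    have c: "\<beta> z \<in> carrier M" "f z \<in> carrier M"
      using \<beta>Z f(1) module_homD(1)[OF _ z] by (auto simp: Z_def HI)
    have ec: "e (d 0 z) \<in> carrier R" using eD(1) d0D(1) z by simp
    have "e (d 0 z) \<odot>\<^bsub>M\<^esub> w' = x \<odot>\<^bsub>M\<^esub> f' z" using f'(2) z by (simp add: reps_def)
    also have "\<dots> = x \<odot>\<^bsub>M\<^esub> \<beta> z \<oplus>\<^bsub>M\<^esub> s \<odot>\<^bsub>M\<^esub> (x \<odot>\<^bsub>M\<^esub> f z)"
      using z \<beta>(2,3) c xc smult_left_commute[OF xc \<beta>(2) c(2)]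
      by (simp add: H_eval smult_r_distr)
    also have "x \<odot>\<^bsub>M\<^esub> f z = e (d 0 z) \<odot>\<^bsub>M\<^esub> w" using f(2) z by (simp add: reps_def)
    also have "s \<odot>\<^bsub>M\<^esub> (e (d 0 z) \<odot>\<^bsub>M\<^esub> w) = e (d 0 z) \<odot>\<^bsub>M\<^esub> (s \<odot>\<^bsub>M\<^esub> w)"
      by (rule smult_left_commute[OF \<beta>(2) ec w(1)])
    finally have eq: "e (d 0 z) \<odot>\<^bsub>M\<^esub> w' = x \<odot>\<^bsub>M\<^esub> \<beta> z \<oplus>\<^bsub>M\<^esub> e (d 0 z) \<odot>\<^bsub>M\<^esub> (s \<odot>\<^bsub>M\<^esub> w)" .
    have "e (d 0 z) \<odot>\<^bsub>M\<^esub> v = e (d 0 z) \<odot>\<^bsub>M\<^esub> w' \<oplus>\<^bsub>M\<^esub> \<ominus>\<^bsub>M\<^esub> (e (d 0 z) \<odot>\<^bsub>M\<^esub> (s \<odot>\<^bsub>M\<^esub> w))"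
      unfolding v_def using ec w \<beta>(2) by (simp add: smult_r_distr smult_r_minus)
    also have "\<dots> = x \<odot>\<^bsub>M\<^esub> \<beta> z"
      unfolding eq using ec w(1) \<beta>(2) c(1) xc by (simp add: M.a_assoc M.r_neg)
    finally show "x \<odot>\<^bsub>M\<^esub> \<beta> z = e (d 0 z) \<odot>\<^bsub>M\<^esub> v" by simp
  qed
  then have "v \<in> ?xM" by (rule rep_B[OF \<beta>(1) _ vc])
  moreover have "w' = v \<oplus>\<^bsub>M\<^esub> s \<odot>\<^bsub>M\<^esub> w" unfolding v_def using w \<beta>(2) by (simp add: M.a_assoc M.l_neg)
  ultimately show ?thesis unfolding mem_add_cyclic using \<beta>(2) by auto
qed

end

section \<open>Dimension and multiplicity\<close>

lemma krull_dim_geI: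
  assumes "\<And>i. i \<le> n \<Longrightarrow> primeideal (P i) R" "\<And>i. i < n \<Longrightarrow> P i \<subset> P (Suc i)"
  shows "enat n \<le> krull_dim R"
  unfolding krull_dim_def by (rule Sup_upper) (use assms in auto)

context local_module begin

text \<open>An ideal maximal among those disjoint from the multiplicative set \<open>{x\<^sup>i s | s \<notin> P}\<close> is a prime
  strictly below \<open>P\<close>.\<close>
lemma prime_containing_regular:
  assumes dim: "krull_dim R = 1" and x: "x \<in> carrier R"
    and reg: "\<And>r. r \<in> carrier R \<Longrightarrow> x \<otimes> r = \<zero> \<Longrightarrow> r = \<zero>"
    and P: "primeideal P R" "x \<in> P"
  shows "P = mm"
proof (rule ccontr)
  assume neq: "P \<noteq> mm"
  interpret P: primeideal P R by fact
  have Pone: "\<one> \<notin> P" using P.one_imp_carrier P.I_notcarr by auto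
  have Pmm: "P \<subset> mm" using ideal_le_mm[OF P.is_ideal Pone] neq by auto
  define S where "S = {y. \<exists>i::nat. \<exists>s. s \<in> carrier R \<and> s \<notin> P \<and> y = x [^] i \<otimes> s}"
  have SI: "x [^] i \<otimes> s \<in> S" if "s \<in> carrier R" "s \<notin> P" for i :: nat and s using that by (auto simp: S_def)
  have S_mult: "y \<otimes> z \<in> S" if yz: "y \<in> S" "z \<in> S" for y z
  proof -
    obtain i s j t where *: "s \<in> carrier R" "s \<notin> P" "y = x [^] (i::nat) \<otimes> s"
      "t \<in> carrier R" "t \<notin> P" "z = x [^] (j::nat) \<otimes> t" using yz by (auto simp: S_def)
    have "y \<otimes> z = x [^] (i + j) \<otimes> (s \<otimes> t)"
      using * x by (simp add: R.nat_pow_mult[symmetric] R.m_ac)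
    moreover have "s \<otimes> t \<notin> P" using P.I_prime *(1,2,4,5) by auto
    ultimately show ?thesis using SI[of "s \<otimes> t" "i + j"] * by simp
  qed
  have zero: "\<zero> \<notin> S"
  proof
    assume "\<zero> \<in> S"
    then obtain i s where s: "s \<in> carrier R" "s \<notin> P" "\<zero> = x [^] (i::nat) \<otimes> s" by (auto simp: S_def)
    have "s = \<zero>" using s(1) s(3)[symmetric]
    proof (induction i arbitrary: s)
      case (Suc i)
      then have "x [^] i \<otimes> (x \<otimes> s) = \<zero>" using x by (simp add: R.m_assoc)
      then have "x \<otimes> s = \<zero>" using Suc.IH[of "x \<otimes> s"] Suc.prems(1) x by simp
      then show ?case using reg Suc.prems(1) by simp
    qed simp
    then show False using s(2) by simp
  qed
  let ?F = "{I. ideal I R \<and> I \<inter> S = {}}"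
  have "{\<zero>} \<in> ?F" using R.zeroideal zero by simp
  then have "?F \<noteq> {}" by (metis empty_iff)
  then obtain Q where QF: "Q \<in> ?F" and mx: "\<And>K. K \<in> ?F \<Longrightarrow> Q \<subseteq> K \<Longrightarrow> K = Q"
    by (rule noetherian_ring.ideal_family_maximal[OF noetherian]) auto
  have Q: "ideal Q R" "Q \<inter> S = {}" using QF by auto
  interpret Q: ideal Q R by (rule Q(1))
  have oneS: "\<one> \<in> S" using SI[OF R.one_closed Pone, of 0] by simp
  have xS: "x \<in> S" using SI[OF R.one_closed Pone, of 1] x by simp
  have meets: "\<exists>q\<in>Q. \<exists>r\<in>carrier R. q \<oplus> r \<otimes> a \<in> S" if a: "a \<in> carrier R" "a \<notin> Q" for a
  proof -
    let ?K = "Q <+>\<^bsub>R\<^esub> (PIdl a)"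
    have K: "ideal ?K R" by (rule R.add_ideals[OF Q(1) R.cgenideal_ideal[OF a(1)]])
    have mem: "q \<oplus> r \<otimes> a \<in> ?K" if "q \<in> Q" "r \<in> carrier R" for q r
      using that unfolding set_add_def' cgenideal_def by blast
    have "q \<in> ?K" if "q \<in> Q" for q using mem[OF that, of \<zero>] a(1) Q.Icarr[OF that] by simp
    moreover have "a \<in> ?K" using mem[of \<zero> \<one>] a(1) by simp
    ultimately have "?K \<notin> ?F" using mx[of ?K] a(2) by auto
    then obtain y where "y \<in> ?K" "y \<in> S" using K by auto
    then show ?thesis unfolding set_add_def' cgenideal_def by auto
  qed
  have "primeideal Q R"
  proof (rule primeidealI[OF Q(1) R.is_cring])
    show "carrier R \<noteq> Q" using oneS Q(2) by auto
    fix a b assume ab: "a \<in> carrier R" "b \<in> carrier R" "a \<otimes> b \<in> Q"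
    show "a \<in> Q \<or> b \<in> Q"
    proof (rule ccontr)
      assume "\<not> ?thesis"
      then obtain q r q' r' where *: "q \<in> Q" "r \<in> carrier R" "q \<oplus> r \<otimes> a \<in> S"
        "q' \<in> Q" "r' \<in> carrier R" "q' \<oplus> r' \<otimes> b \<in> S"
        using meets[OF ab(1)] meets[OF ab(2)] by auto
      have qc: "q \<in> carrier R" "q' \<in> carrier R" using *(1,4) Q.Icarr by auto
      have "(q \<oplus> r \<otimes> a) \<otimes> (q' \<oplus> r' \<otimes> b) = q \<otimes> (q' \<oplus> r' \<otimes> b) \<oplus> ((r \<otimes> a) \<otimes> q' \<oplus> (r \<otimes> r') \<otimes> (a \<otimes> b))"
        using qc *(2,5) ab(1,2) by (simp add: R.l_distr R.r_distr R.m_ac R.a_ac)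
      moreover have "q \<otimes> (q' \<oplus> r' \<otimes> b) \<in> Q" by (rule Q.I_r_closed[OF *(1)]) (use qc *(5) ab(2) in simp)
      moreover have "(r \<otimes> a) \<otimes> q' \<in> Q" by (rule Q.I_l_closed[OF *(4)]) (use *(2) ab(1) in simp)
      moreover have "(r \<otimes> r') \<otimes> (a \<otimes> b) \<in> Q" by (rule Q.I_l_closed[OF ab(3)]) (use *(2,5) in simp)
      ultimately have "(q \<oplus> r \<otimes> a) \<otimes> (q' \<oplus> r' \<otimes> b) \<in> Q" by (simp add: Q.a_closed)
      then show False using S_mult[OF *(3,6)] Q(2) by auto
    qed
  qed
  \<comment> \<open>The exponent 0 puts the complement of \<open>P\<close> into \<open>S\<close>, so
    Q lies in \<open>P\<close>; \<open>x\<close> belongs to \<open>P\<close> and to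
    \<open>S\<close>, so the inclusion is strict.\<close>
  moreover have "Q \<subset> P"
  proof -
    have "y \<in> P" if y: "y \<in> Q" for y
      using SI[of y 0] y Q.Icarr[OF y] Q(2) by auto
    then show ?thesis using P(2) xS Q(2) by auto
  qed
  \<comment> \<open>The chain Q, P, \<open>mm\<close> of primes has two strict inclusions.\<close>
  ultimately have "enat 2 \<le> krull_dim R"
    by (intro krull_dim_geI[where P = "\<lambda>i. if i = 0 then Q else if i = 1 then P else mm"])
      (use Pmm P(1) mm_prime in \<open>auto simp: less_Suc_eq numeral_2_eq_2\<close>)
  then show False unfolding dim by (simp add: one_enat_def)
qed

text \<open>Primes of R/J pull back to primes above \<open>J\<close>, so R/J has at most one prime.
  If it has none, that is, if \<open>J\<close> is the whole ring, the supremum over the empty set is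
  0 as well.\<close>

lemma krull_dim_quotient_zero:
  assumes J: "ideal J R" and primes: "\<And>P. primeideal P R \<Longrightarrow> J \<subseteq> P \<Longrightarrow> P = mm"
  shows "krull_dim (R Quot J) = 0"
proof -
  let ?q = "\<lambda>r. J +>\<^bsub>R\<^esub> r"
  interpret J: ideal J R by fact
  have q_zero: "\<zero>\<^bsub>R Quot J\<^esub> = J" by (simp only: FactRing_def ring.simps)
  interpret q: ring_hom_ring R "R Quot J" ?q by (rule J.rcos_ring_hom_ring)
  have pre: "{r \<in> carrier R. ?q r \<in> P} = mm" if P: "primeideal P (R Quot J)" for P
  proof (rule primes)
    interpret P: primeideal P "R Quot J" by fact
    have Pone: "\<one>\<^bsub>R Quot J\<^esub> \<notin> P" using P.one_imp_carrier P.I_notcarr by auto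
    show "primeideal {r \<in> carrier R. ?q r \<in> P} R"
    proof (rule primeidealI[OF q.ideal_vimage[OF P.is_ideal] R.is_cring])
      show "carrier R \<noteq> {r \<in> carrier R. ?q r \<in> P}" using Pone q.hom_one R.one_closed by (metis (mono_tags, lifting) mem_Collect_eq)
      fix a b assume ab: "a \<in> carrier R" "b \<in> carrier R" "a \<otimes> b \<in> {r \<in> carrier R. ?q r \<in> P}"
      then have "?q a \<otimes>\<^bsub>R Quot J\<^esub> ?q b \<in> P" using q.hom_mult by simp
      then show "a \<in> {r \<in> carrier R. ?q r \<in> P} \<or> b \<in> {r \<in> carrier R. ?q r \<in> P}"
        using P.I_prime[of "?q a" "?q b"] ab q.hom_closed by auto
    qed
    show "J \<subseteq> {r \<in> carrier R. ?q r \<in> P}"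
    proof
      fix j assume j: "j \<in> J"
      have "?q j = J" by (rule J.a_rcos_const[OF j])
      moreover have "J \<in> P" using P.zero_closed unfolding q_zero .
      ultimately show "j \<in> {r \<in> carrier R. ?q r \<in> P}" using J.Icarr[OF j] by simp
    qed
  qed
  have eq: "P = ?q ` mm" if P: "primeideal P (R Quot J)" for P
  proof -
    interpret P: primeideal P "R Quot J" by fact
    have "P \<subseteq> ?q ` carrier R" using P.a_subset by (auto simp: FactRing_def A_RCOSETS_def' a_r_coset_def')
    then show ?thesis using pre[OF P] by auto
  qed
  have "n = 0" if "\<forall>i\<le>n. primeideal (P i) (R Quot J)" "\<forall>i<n. P i \<subset> P (Suc i)" for n and P :: "nat \<Rightarrow> 'a set set"
  proof (rule ccontr)
    assume "n \<noteq> 0"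
    then have "primeideal (P 0) (R Quot J)" "primeideal (P 1) (R Quot J)" "P 0 \<subset> P 1" using that by auto
    then show False using eq[of "P 0"] eq[of "P 1"] by (metis psubset_eq)
  qed
  then have "krull_dim (R Quot J) \<le> 0"
    unfolding krull_dim_def by (intro Sup_least) (auto simp: zero_enat_def)
  then show ?thesis by simp
qed

section \<open>Lengths of quotients and powers of the maximal ideal\<close>

lemma module_length_quot_geI:
  assumes N: "submodule N R M" and V: "\<And>i. i \<le> n \<Longrightarrow> submodule (V i) R M" "\<And>i. i \<le> n \<Longrightarrow> N \<subseteq> V i"
    and strict: "\<And>i. i < n \<Longrightarrow> V i \<subset> V (Suc i)"
  shows "enat n \<le> module_length R (quot_module M N)"
proof -
  let ?q = "\<lambda>x. N +>\<^bsub>M\<^esub> x"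
  have "?q ` V i \<subset> ?q ` V (Suc i)" if i: "i < n" for i
  proof -
    have Vi: "submodule (V i) R M" "submodule (V (Suc i)) R M" "N \<subseteq> V i" using V i by auto
    obtain y where y: "y \<in> V (Suc i)" "y \<notin> V i" using strict[OF i] by auto
    have yc: "y \<in> carrier M" using y(1) submoduleE(1)[OF Vi(2)] by auto
    have "?q y \<notin> ?q ` V i"
    proof
      assume "?q y \<in> ?q ` V i"
      then obtain v where v: "v \<in> V i" "?q y = ?q v" by auto
      have vc: "v \<in> carrier M" using v(1) submoduleE(1)[OF Vi(1)] by auto
      obtain b where "b \<in> N" "y = b \<oplus>\<^bsub>M\<^esub> v" by (rule coset_mem_eq[OF N yc vc v(2)])
      then show False using y(2) Vi(3) v(1) submoduleE(5)[OF Vi(1)] by auto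
    qed
    then show ?thesis using image_mono[of "V i" "V (Suc i)" ?q] strict[OF i] y(1) by auto
  qed
  moreover have "submodule (?q ` V i) R (quot_module M N)" if "i \<le> n" for i
    by (rule submodule_image[OF module_axioms quot_module_module[OF N] quot_proj_hom[OF N] V(1)[OF that]])
  ultimately have "(\<forall>i\<le>n. submodule (?q ` V i) R (quot_module M N)) \<and> (\<forall>i<n. ?q ` V i \<subset> ?q ` V (Suc i))"
    by simp
  then show ?thesis
    unfolding module_length_def
    by - (rule Sup_upper, rule CollectI, rule exI[of _ n], rule conjI[OF refl], rule exI[of _ "\<lambda>i. ?q ` V i"])
qed

lemma module_length_quot_antimono:
  assumes N: "submodule N R M" and N': "submodule N' R M" and le: "N \<subseteq> N'"
  shows "module_length R (quot_module M N') \<le> module_length R (quot_module M N)"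
  unfolding module_length_def[of R "quot_module M N'"]
proof (rule Sup_least)
  fix l assume "l \<in> {enat n | n. \<exists>V :: nat \<Rightarrow> 'c set set. (\<forall>i\<le>n. submodule (V i) R (quot_module M N')) \<and>
    (\<forall>i<n. V i \<subset> V (Suc i))}"
  then obtain n and V :: "nat \<Rightarrow> 'c set set" where l: "l = enat n"
    and V: "\<And>i. i \<le> n \<Longrightarrow> submodule (V i) R (quot_module M N')" "\<And>i. i < n \<Longrightarrow> V i \<subset> V (Suc i)" by auto
  let ?q = "\<lambda>x. N' +>\<^bsub>M\<^esub> x"
  interpret Q: plain_module R "quot_module M N'" by (rule plain_module.intro[OF quot_module_module[OF N']])
  show "l \<le> module_length R (quot_module M N)"
    unfolding l
  proof (rule module_length_quot_geI[OF N])
    fix i assume i: "i \<le> n"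
    show "submodule {x \<in> carrier M. ?q x \<in> V i} R M"
      by (rule submodule_vimage[OF module_axioms quot_module_module[OF N'] quot_proj_hom[OF N'] V(1)[OF i]])
    have "N' \<in> V i" using Q.submodule_zero[OF V(1)[OF i]] quot_module_zero[OF N'] by simp
    moreover have "x \<in> carrier M" "?q x = N'" if "x \<in> N" for x
      using that le submoduleE(1)[OF N'] coset_eq_iff[OF N', of x] by auto
    ultimately show "N \<subseteq> {x \<in> carrier M. ?q x \<in> V i}" by auto
  next
    fix i assume i: "i < n"
    obtain X where X: "X \<in> V (Suc i)" "X \<notin> V i" using V(2)[OF i] by auto
    have "X \<in> carrier (quot_module M N')" using X(1) Q.submoduleE(1)[OF V(1)[of "Suc i"]] i by auto
    then obtain y where "y \<in> carrier M" "X = ?q y" by (auto simp: quot_module_carrier[OF N'])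
    then show "{x \<in> carrier M. ?q x \<in> V i} \<subset> {x \<in> carrier M. ?q x \<in> V (Suc i)}"
      using X V(2)[OF i] by auto
  qed
qed

lemma mm_power:
  "mm [^]\<^bsub>ideals_set R\<^esub> (0::nat) = carrier R"
  "mm [^]\<^bsub>ideals_set R\<^esub> (Suc n) = (mm [^]\<^bsub>ideals_set R\<^esub> n) \<cdot>\<^bsub>R\<^esub> mm"
  by (simp_all add: nat_pow_def ideals_set_def)

lemma mm_power_ideal: "ideal (mm [^]\<^bsub>ideals_set R\<^esub> (n::nat)) R"
  by (induction n) (simp_all only: mm_power R.oneideal R.ideal_prod_is_ideal mm_ideal)

lemma ideal_smult_mono: "I \<subseteq> J \<Longrightarrow> ideal_smult R I M \<subseteq> ideal_smult R J M"
  unfolding ideal_smult_def mspan_def by (intro Inter_anti_mono) blast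

end

section \<open>Minimal generators and multiplicity in dimension zero\<close>

context fg_local_module begin

text \<open>A lower bound for the length of M/mM. The members of a minimal generating set are added
  to mM one at a time; if one of them brought nothing new, Nakayama's lemma would allow it to be
  dropped.\<close>

lemma strict_chain_min_gens:
  assumes k: "min_gens R M = enat k"
  shows "(strict_step ^^ k) (ideal_smult R mm M) (carrier M)"
proof -
  let ?N = "ideal_smult R mm M"
  have N: "submodule ?N R M" by (rule ideal_smult_is_submodule) (use mm_carrier in auto)
  obtain S where S: "finite S" "S \<subseteq> carrier M" "mspan R M S = carrier M" "enat (card S) = min_gens R M"
    by (rule min_gens_attained[OF fg])
  have least: "enat k \<le> enat (card T)" if "finite T" "T \<subseteq> carrier M" "mspan R M T = carrier M" for T
    unfolding k[symmetric] min_gens_def by (rule Inf_lower) (use that in auto)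
  have sub: "submodule (mspan R M T) R M" if "T \<subseteq> S" for T
    by (rule mspan_is_submodule) (use that S(2) in auto)
  have "(strict_step ^^ card T) ?N (?N <+>\<^bsub>M\<^esub> mspan R M T)" if "finite T" "T \<subseteq> S" for T
    using that
  proof (induction T)
    case empty
    have "mspan R M {} \<subseteq> {\<zero>\<^bsub>M\<^esub>}" by (rule mspan_least[OF submodule_zero_set]) simp
    then have "mspan R M {} \<subseteq> ?N" using submodule_zero[OF N] by auto
    then have "?N <+>\<^bsub>M\<^esub> mspan R M {} = ?N"
      using set_add_least[OF N subset_refl] set_add_upper(1)[OF N sub[of "{}"]] by auto
    then show ?case by simp
  next
    case (insert a T)
    let ?A = "?N <+>\<^bsub>M\<^esub> mspan R M T" and ?B = "?N <+>\<^bsub>M\<^esub> mspan R M (insert a T)"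
    have T: "T \<subseteq> S" "a \<in> S" "insert a T \<subseteq> S" using insert.prems by auto
    have AB: "submodule ?A R M" "submodule ?B R M" using submodule_set_add[OF N] sub T by auto
    have "mspan R M T \<subseteq> mspan R M (insert a T)"
      by (rule mspan_least[OF sub[OF T(3)]]) (use mspan_superset[of "insert a T"] in auto)
    then have le: "?A \<subseteq> ?B" by (intro set_add_mono) auto
    have "a \<notin> ?A"
    proof
      assume a: "a \<in> ?A"
      let ?S = "S - {a}"
      have S': "?S \<subseteq> S" by auto
      let ?D = "?N <+>\<^bsub>M\<^esub> mspan R M ?S"
      note D = submodule_set_add[OF N sub[OF S']]
      have "T \<subseteq> ?S" using T(1) insert.hyps(2) by auto
      then have "mspan R M T \<subseteq> mspan R M ?S"
        by (intro mspan_least[OF sub[OF S']]) (use mspan_superset[of ?S] in auto)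
      then have "?A \<subseteq> ?D" by (intro set_add_mono) auto
      then have "S \<subseteq> ?D" using a set_add_upper(2)[OF N sub[OF S']] mspan_superset[of ?S] by auto
      then have CD: "carrier M \<subseteq> ?D" using mspan_least[OF D] S(3) by auto
      have "carrier M \<subseteq> mspan R M ?S"
      proof (rule nakayama[OF sub[OF S'] carrier_is_submodule])
        fix U assume U: "submodule U R M" "mspan R M ?S \<subseteq> U"
          "\<And>c v. c \<in> mm \<Longrightarrow> v \<in> carrier M \<Longrightarrow> c \<odot>\<^bsub>M\<^esub> v \<in> U"
        have "?N \<subseteq> U" by (rule ideal_smult_least[OF U(1) U(3)])
        then show "carrier M \<subseteq> U" using CD set_add_least[OF U(1) _ U(2)] by (meson order_trans)
      qed
      then have "mspan R M ?S = carrier M" using submoduleE(1)[OF sub[OF S']] by auto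
      then have "k \<le> card ?S" using least[of ?S] S(1,2) by auto
      moreover have "card ?S < card S" using S(1) T(2) by (rule card_Diff1_less)
      ultimately show False using S(4) k by simp
    qed
    moreover have "a \<in> ?B" using set_add_upper(2)[OF N sub[OF T(3)]] mspan_superset[of "insert a T"] by auto
    ultimately have "strict_step ?A ?B" unfolding strict_step_def using AB le by auto
    then show ?case using insert.IH[OF T(1)] insert.hyps by (simp add: relcomppI)
  qed
  from this[OF S(1) subset_refl] have "(strict_step ^^ k) ?N (?N <+>\<^bsub>M\<^esub> carrier M)" using S(3,4) k by simp
  moreover have "?N <+>\<^bsub>M\<^esub> carrier M = carrier M"
    using set_add_least[OF carrier_is_submodule submoduleE(1)[OF N] subset_refl]
      set_add_upper(2)[OF N carrier_is_submodule] by auto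
  ultimately show ?thesis by simp
qed

text \<open>By Nakayama's lemma for the submodule mM, equality would force mM = 0.\<close>

lemma strict_step_square:
  assumes "\<not> ideal_smult R mm M \<subseteq> {\<zero>\<^bsub>M\<^esub>}"
  shows "strict_step (ideal_smult R (mm [^]\<^bsub>ideals_set R\<^esub> (2::nat)) M) (ideal_smult R mm M)"
proof -
  let ?I = "mm [^]\<^bsub>ideals_set R\<^esub> (1::nat)" and ?J = "mm [^]\<^bsub>ideals_set R\<^esub> (2::nat)"
  let ?N = "ideal_smult R mm M"
  \<comment> \<open>By the recursion the first power is the product of \<open>carrier R\<close> with
    \<open>mm\<close>; its inclusion in \<open>mm\<close> is enough.\<close>
  have J: "?J = ?I \<cdot>\<^bsub>R\<^esub> mm" and I: "?I = carrier R \<cdot>\<^bsub>R\<^esub> mm"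
    using mm_power(2)[of 1] mm_power(1) mm_power(2)[of 0] by (simp_all add: numeral_2_eq_2)
  have Imm: "?I \<subseteq> mm"
    unfolding I by (rule order_trans[OF R.ideal_prod_inter[OF R.oneideal mm_ideal] Int_lower2])
  have Jmm: "?J \<subseteq> mm"
    unfolding J by (rule order_trans[OF R.ideal_prod_inter[OF mm_power_ideal mm_ideal] Int_lower2])
  have N: "submodule ?N R M" by (rule ideal_smult_is_submodule) (use mm_carrier in auto)
  have N2: "submodule (ideal_smult R ?J M) R M" by (rule ideal_smult_is_submodule) (use mm_carrier Jmm in auto)
  have "\<not> ?N \<subseteq> ideal_smult R ?J M"
  proof
    assume le: "?N \<subseteq> ideal_smult R ?J M"
    have "?N \<subseteq> {\<zero>\<^bsub>M\<^esub>}"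
    proof (rule nakayama[OF submodule_zero_set N])
      fix T assume T: "submodule T R M" "\<And>a v. a \<in> mm \<Longrightarrow> v \<in> ?N \<Longrightarrow> a \<odot>\<^bsub>M\<^esub> v \<in> T"
      have "c \<odot>\<^bsub>M\<^esub> y \<in> T" if c: "c \<in> ?J" and y: "y \<in> carrier M" for c y
      proof -
        have "c \<in> carrier R \<and> c \<odot>\<^bsub>M\<^esub> y \<in> T" using c unfolding J
        proof (induction rule: ideal_prod.induct)
          case (prod i j)
          then have ij: "i \<in> mm" "i \<in> carrier R" "j \<in> carrier R" using Imm mm_carrier by auto
          have "i \<odot>\<^bsub>M\<^esub> (j \<odot>\<^bsub>M\<^esub> y) \<in> T" by (rule T(2)[OF ij(1) ideal_smult_mem[OF prod(2) y]])
          then show ?case using ij y by (simp add: smult_assoc1)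
        next
          case (sum s t)
          then show ?case using submoduleE(5)[OF T(1)] y by (simp add: smult_l_distr)
        qed
        then show ?thesis by simp
      qed
      then have "ideal_smult R ?J M \<subseteq> T" by (rule ideal_smult_least[OF T(1)])
      then show "?N \<subseteq> T" using le by simp
    qed
    then show False using assms by simp
  qed
  then show ?thesis unfolding strict_step_def using N N2 ideal_smult_mono[OF Jmm] by auto
qed

text \<open>If mM is not zero, M/m^2 M has length at least \<mu>(M) + 1: \<mu>(M) steps above mM and
  one more below it. In dimension 0 the multiplicity is at least that length.\<close>

lemma mm_smult_zero_of_multiplicity:
  assumes mm: "max_ideal R = mm" and dim: "module_dim R M = 0"
    and mult: "ereal_of_enat (min_gens R M) = multiplicity_at_max R M"
    and a: "a \<in> mm" and y: "y \<in> carrier M"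
  shows "a \<odot>\<^bsub>M\<^esub> y = \<zero>\<^bsub>M\<^esub>"
proof (rule ccontr)
  assume nz: "a \<odot>\<^bsub>M\<^esub> y \<noteq> \<zero>\<^bsub>M\<^esub>"
  define W where "W n = ideal_smult R (mm [^]\<^bsub>ideals_set R\<^esub> n) M" for n :: nat
  have W: "submodule (W n) R M" for n
    unfolding W_def by (rule ideal_smult_is_submodule) (use ideal.Icarr[OF mm_power_ideal] in auto)
  define L where "L n = module_length R (quot_module M (W n))" for n
  have "W (Suc n) \<subseteq> W n" for n
    unfolding W_def mm_power using R.ideal_prod_inter[OF mm_power_ideal mm_ideal]
    by (intro ideal_smult_mono) auto
  then have "L n \<le> L (Suc n)" for n unfolding L_def by (intro module_length_quot_antimono W)
  then have "incseq (\<lambda>n. ereal_of_enat (L n))" by (intro incseq_SucI) simp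
  \<comment> \<open>\<open>lim\<close> is a definite description, so its value is known only once
    convergence is shown; an increasing sequence in \<open>ereal\<close> converges to its
    supremum.\<close>
  then have "(\<lambda>n. ereal_of_enat (L n)) \<longlonglongrightarrow> (SUP n. ereal_of_enat (L n))" by (rule LIMSEQ_SUP)
  then have "lim (\<lambda>n. ereal_of_enat (L n)) = (SUP n. ereal_of_enat (L n))" by (rule limI)
  \<comment> \<open>With r = 0 both the factorial and n^r equal 1, also at n = 0.\<close>
  moreover have "multiplicity_at_max R M = lim (\<lambda>n. ereal_of_enat (L n))"
    unfolding multiplicity_at_max_def dim mm L_def W_def by (simp add: Let_def zero_enat_def divide_ereal_def flip: one_ereal_def)
  ultimately have "ereal_of_enat (L 2) \<le> ereal_of_enat (min_gens R M)"
    using mult SUP_upper[of 2 UNIV "\<lambda>n. ereal_of_enat (L n)"] by simp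
  then have L2: "L 2 \<le> min_gens R M" by simp
  obtain k where k: "min_gens R M = enat k" using fg by auto
  have "a \<odot>\<^bsub>M\<^esub> y \<in> ideal_smult R mm M" by (rule ideal_smult_mem[OF a y])
  then have "strict_step (W 2) (ideal_smult R mm M)"
    unfolding W_def using nz by (intro strict_step_square) auto
  then have chain: "(strict_step ^^ Suc k) (W 2) (carrier M)"
    using strict_chain_min_gens[OF k] by (rule relpowp_Suc_I2)
  then obtain V where V: "V 0 = W 2" "V (Suc k) = carrier M" "\<And>i. i < Suc k \<Longrightarrow> strict_step (V i) (V (Suc i))"
    unfolding relpowp_fun_conv by auto
  have "enat (Suc k) \<le> L 2"
    unfolding L_def
  proof (rule module_length_quot_geI[OF W, where V = V])
    fix i assume i: "i \<le> Suc k"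
    show "submodule (V i) R M"
      using V(2) V(3)[of i] i carrier_is_submodule by (cases "i = Suc k") (auto simp: strict_step_def)
    show "W 2 \<subseteq> V i" using i
    proof (induction i)
      case (Suc i)
      then show ?case using V(3)[of i] by (auto simp: strict_step_def)
    qed (simp add: V(1))
  qed (use V(3) in \<open>auto simp: strict_step_def\<close>)
  then have "enat (Suc k) \<le> enat k" using L2 unfolding k by (rule order_trans)
  then show False by simp
qed

end

section \<open>Almost Gorenstein rings of dimension one\<close>

lemma min_gens_image_finite:
  assumes "module R M" "module R C" and \<psi>: "\<psi> \<in> module_hom R M C" "\<psi> ` carrier M = carrier C"
    and fg: "min_gens R M < \<infinity>"
  shows "min_gens R C < \<infinity>"
proof -
  interpret M: plain_module R M using assms(1) by (rule plain_module.intro)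
  interpret C: plain_module R C using assms(2) by (rule plain_module.intro)
  obtain S where S: "finite S" "S \<subseteq> carrier M" "mspan R M S = carrier M" by (rule min_gens_attained[OF fg])
  have im: "\<psi> ` S \<subseteq> carrier C" using S(2) \<psi>(2) by auto
  note span = C.mspan_is_submodule[OF im]
  have "carrier M \<subseteq> {x \<in> carrier M. \<psi> x \<in> mspan R C (\<psi> ` S)}"
    unfolding S(3)[symmetric]
    by (rule M.mspan_least)
      (use submodule_vimage[OF assms(1,2) \<psi>(1) span] S(2,3) C.mspan_superset[of "\<psi> ` S"] in auto)
  then have "carrier C \<subseteq> mspan R C (\<psi> ` S)" unfolding \<psi>(2)[symmetric] by auto
  then have "mspan R C (\<psi> ` S) = carrier C" using C.submoduleE(1)[OF span] by auto
  then have "min_gens R C \<le> enat (card (\<psi> ` S))"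
    unfolding min_gens_def using S(1) im by (intro Inf_lower) auto
  then show ?thesis by (cases "min_gens R C") auto
qed

lemma (in plain_module) nonzerodivisor_of_positive_depth:
  assumes "depth R M = 1"
  obtains x where "x \<in> max_ideal R" "nonzerodivisor_on M x"
proof -
  have "\<exists>xs. regular_sequence R M xs \<and> xs \<noteq> []"
  proof (rule ccontr)
    assume "\<not> ?thesis"
    then have "depth R M \<le> 0"
      unfolding depth_def by (intro Sup_least) (auto simp: zero_enat_def)
    then show False using assms by simp
  qed
  then obtain xs where xs: "regular_sequence R M xs" "xs \<noteq> []" by auto
  \<comment> \<open>The first entry of a regular sequence is tested on M modulo the ideal of the
    empty prefix times M. That submodule is zero and its cosets are singletons, so the condition is
    regularity on \<open>M\<close> itself.\<close>
  have "Idl {} \<subseteq> {\<zero>}" by (rule R.genideal_minimal[OF R.zeroideal]) simp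
  then have "ideal_smult R (Idl {}) M \<subseteq> {\<zero>\<^bsub>M\<^esub>}"
    by (intro ideal_smult_least[OF submodule_zero_set]) auto
  moreover have "\<zero>\<^bsub>M\<^esub> \<in> ideal_smult R (Idl {}) M"
    by (intro submodule_zero ideal_smult_is_submodule) (use \<open>Idl {} \<subseteq> {\<zero>}\<close> in auto)
  ultimately have N: "ideal_smult R (Idl {}) M = {\<zero>\<^bsub>M\<^esub>}" by auto
  have "set xs \<subseteq> max_ideal R" using xs(1) by (simp add: regular_sequence_def)
  then have x: "xs ! 0 \<in> max_ideal R" using xs(2) nth_mem[of 0 xs] by auto
  have "\<forall>j<length xs. nonzerodivisor_on
      (quot_module M (ideal_smult R (Idl\<^bsub>R\<^esub> (set (take j xs))) M)) (xs ! j)"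
    using xs(1) unfolding regular_sequence_def by simp
  from this[rule_format, of 0] xs(2)
  have nz: "nonzerodivisor_on (quot_module M {\<zero>\<^bsub>M\<^esub>}) (xs ! 0)" by (simp add: N)
  show thesis
  proof (rule that[OF x])
    show "nonzerodivisor_on M (xs ! 0)"
      unfolding nonzerodivisor_on_def
    proof (intro ballI impI)
      fix y assume y: "y \<in> carrier M" "xs ! 0 \<odot>\<^bsub>M\<^esub> y = \<zero>\<^bsub>M\<^esub>"
      note Z = submodule_zero_set
      let ?Y = "{\<zero>\<^bsub>M\<^esub>} +>\<^bsub>M\<^esub> y"
      have Y: "?Y = {y}" using y(1) by (simp add: a_r_coset_def')
      have "xs ! 0 \<odot>\<^bsub>quot_module M {\<zero>\<^bsub>M\<^esub>}\<^esub> ?Y = {\<zero>\<^bsub>M\<^esub>}"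
        unfolding Y quot_module_def using y(2) by (simp add: a_r_coset_def')
      then have "?Y = {\<zero>\<^bsub>M\<^esub>}"
        using nz y(1) unfolding nonzerodivisor_on_def quot_module_carrier[OF Z] quot_module_zero[OF Z] by blast
      then show "y = \<zero>\<^bsub>M\<^esub>" using Y by simp
    qed
  qed
qed

theorem proposition6p1:
  fixes R :: "('a, 'r) ring_scheme" and \<omega> :: "('a, 'b) module"
  assumes "cohen_macaulay_local_ring R"
    and "krull_dim R = 1"
    and "canonical_module TYPE('i) R \<omega>"
    and "almost_gorenstein R \<omega>"
  shows "nearly_gorenstein R \<omega>"
proof -
  let ?m = "max_ideal R"
  have R: "cring R" "noetherian_ring R" "\<exists>!I. maximalideal I R"
    using assms(1) unfolding cohen_macaulay_local_ring_def noetherian_local_ring_def by auto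
  have m: "maximalideal ?m R" unfolding max_ideal_def by (rule theI'[OF R(3)])
  have m_unique: "I = ?m" if "maximalideal I R" for I using R(3) m that by blast
  interpret cring R by (rule R(1))
  have \<omega>: "module R \<omega>" "min_gens R \<omega> < \<infinity>" "depth R \<omega> = 1" "has_cm_type R \<omega> 1"
    using assms(2,3) unfolding canonical_module_def maximal_cohen_macaulay_def by auto
  obtain C :: "('a, 'b set) module" and \<phi> \<psi> where C: "module R C"
    and \<phi>: "\<phi> \<in> module_hom R (self_module R) \<omega>" and \<psi>: "\<psi> \<in> module_hom R \<omega> C"
    and inj: "inj_on \<phi> (carrier R)" and exact: "\<phi> ` carrier R = a_kernel \<omega> C \<psi>"
    and surj: "\<psi> ` carrier \<omega> = carrier C"
    and mult: "ereal_of_enat (min_gens R C) = multiplicity_at_max R C"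
    using assms(4) unfolding almost_gorenstein_def by auto
  note loc = local_module_axioms.intro[OF m m_unique R(2)]
  interpret W: fg_local_module R \<omega> ?m
    by (intro fg_local_module.intro local_module.intro plain_module.intro fg_local_module_axioms.intro \<omega>(1,2) loc)
  interpret C: fg_local_module R C ?m
    by (intro fg_local_module.intro local_module.intro plain_module.intro fg_local_module_axioms.intro
        C loc min_gens_image_finite[OF \<omega>(1) C \<psi> surj \<omega>(2)])
  note \<phi>D = module_homD[OF \<phi>, simplified] and \<psi>D = module_homD[OF \<psi>]
  have ker: "w \<in> \<phi> ` carrier R \<longleftrightarrow> w \<in> carrier \<omega> \<and> \<psi> w = \<zero>\<^bsub>C\<^esub>" for w
    unfolding exact a_kernel_def' by simp
  have \<phi>0: "\<phi> \<zero>\<^bsub>R\<^esub> = \<zero>\<^bsub>\<omega>\<^esub>" using module_hom_zero[OF self_module_module \<omega>(1) \<phi>] by simp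
  have \<phi>_zero: "r = \<zero>\<^bsub>R\<^esub>" if "r \<in> carrier R" "\<phi> r = \<zero>\<^bsub>\<omega>\<^esub>" for r
    using inj_onD[OF inj, of r "\<zero>\<^bsub>R\<^esub>"] that \<phi>0 by simp
  obtain x where x: "x \<in> ?m" "nonzerodivisor_on \<omega> x" by (rule W.nonzerodivisor_of_positive_depth[OF \<omega>(3)])
  note xc = W.mm_carrier[OF x(1)]
  \<comment> \<open>Regularity passes from \<omega> to R along the embedding \<phi>.\<close>
  have xreg: "r = \<zero>\<^bsub>R\<^esub>" if r: "r \<in> carrier R" "x \<otimes>\<^bsub>R\<^esub> r = \<zero>\<^bsub>R\<^esub>" for r
  proof -
    have "x \<odot>\<^bsub>\<omega>\<^esub> \<phi> r = \<zero>\<^bsub>\<omega>\<^esub>" using \<phi>D(3)[OF xc r(1)] r(2) \<phi>0 by simp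
    then have "\<phi> r = \<zero>\<^bsub>\<omega>\<^esub>" using x(2) \<phi>D(1)[OF r(1)] unfolding nonzerodivisor_on_def by simp
    then show ?thesis by (rule \<phi>_zero[OF r(1)])
  qed
  have primes: "P = ?m" if "primeideal P R" "x \<in> P" for P
    by (rule W.prime_containing_regular[OF assms(2) xc xreg that])
  define e where "e = \<phi> \<one>\<^bsub>R\<^esub>"
  have e: "e \<in> carrier \<omega>" using \<phi>D(1) by (simp add: e_def)
  have re: "r \<odot>\<^bsub>\<omega>\<^esub> e = \<phi> r" if "r \<in> carrier R" for r
    using \<phi>D(3)[OF that one_closed] that by (simp add: e_def)
  \<comment> \<open>The copy of R in \<omega> is the cyclic submodule of \<open>e\<close>, the form
    in which the chain lemmas take it.\<close>
  have U: "W.cyclic_submodule e = \<phi> ` carrier R"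
    unfolding W.cyclic_submodule_def using re by (intro image_cong) auto
  obtain l where l: "(W.simple_step ^^ l) (W.smult_set x (W.cyclic_submodule e)) (W.cyclic_submodule e)"
    "(W.strict_step ^^ l) (W.smult_set x (W.cyclic_submodule e)) (W.cyclic_submodule e)"
    by (rule W.composition_series[OF xc e primes])
  \<comment> \<open>The \<open>l\<close> that bounds R/xR from below by strict steps now bounds
    \<omega>/x\<omega> from above, as \<open>smult_pow_in_submodule\<close> requires.\<close>
  have socle: "(W.simple_step ^^ l) (W.smult_set x (carrier \<omega>)) (carrier \<omega>)"
  proof (rule W.socle_chain[OF xc e _ _ l(1)])
    show "r = \<zero>\<^bsub>R\<^esub>" if "r \<in> carrier R" "r \<odot>\<^bsub>\<omega>\<^esub> e = \<zero>\<^bsub>\<omega>\<^esub>" for r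
      using \<phi>_zero re that by simp
  qed (rule W.type_one_socle[OF \<omega>(4) _ refl x], simp_all add: \<omega>(3) one_enat_def)
  obtain i :: nat where "\<forall>w\<in>carrier \<omega>. x [^]\<^bsub>R\<^esub> i \<odot>\<^bsub>\<omega>\<^esub> w \<in> \<phi> ` carrier R"
    using W.smult_pow_in_submodule[OF x W.cyclic_submodule_is_submodule[OF e] socle l(2)] unfolding U
    by (rule exE)
  note i = bspec[OF this]
  let ?A = "annihilator R C"
  have xA: "x [^]\<^bsub>R\<^esub> i \<in> ?A"
  proof -
    have "x [^]\<^bsub>R\<^esub> i \<odot>\<^bsub>C\<^esub> y = \<zero>\<^bsub>C\<^esub>" if y: "y \<in> carrier C" for y
    proof -
      obtain w where w: "w \<in> carrier \<omega>" "y = \<psi> w" using y surj by auto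
      show ?thesis using ker i[OF w(1)] \<psi>D(3)[of "x [^]\<^bsub>R\<^esub> i" w] w xc by simp
    qed
    then show ?thesis unfolding annihilator_def using xc by simp
  qed
  have A: "ideal ?A R"
    using C.ideal_colon[OF C.submodule_zero_set subset_refl] by (simp add: annihilator_def)
  \<comment> \<open>The case C = 0 is included: the annihilator is then R, and no prime contains
    it.\<close>
  have "module_dim R C = 0"
    unfolding module_dim_def
  proof (rule W.krull_dim_quotient_zero[OF A])
    fix P assume P: "primeideal P R" "?A \<subseteq> P"
    interpret P: primeideal P R by (rule P(1))
    have "x [^]\<^bsub>R\<^esub> (j::nat) \<in> P \<Longrightarrow> x \<in> P" for j
    proof (induction j)
      case 0
      then show ?case using P.one_imp_carrier P.I_notcarr by simp
    next
      case (Suc j)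
      then show ?case using P.I_prime[of "x [^]\<^bsub>R\<^esub> j" x] xc by auto
    qed
    then show "P = ?m" using primes[OF P(1)] xA P(2) by auto
  qed
  from C.mm_smult_zero_of_multiplicity[OF refl this mult]
  have mC: "a \<odot>\<^bsub>C\<^esub> y = \<zero>\<^bsub>C\<^esub>" if "a \<in> ?m" "y \<in> carrier C" for a y using that .
  show ?thesis
    unfolding nearly_gorenstein_def
  proof
    fix a assume a: "a \<in> ?m"
    note ac = W.mm_carrier[OF a]
    have "\<forall>w\<in>carrier \<omega>. \<exists>r. r \<in> carrier R \<and> \<phi> r = a \<odot>\<^bsub>\<omega>\<^esub> w"
    proof
      fix w assume w: "w \<in> carrier \<omega>"
      have "\<psi> (a \<odot>\<^bsub>\<omega>\<^esub> w) = \<zero>\<^bsub>C\<^esub>" using \<psi>D(1,3) w ac mC[OF a] by simp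
      then have "a \<odot>\<^bsub>\<omega>\<^esub> w \<in> \<phi> ` carrier R" using ker w ac by simp
      then show "\<exists>r. r \<in> carrier R \<and> \<phi> r = a \<odot>\<^bsub>\<omega>\<^esub> w" by auto
    qed
    then obtain f where f: "\<And>w. w \<in> carrier \<omega> \<Longrightarrow> f w \<in> carrier R"
      "\<And>w. w \<in> carrier \<omega> \<Longrightarrow> \<phi> (f w) = a \<odot>\<^bsub>\<omega>\<^esub> w" by (metis bchoice)
    \<comment> \<open>\<open>f\<close> is multiplication by \<open>a\<close> followed by the inverse
      of \<phi>; by injectivity its linearity and its value at \<open>e\<close> can be checked after
      applying \<phi>.\<close>
    have \<phi>_eq: "r = s" if "r \<in> carrier R" "s \<in> carrier R" "\<phi> r = \<phi> s" for r s
      using inj_onD[OF inj that(3,1,2)] .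
    have "f (w \<oplus>\<^bsub>\<omega>\<^esub> w') = f w \<oplus>\<^bsub>R\<^esub> f w'" if "w \<in> carrier \<omega>" "w' \<in> carrier \<omega>" for w w'
      by (rule \<phi>_eq) (use that f \<phi>D(2) ac in \<open>simp_all add: W.smult_r_distr\<close>)
    moreover have "f (r \<odot>\<^bsub>\<omega>\<^esub> w) = r \<otimes>\<^bsub>R\<^esub> f w" if "r \<in> carrier R" "w \<in> carrier \<omega>" for r w
      by (rule \<phi>_eq) (use that f \<phi>D(3) ac in \<open>simp_all add: W.smult_left_commute[OF ac that]\<close>)
    ultimately have "f \<in> module_hom R \<omega> (self_module R)" using f(1) by (simp add: module_hom_def)
    moreover have "f e = a"
      by (rule \<phi>_eq) (use f e ac re in simp_all)
    ultimately have mem: "a \<in> (\<Union>f\<in>module_hom R \<omega> (self_module R). f ` carrier \<omega>)" (is "a \<in> ?T")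
      using e by (metis UN_I imageI)
    have sub: "?T \<subseteq> carrier R" using module_homD(1)[of _ R \<omega> "self_module R"] by auto
    show "a \<in> trace_ideal R \<omega>"
      unfolding trace_ideal_def by (rule subsetD[OF genideal_self[OF sub] mem])
  qed
qed

end
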